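(* Let $0\le\tau\le1$ and $\sigma\ge1$. Let $C_K$ be the curve in the half-plane $\{x\ge0\}$ of the $xz$-plane consisting of a circular arc of radius $\sigma$ and angle $\arcsin\tau$, centered at $(0,0,\sigma-\frac12)$ and starting at the tip $(0,0,-\frac12)$, joined in a $C^1$ fashion to a straight line segment (ending on the constraining plane). Let $\tilde C_K$ be the corresponding $2{*}2$-symmetric curve, consisting of two components whose tips lie at unit distance. Then $\tilde C_K$ is critical for the $(\tau,\sigma)$-clasp problem.
   Context: Symmetry. The group $2{*}2\subset O(3)$ (order 8) is generated by $(x,y,z)\mapsto(-x,y,z)$, $(x,y,z)\mapsto(x,-y,z)$ and $(x,y,z)\mapsto(-y,x,-z)$. A curve $C$ in $\{y=0,x\ge0\}$ starting orthogonally to the $z$-axis at its tip $(0,0,z_0)$ determines the $2{*}2$-symmetric curve $\tilde C$, the union of its images: one component in the $xz$-plane and a congruent one in the $yz$-plane with tip $(0,0,-z_0)$. Clasp problem. Fix $h$ large. The $(\tau,\sigma)$-clasp problem concerns links $L$ of two arcs, the first with one endpoint on each of the planes $\pm\sqrt{1-\tau^2}\,x+\tau z=h$, the second with one endpoint on each of the planes $\pm\sqrt{1-\tau^2}\,y-\tau z=h$ (these are the faces of a large tetrahedron), tangents at endpoints free, and hooked through each other (giving a Hopf link if each component is closed up by segments in its own boundary faces); one minimizes length subject to $\mathrm{Thi}_\sigma(L)\ge1$. Thickness. For a $C^{1,1}$ link $L$ (compact embedded 1-manifold with boundary, $C^{1,1}$ in arclength) and $\sigma\ge\frac12$, $\mathrm{Thi}_\sigma(L)=\min\{2\,\mathrm{reach}(L),\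 \frac1\sigma\min_L\rho\}$, where $\mathrm{reach}(L)$ is the supremal $r$ such that every point within distance less than $r$ of $L$ has a unique nearest point on $L$, and $\rho(x)=\bigl(\limsup_{y\to x}|\kappa(y)|\bigr)^{-1}$, the limsup being over points $y$ where $L$ is twice differentiable ($\kappa$ the curvature vector). Critical for the $(\tau,\sigma)$-clasp problem: $L$ satisfies the endpoint constraints, $\mathrm{Thi}_\sigma(L)=1$, and for every $\xi\in C^2(\mathbb{R}^3,\mathbb{R}^3)$ tangent at each endpoint of $L$ to its constraining plane, $\delta_\xi\mathrm{len}(L)<0$ implies $\delta_\xi\mathrm{Thi}_\sigma(L)<0$. Here $\delta_\xi\mathrm{len}(L)=\int_L\langle\xi',T\rangle ds$ and $\delta_\xi\mathrm{Thi}_\sigma(L)$ is the right derivative at $t=0$ of $\mathrm{Thi}_\sigma(\phi^t(L))$ for any $C^1$ family of $C^2$ diffeomorphisms $\phi^t$ with $\phi^0=\mathrm{Id}$ and initial velocity $\xi$. *)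

theory Defs
  imports "HOL-Analysis.Analysis"
begin

type_synonym space = "real^3"

section \<open>Thickness of links\<close>

definition reach :: "space set \<Rightarrow> ereal" where
  "reach L = Sup {ereal r | r. \<forall>p. infdist p L < r \<longrightarrow> (\<exists>!q. q \<in> L \<and> dist p q = infdist p L)}"

text \<open>
  \<open>L\<close> is twice differentiable in arclength at \<open>y\<close>, with curvature vector \<open>k\<close>. The chart \<open>\<gamma>\<close>
  parametrizes a whole neighbourhood \<open>L \<inter> U\<close> of \<open>y\<close> in \<open>L\<close>, so the second derivative is one-sided
  only if \<open>y\<close> is an endpoint of \<open>L\<close>. Reversing the orientation does not change \<open>k\<close>.
\<close>

definition has_curvature :: "space set \<Rightarrow> space \<Rightarrow> space \<Rightarrow> bool" where
  "has_curvature L y k \<longleftrightarrow>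
    (\<exists>U I \<gamma> \<gamma>inv T s. open U \<and> is_interval I \<and> s \<in> I \<and> I \<noteq> {s} \<and> \<gamma> s = y \<and>
       homeomorphism I (L \<inter> U) \<gamma> \<gamma>inv \<and>
       (\<forall>u\<in>I. (\<gamma> has_vector_derivative T u) (at u within I) \<and> norm (T u) = 1) \<and>
       (T has_vector_derivative k) (at s within I))"

definition curvature :: "space set \<Rightarrow> space \<Rightarrow> space" where
  "curvature L y = (THE k. has_curvature L y k)"

text \<open>The values are extended reals: \<open>curvature_radius L x = \<infinity>\<close> where \<open>L\<close> is locally straight.\<close>

definition curvature_radius :: "space set \<Rightarrow> space \<Rightarrow> ereal" where
  "curvature_radius L x =
    inverse (Limsup (at x within {y. \<exists>k. has_curvature L y k}) (\<lambda>y. ereal (norm (curvature L y))))"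

text \<open>
  The curvature radius is lower semicontinuous, hence its infimum over a compact link is a minimum.
\<close>

definition thickness :: "real \<Rightarrow> space set \<Rightarrow> ereal" where
  "thickness \<sigma> L = min (2 * reach L) (ereal (1 / \<sigma>) * (INF x\<in>L. curvature_radius L x))"


section \<open>First variations\<close>

definition C2_map :: "(space \<Rightarrow> space) \<Rightarrow> bool" where
  "C2_map f \<longleftrightarrow>
    (\<exists>(f' :: space \<Rightarrow> space \<Rightarrow>\<^sub>L space) (f'' :: space \<Rightarrow> space \<Rightarrow>\<^sub>L (space \<Rightarrow>\<^sub>L space)).
       (\<forall>x. (f has_derivative blinfun_apply (f' x)) (at x)) \<and>
       (\<forall>x. (f' has_derivative blinfun_apply (f'' x)) (at x)) \<and>
       continuous_on UNIV f'')"

definition C2_diffeo :: "(space \<Rightarrow> space) \<Rightarrow> bool" where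
  "C2_diffeo f \<longleftrightarrow> bij f \<and> C2_map f \<and> C2_map (inv f)"

text \<open>
  A \<open>C\<^sup>1\<close> family \<open>\<phi>\<close> of \<open>C\<^sup>2\<close> diffeomorphisms, defined for parameters near \<open>0\<close>, starting at the
  identity with initial velocity \<open>\<xi>\<close>. The family is \<open>C\<^sup>1\<close> in the topology of locally uniform
  convergence of maps together with their spatial derivatives \<open>F1\<close>, \<open>F2\<close> of order one and two:
  \<open>G0\<close>, \<open>G1\<close>, \<open>G2\<close> are the time derivatives of \<open>\<phi>\<close>, \<open>F1\<close>, \<open>F2\<close>, jointly continuous in time and space.
\<close>

definition C1_family :: "(space \<Rightarrow> space) \<Rightarrow> (real \<Rightarrow> space \<Rightarrow> space) \<Rightarrow> bool" where
  "C1_family \<xi> \<phi> \<longleftrightarrow>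
    (\<exists>\<epsilon>>0. \<exists>(F1 :: real \<Rightarrow> space \<Rightarrow> space \<Rightarrow>\<^sub>L space)
       (F2 :: real \<Rightarrow> space \<Rightarrow> space \<Rightarrow>\<^sub>L (space \<Rightarrow>\<^sub>L space)) G0 G1 G2.
       (\<forall>t\<in>{-\<epsilon><..<\<epsilon>}. C2_diffeo (\<phi> t) \<and>
         (\<forall>x. (\<phi> t has_derivative blinfun_apply (F1 t x)) (at x) \<and>
              (F1 t has_derivative blinfun_apply (F2 t x)) (at x) \<and>
              ((\<lambda>u. \<phi> u x) has_vector_derivative G0 t x) (at t) \<and>
              ((\<lambda>u. F1 u x) has_vector_derivative G1 t x) (at t) \<and>
              ((\<lambda>u. F2 u x) has_vector_derivative G2 t x) (at t))) \<and>
       continuous_on ({-\<epsilon><..<\<epsilon>} \<times> UNIV) (\<lambda>(t, x). G0 t x) \<and>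
       continuous_on ({-\<epsilon><..<\<epsilon>} \<times> UNIV) (\<lambda>(t, x). G1 t x) \<and>
       continuous_on ({-\<epsilon><..<\<epsilon>} \<times> UNIV) (\<lambda>(t, x). G2 t x) \<and>
       \<phi> 0 = id \<and> G0 0 = \<xi>)"

text \<open>
  \<open>D\<close> is the first variation of thickness of \<open>L\<close> in the direction \<open>\<xi>\<close>: the right derivative exists
  for every such family, and always has the same value \<open>D\<close>.
\<close>

definition has_thickness_variation :: "real \<Rightarrow> space set \<Rightarrow> (space \<Rightarrow> space) \<Rightarrow> real \<Rightarrow> bool" where
  "has_thickness_variation \<sigma> L \<xi> D \<longleftrightarrow>
    (\<forall>\<phi>. C1_family \<xi> \<phi> \<longrightarrow>
       ((\<lambda>t. real_of_ereal (thickness \<sigma> (\<phi> t ` L))) has_real_derivative D) (at_right 0))"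

definition C11_arc :: "(real \<Rightarrow> space) \<Rightarrow> real \<Rightarrow> bool" where
  "C11_arc \<gamma> l \<longleftrightarrow> 0 < l \<and> inj_on \<gamma> {0..l} \<and>
    (\<exists>T M. (\<forall>s\<in>{0..l}. (\<gamma> has_vector_derivative T s) (at s within {0..l}) \<and> norm (T s) = 1) \<and>
           M-lipschitz_on {0..l} T)"

definition length_variation :: "(space \<Rightarrow> space) \<Rightarrow> (real \<Rightarrow> space) \<Rightarrow> real \<Rightarrow> real" where
  "length_variation \<xi> \<gamma> l =
    integral {0..l} (\<lambda>s. vector_derivative (\<lambda>u. \<xi> (\<gamma> u)) (at s within {0..l}) \<bullet>
                         vector_derivative \<gamma> (at s within {0..l}))"


section \<open>The clasp problem\<close>

text \<open>
  Normals of the four constraining planes \<open>{p. p \<bullet> n = h}\<close>, where \<open>e\<close> is \<open>1\<close> or \<open>-1\<close>: the first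
  component of a link has an endpoint on each \<open>face_normal1\<close> plane, the second on each
  \<open>face_normal2\<close> plane.
\<close>

definition face_normal1 :: "real \<Rightarrow> real \<Rightarrow> space" where
  "face_normal1 \<tau> e = vector [e * sqrt (1 - \<tau>\<^sup>2), 0, \<tau>]"

definition face_normal2 :: "real \<Rightarrow> real \<Rightarrow> space" where
  "face_normal2 \<tau> e = vector [0, e * sqrt (1 - \<tau>\<^sup>2), - \<tau>]"

text \<open>
  The arcs are parametrized by arclength, oriented from the face \<open>e = -1\<close> to the face \<open>e = 1\<close>.
\<close>

definition clasp_critical :: "real \<Rightarrow> real \<Rightarrow> real \<Rightarrow> space set \<Rightarrow> bool" where
  "clasp_critical h \<tau> \<sigma> L \<longleftrightarrow>
    (\<exists>\<gamma>1 l1 \<gamma>2 l2.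
       C11_arc \<gamma>1 l1 \<and> C11_arc \<gamma>2 l2 \<and>
       \<gamma>1 ` {0..l1} \<inter> \<gamma>2 ` {0..l2} = {} \<and> L = \<gamma>1 ` {0..l1} \<union> \<gamma>2 ` {0..l2} \<and>
       \<gamma>1 0 \<bullet> face_normal1 \<tau> (-1) = h \<and> \<gamma>1 l1 \<bullet> face_normal1 \<tau> 1 = h \<and>
       \<gamma>2 0 \<bullet> face_normal2 \<tau> (-1) = h \<and> \<gamma>2 l2 \<bullet> face_normal2 \<tau> 1 = h \<and>
       thickness \<sigma> L = 1 \<and>
       (\<forall>\<xi>. C2_map \<xi> \<and>
            \<xi> (\<gamma>1 0) \<bullet> face_normal1 \<tau> (-1) = 0 \<and> \<xi> (\<gamma>1 l1) \<bullet> face_normal1 \<tau> 1 = 0 \<and>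
            \<xi> (\<gamma>2 0) \<bullet> face_normal2 \<tau> (-1) = 0 \<and> \<xi> (\<gamma>2 l2) \<bullet> face_normal2 \<tau> 1 = 0 \<and>
            length_variation \<xi> \<gamma>1 l1 + length_variation \<xi> \<gamma>2 l2 < 0 \<longrightarrow>
            (\<exists>D<0. has_thickness_variation \<sigma> L \<xi> D)))"


section \<open>The symmetric kinky clasp\<close>

text \<open>
  The group \<open>2*2\<close>. The generators have finite order, so closing under composition suffices.
\<close>

inductive_set star22 :: "(space \<Rightarrow> space) set" where
  one: "id \<in> star22"
| reflect_x: "f \<in> star22 \<Longrightarrow> (\<lambda>p. vector [- p$1, p$2, p$3]) \<circ> f \<in> star22"
| reflect_y: "f \<in> star22 \<Longrightarrow> (\<lambda>p. vector [p$1, - p$2, p$3]) \<circ> f \<in> star22"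
| rotate_reflect: "f \<in> star22 \<Longrightarrow> (\<lambda>p. vector [- p$2, p$1, - p$3]) \<circ> f \<in> star22"

definition symmetrize :: "space set \<Rightarrow> space set" where
  "symmetrize C = (\<Union>g\<in>star22. g ` C)"

text \<open>
  The point of the circle of radius \<open>\<sigma>\<close> about \<open>(0, 0, \<sigma> - 1/2)\<close> at angle \<open>\<theta>\<close> from its lowest point,
  and the unit tangent there.
\<close>

definition kink_point :: "real \<Rightarrow> real \<Rightarrow> space" where
  "kink_point \<sigma> \<theta> = vector [\<sigma> * sin \<theta>, 0, \<sigma> - 1/2 - \<sigma> * cos \<theta>]"

definition kink_tangent :: "real \<Rightarrow> space" where
  "kink_tangent \<theta> = vector [cos \<theta>, 0, sin \<theta>]"

text \<open>
  At the angle \<open>arcsin \<tau>\<close> the arc is continued by the tangential segment up to the constraining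
  plane.
\<close>

definition kinky_curve :: "real \<Rightarrow> real \<Rightarrow> real \<Rightarrow> space set" where
  "kinky_curve h \<tau> \<sigma> =
    kink_point \<sigma> ` {0..arcsin \<tau>} \<union>
    {p. \<exists>s\<ge>0. p = kink_point \<sigma> (arcsin \<tau>) + s *\<^sub>R kink_tangent (arcsin \<tau>) \<and>
              p \<bullet> face_normal1 \<tau> 1 \<le> h}"

end

theory Submission
  imports Defs
begin

text \<open>
  The length of the clasp can only decrease through its circular arcs. For a variation field \<open>\<xi>\<close>
  with normal component \<open>w\<close> on an arc, \<open>\<delta>len = - \<integral> w d\<theta>\<close>, because the clasp meets the constraining
  planes orthogonally, while the radius of curvature divided by \<open>\<sigma>\<close> varies by
  \<open>- (w'' + w) / \<sigma>\<close> and the distance of the tips by \<open>- w(0)\<close>, summed over both components. The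
  function \<open>f(\<theta>) = \<sigma> (1 - cos (\<alpha> - \<bar>\<theta>\<bar>))\<close> is nonnegative, solves \<open>f'' + f = \<sigma>\<close> off the tip, vanishes
  to first order at the junctions, and its derivative jumps by \<open>- 2 \<sigma> \<tau>\<close> at the tip. Integration by
  parts therefore expresses \<open>\<delta>len\<close> as a combination with nonnegative weights \<open>f\<close> and \<open>2 \<tau>\<close> of
  first variations of active constraints. By Danskin's theorem, the first variation of thickness is
  the least of the variations of all active constraints, so \<open>\<delta>len < 0\<close> makes it negative.
\<close>

section \<open>Directional derivatives of minima\<close>

text \<open>The balance of first variations presupposes an exact formula for the thickness of the
  image of the clasp under every nearby map, although the clasp is only C11 and
  \<open>curvature_radius\<close> is the reciprocal of a limsup. Two strict margins provide it.
  Since \<sigma> is at least 1, each component alone keeps unique nearest points well beyond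
  distance 1/2, so that the reach of the link is half the distance of its components. The legs are
  straight, so that after a small perturbation the sharpest curvature still occurs on the arcs. Near
  the identity, thickness is therefore the least of three infima over fixed compact parameter sets:
  the distance of two points on different components and, for each component, the curvature radius
  on the closed arc. Squares of these quantities are used, because they are rational in velocities
  and accelerations; the square root contributes only a factor 1/2, all values being 1 at the start.
  For \<tau> = 0 there is no arc and no curvature constraint; the length variation of an admissible
  field is then never negative, so the condition of criticality holds vacuously.\<close>

lemma has_real_derivative_quadratic:
  fixes f :: "real \<Rightarrow> real"
  assumes "\<And>y. \<bar>f y - f x - (y - x) * d\<bar> \<le> C * (y - x)\<^sup>2"
  shows "(f has_real_derivative d) (at x)"
proof -
  have "((\<lambda>y. (f y - f x) / (y - x) - d) \<longlongrightarrow> 0) (at x)"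
  proof (rule Lim_null_comparison)
    show "((\<lambda>y. C * \<bar>y - x\<bar>) \<longlongrightarrow> 0) (at x)"
      by (auto intro!: tendsto_eq_intros)
    have "norm ((f y - f x) / (y - x) - d) \<le> C * \<bar>y - x\<bar>" if "y \<noteq> x" for y
    proof -
      have "(f y - f x) / (y - x) - d = (f y - f x - (y - x) * d) / (y - x)"
        using that by (simp add: field_simps)
      then have "norm ((f y - f x) / (y - x) - d) = \<bar>f y - f x - (y - x) * d\<bar> / \<bar>y - x\<bar>"
        by (simp add: abs_divide)
      also have "\<dots> \<le> C * (y - x)\<^sup>2 / \<bar>y - x\<bar>"
        by (intro divide_right_mono assms) auto
      also have "\<dots> = C * \<bar>y - x\<bar>"
        using that by (simp add: power2_eq_square divide_eq_eq mult.assoc)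
      finally show ?thesis .
    qed
    then show "\<forall>\<^sub>F y in at x. norm ((f y - f x) / (y - x) - d) \<le> C * \<bar>y - x\<bar>"
      by (auto simp: eventually_at intro: exI[of _ 1])
  qed
  then show ?thesis
    by (simp add: has_field_derivative_iff LIM_zero_iff)
qed

text \<open>Uniform continuity on the compact product of \<open>{0..e/2}\<close> with K turns joint
  continuity into closeness to the initial value that is uniform in the parameter.\<close>

lemma uniformly_near_initial_time:
  fixes f :: "real \<Rightarrow> 'a::metric_space \<Rightarrow> 'b::metric_space"
  assumes "compact K" "0 < e" and cont: "continuous_on ({0..<e} \<times> K) (\<lambda>(t, z). f t z)" and "0 < \<eta>"
  obtains \<delta> where "0 < \<delta>" "\<delta> < e" "\<And>t z. t \<in> {0..\<delta>} \<Longrightarrow> z \<in> K \<Longrightarrow> dist (f t z) (f 0 z) < \<eta>"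
proof -
  have "compact ({0..e/2} \<times> K)"
    using assms by (simp add: compact_Times)
  moreover have "continuous_on ({0..e/2} \<times> K) (\<lambda>(t, z). f t z)"
    by (rule continuous_on_subset[OF cont]) (use \<open>0 < e\<close> in auto)
  ultimately have "uniformly_continuous_on ({0..e/2} \<times> K) (\<lambda>(t, z). f t z)"
    by (rule compact_uniformly_continuous[rotated])
  then obtain d where "0 < d"
    and d: "\<And>p q. p \<in> {0..e/2} \<times> K \<Longrightarrow> q \<in> {0..e/2} \<times> K \<Longrightarrow> dist q p < d \<Longrightarrow>
      dist (case q of (t, z) \<Rightarrow> f t z) (case p of (t, z) \<Rightarrow> f t z) < \<eta>"
    using \<open>0 < \<eta>\<close> unfolding uniformly_continuous_on_def by metis
  show ?thesis
  proof
    show "0 < min (d/2) (e/2)" "min (d/2) (e/2) < e"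
      using \<open>0 < d\<close> \<open>0 < e\<close> by auto
    fix t z assume "t \<in> {0..min (d/2) (e/2)}" "z \<in> K"
    then show "dist (f t z) (f 0 z) < \<eta>"
      using d[of "(0, z)" "(t, z)"] \<open>0 < d\<close> \<open>0 < e\<close> by (auto simp: dist_Pair_Pair)
  qed
qed

text \<open>For the upper bound it is enough to follow a single initial minimizer of least rate. For
  the lower bound, parameters of nearly sufficient rate are controlled by the mean value theorem,
  and the others start strictly above the minimum, by an amount that compactness makes
  uniform.\<close>

lemma danskin:
  fixes f g :: "real \<Rightarrow> 'a::metric_space \<Rightarrow> real"
  assumes K: "compact K" "K \<noteq> {}" and "0 < e"
    and deriv: "\<And>t z. t \<in> {0..<e} \<Longrightarrow> z \<in> K \<Longrightarrow> ((\<lambda>u. f u z) has_real_derivative g t z) (at t)"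
    and cont_g: "continuous_on ({0..<e} \<times> K) (\<lambda>(t, z). g t z)"
    and cont_f: "continuous_on K (f 0)"
  shows "((\<lambda>t. INF z\<in>K. f t z) has_real_derivative
           (INF z\<in>{z\<in>K. f 0 z = (INF z\<in>K. f 0 z)}. g 0 z)) (at_right 0)"
proof -
  define m where "m t = (INF z\<in>K. f t z)" for t
  define Z where "Z = {z\<in>K. f 0 z = m 0}"
  define D where "D = (INF z\<in>Z. g 0 z)"
  have cont_g0: "continuous_on K (g 0)"
  proof -
    have "continuous_on K (\<lambda>z. (\<lambda>(t, z). g t z) (0, z))"
      by (rule continuous_on_compose2[OF cont_g]) (use \<open>0 < e\<close> in \<open>auto intro!: continuous_intros\<close>)
    then show ?thesis by simp
  qed
  have bdd0: "bdd_below (f 0 ` K)"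
    using K cont_f by (meson bounded_imp_bdd_below compact_continuous_image compact_imp_bounded)
  have f0_ge: "m 0 \<le> f 0 z" if "z \<in> K" for z
    unfolding m_def by (rule cINF_lower[OF bdd0 that])
  obtain z0 where z0: "z0 \<in> K" "\<And>z. z \<in> K \<Longrightarrow> f 0 z0 \<le> f 0 z"
    using continuous_attains_inf[OF K cont_f] by blast
  have "m 0 = f 0 z0"
    using f0_ge[OF z0(1)] K z0 by (simp add: m_def antisym cINF_greatest)
  then have "z0 \<in> Z" by (simp add: Z_def z0)
  then have "Z \<noteq> {}" by blast
  have "compact Z"
  proof -
    have "Z = K \<inter> (K \<inter> f 0 -` {m 0})" by (auto simp: Z_def)
    moreover have "compact (K \<inter> (K \<inter> f 0 -` {m 0}))"
      by (intro compact_Int_closed continuous_closed_preimage cont_f K closed_singleton compact_imp_closed)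
    ultimately show ?thesis by simp
  qed
  have bddg: "bdd_below (g 0 ` Z)"
    using \<open>compact Z\<close> continuous_on_subset[OF cont_g0, of Z]
    by (metis (no_types, lifting) Z_def bounded_imp_bdd_below compact_continuous_image compact_imp_bounded
        mem_Collect_eq subsetI)
  have D_le: "D \<le> g 0 z" if "z \<in> Z" for z
    unfolding D_def by (rule cINF_lower[OF bddg that])
  obtain zD where zD: "zD \<in> Z" "g 0 zD = D"
  proof -
    have "continuous_on Z (g 0)"
      by (rule continuous_on_subset[OF cont_g0]) (auto simp: Z_def)
    from continuous_attains_inf[OF \<open>compact Z\<close> \<open>Z \<noteq> {}\<close> this]
    obtain z where z: "z \<in> Z" "\<And>y. y \<in> Z \<Longrightarrow> g 0 z \<le> g 0 y" by blast
    then have "g 0 z = D"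
      using D_le[OF z(1)] \<open>Z \<noteq> {}\<close> by (simp add: D_def antisym cINF_greatest)
    with z that show ?thesis by blast
  qed
  have lower: "\<exists>\<delta>>0. \<forall>t\<in>{0<..<\<delta>}. \<forall>z\<in>K. m 0 + t * (D - \<eta>) \<le> f t z" if "0 < \<eta>" for \<eta>
  proof -
    obtain \<delta> where \<delta>: "0 < \<delta>" "\<delta> < e"
      and near: "\<And>t z. t \<in> {0..\<delta>} \<Longrightarrow> z \<in> K \<Longrightarrow> dist (g t z) (g 0 z) < \<eta>/2"
      using uniformly_near_initial_time[OF K(1) \<open>0 < e\<close> cont_g, of "\<eta>/2"] \<open>0 < \<eta>\<close> by auto
    have grow: "f 0 z + t * (g 0 z - \<eta>/2) \<le> f t z" if "t \<in> {0<..<\<delta>}" "z \<in> K" for t z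
    proof -
      have "\<exists>u>0. u < t \<and> f t z - f 0 z = (t - 0) * g u z"
        by (rule MVT2) (use that \<delta> deriv in auto)
      then obtain u where u: "0 < u" "u < t" "f t z - f 0 z = t * g u z" by auto
      have "g 0 z - \<eta>/2 \<le> g u z"
        using near[of u z] that u by (simp add: dist_real_def abs_if split: if_splits)
      then have "t * (g 0 z - \<eta>/2) \<le> t * g u z"
        using that by (intro mult_left_mono) auto
      with u show ?thesis by linarith
    qed
    define K' where "K' = K \<inter> (K \<inter> g 0 -` {..D - \<eta>/2})"
    have "compact K'"
      unfolding K'_def
      by (intro compact_Int_closed continuous_closed_preimage cont_g0 K closed_atMost compact_imp_closed)
    have "\<exists>\<mu>>0. \<forall>z\<in>K'. m 0 + \<mu> \<le> f 0 z"
    proof (cases "K' = {}")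
      case False
      have "continuous_on K' (f 0)"
        by (rule continuous_on_subset[OF cont_f]) (auto simp: K'_def)
      from continuous_attains_inf[OF \<open>compact K'\<close> False this]
      obtain z where z: "z \<in> K'" "\<And>y. y \<in> K' \<Longrightarrow> f 0 z \<le> f 0 y" by blast
      have "z \<notin> Z"
        using z(1) D_le[of z] \<open>0 < \<eta>\<close> by (auto simp: K'_def)
      then have "m 0 < f 0 z"
        using z(1) f0_ge[of z] by (auto simp: K'_def Z_def)
      then show ?thesis
        using z by (intro exI[of _ "f 0 z - m 0"]) auto
    qed (auto intro: exI[of _ 1])
    then obtain \<mu> where \<mu>: "0 < \<mu>" "\<And>z. z \<in> K' \<Longrightarrow> m 0 + \<mu> \<le> f 0 z" by blast
    have "bounded (g 0 ` K)"
      by (simp add: K(1) compact_continuous_image compact_imp_bounded cont_g0)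
    then obtain B where B: "\<And>z. z \<in> K \<Longrightarrow> \<bar>g 0 z\<bar> \<le> B" "0 < B"
      unfolding bounded_pos by auto
    define C where "C = \<bar>D\<bar> + B + \<eta>"
    have "0 < C" using B \<open>0 < \<eta>\<close> by (simp add: C_def)
    show ?thesis
    proof (intro exI[of _ "min \<delta> (\<mu> / C)"] conjI ballI)
      show "0 < min \<delta> (\<mu> / C)" using \<open>0 < C\<close> \<mu> \<delta> by simp
      fix t z assume t: "t \<in> {0<..<min \<delta> (\<mu> / C)}" and "z \<in> K"
      have g: "f 0 z + t * (g 0 z - \<eta>/2) \<le> f t z"
        using grow[of t z] t \<open>z \<in> K\<close> by auto
      show "m 0 + t * (D - \<eta>) \<le> f t z"
      proof (cases "z \<in> K'")
        case True
        have "t * C < \<mu>" using t \<open>0 < C\<close> by (simp add: field_simps)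
        moreover have "t * (D - g 0 z - \<eta>/2) \<le> t * C"
          using B(1)[OF \<open>z \<in> K\<close>] B(2) \<open>0 < \<eta>\<close> t by (intro mult_left_mono) (auto simp: C_def)
        ultimately show ?thesis
          using g \<mu>(2)[OF True] by (simp add: algebra_simps)
      next
        case False
        then have "D - \<eta> \<le> g 0 z - \<eta>/2" using \<open>z \<in> K\<close> by (auto simp: K'_def)
        then have "t * (D - \<eta>) \<le> t * (g 0 z - \<eta>/2)"
          using t by (intro mult_left_mono) auto
        then show ?thesis using g f0_ge[OF \<open>z \<in> K\<close>] by linarith
      qed
    qed
  qed
  have lim: "((\<lambda>t. (m t - m 0) / (t - 0)) \<longlongrightarrow> D) (at_right 0)"
  proof (rule order_tendstoI)
    fix a assume "a < D"
    then obtain \<delta> where "0 < \<delta>"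
      and \<delta>: "\<And>t z. t \<in> {0<..<\<delta>} \<Longrightarrow> z \<in> K \<Longrightarrow> m 0 + t * (D - (D - a)/2) \<le> f t z"
      using lower[of "(D - a)/2"] by auto
    have "a < (m t - m 0) / (t - 0)" if "t \<in> {0<..<\<delta>}" for t
    proof -
      have "m 0 + t * (D - (D - a)/2) \<le> m t"
        unfolding m_def[of t] by (rule cINF_greatest[OF K(2) \<delta>[OF that]])
      then have "D - (D - a)/2 \<le> (m t - m 0) / t"
        using that by (simp add: field_simps)
      moreover have "a < D - (D - a)/2" using \<open>a < D\<close> by (simp add: field_simps)
      ultimately have "a < (m t - m 0) / t" by (rule less_le_trans[rotated])
      then show ?thesis by simp
    qed
    then show "\<forall>\<^sub>F t in at_right 0. a < (m t - m 0) / (t - 0)"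
      using \<open>0 < \<delta>\<close> eventually_at_right_field by fastforce
  next
    fix a assume "D < a"
    have "((\<lambda>u. f u zD) has_real_derivative g 0 zD) (at 0)"
      using deriv[of 0 zD] zD \<open>0 < e\<close> by (auto simp: Z_def)
    then have "((\<lambda>t. (f t zD - f 0 zD) / (t - 0)) \<longlongrightarrow> D) (at_right 0)"
      unfolding has_field_derivative_iff zD by (rule tendsto_mono[rotated]) (simp add: at_le)
    then have ev: "\<forall>\<^sub>F t in at_right 0. (f t zD - f 0 zD) / (t - 0) < a"
      using \<open>D < a\<close> order_tendstoD by blast
    \<comment> \<open>A real \<open>INF\<close> is a lower bound only over a set that is bounded
      below; for positive t this is read off from the linear lower estimate, with the arbitrary
      tolerance 1.\<close>
    obtain \<delta> where "0 < \<delta>"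
      and \<delta>: "\<And>t z. t \<in> {0<..<\<delta>} \<Longrightarrow> z \<in> K \<Longrightarrow> m 0 + t * (D - 1) \<le> f t z"
      using lower[of 1] by auto
    have "m t \<le> f t zD" if "0 < t" "t < \<delta>" for t
    proof -
      have "bdd_below (f t ` K)"
        using \<delta>[of t] that by (intro bdd_belowI2) auto
      then show ?thesis
        unfolding m_def[of t] using zD by (intro cINF_lower) (auto simp: Z_def)
    qed
    then have "\<forall>\<^sub>F t in at_right 0. m t \<le> f t zD \<and> 0 < t"
      using \<open>0 < \<delta>\<close> eventually_at_right_field by blast
    with ev show "\<forall>\<^sub>F t in at_right 0. (m t - m 0) / (t - 0) < a"
    proof (eventually_elim)
      case (elim t)
      moreover have "f 0 zD = m 0" using zD by (simp add: Z_def)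
      ultimately have "(m t - m 0) / (t - 0) \<le> (f t zD - f 0 zD) / (t - 0)"
        by (auto intro!: divide_right_mono)
      with elim show ?case by linarith
    qed
  qed
  show ?thesis
    using lim unfolding has_field_derivative_iff m_def D_def Z_def .
qed

text \<open>Both functions start at the same value, so for positive t the difference quotient of the
  minimum is the minimum of the difference quotients.\<close>

lemma has_real_derivative_min_right:
  fixes f g :: "real \<Rightarrow> real"
  assumes f: "(f has_real_derivative F) (at_right 0)" and g: "(g has_real_derivative G) (at_right 0)"
    and eq: "f 0 = g 0"
  shows "((\<lambda>t. min (f t) (g t)) has_real_derivative min F G) (at_right 0)"
proof -
  have "((\<lambda>t. min ((f t - f 0) / (t - 0)) ((g t - g 0) / (t - 0))) \<longlongrightarrow> min F G) (at_right 0)"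
    using f g unfolding has_field_derivative_iff by (rule tendsto_min)
  moreover have "min ((f t - f 0) / (t - 0)) ((g t - g 0) / (t - 0)) =
      (min (f t) (g t) - min (f 0) (g 0)) / (t - 0)" if "0 < t" for t
    using that eq by (auto simp: min_def divide_le_cancel)
  ultimately show ?thesis
    unfolding has_field_derivative_iff
    by (subst (asm) tendsto_cong[of _ "\<lambda>t. (min (f t) (g t) - min (f 0) (g 0)) / (t - 0)"])
      (auto simp: eventually_at_filter)
qed

section \<open>Families of maps and curvature of links\<close>

lemma has_vector_derivative_tendsto:
  assumes "(f has_vector_derivative f') (at x within S)"
  shows "((\<lambda>y. (f y - f x) /\<^sub>R (y - x)) \<longlongrightarrow> f') (at x within S)"
proof -
  have "((\<lambda>y. norm (f y - f x - (y - x) *\<^sub>R f') / norm (y - x)) \<longlongrightarrow> 0) (at x within S)"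
    using assms by (simp add: has_vector_derivative_def has_derivative_iff_norm)
  moreover have "norm (f y - f x - (y - x) *\<^sub>R f') / norm (y - x) = norm ((f y - f x) /\<^sub>R (y - x) - f')"
    if "y \<noteq> x" for y
  proof -
    have "(f y - f x) /\<^sub>R (y - x) - f' = (f y - f x - (y - x) *\<^sub>R f') /\<^sub>R (y - x)"
      using that by (simp add: scaleR_diff_right)
    then show ?thesis by (simp add: divide_inverse mult.commute)
  qed
  ultimately have "((\<lambda>y. norm ((f y - f x) /\<^sub>R (y - x) - f')) \<longlongrightarrow> 0) (at x within S)"
    by (subst (asm) tendsto_cong[of _ "\<lambda>y. norm ((f y - f x) /\<^sub>R (y - x) - f')"])
      (auto simp: eventually_at_filter)
  then show ?thesis
    by (simp add: tendsto_norm_zero_iff LIM_zero_iff)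
qed

text \<open>A \<open>C1_family\<close> provides joint continuity only for the time derivatives.
  Their local boundedness makes the maps Lipschitz in time, uniformly near a point of space; with
  continuity in space at a fixed time this gives joint continuity of the maps themselves.\<close>

lemma continuous_on_time_derivative:
  fixes F G :: "real \<Rightarrow> 'a::metric_space \<Rightarrow> 'b::real_normed_vector"
  assumes deriv: "\<And>t x. t \<in> {-e<..<e} \<Longrightarrow> ((\<lambda>u. F u x) has_vector_derivative G t x) (at t)"
    and cont_G: "continuous_on ({-e<..<e} \<times> UNIV) (\<lambda>(t, x). G t x)"
    and cont_F: "\<And>t. t \<in> {-e<..<e} \<Longrightarrow> continuous_on UNIV (F t)"
  shows "continuous_on ({-e<..<e} \<times> UNIV) (\<lambda>(t, x). F t x)"
  unfolding continuous_on_def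
proof safe
  fix t0 :: real and x0 :: 'a
  assume t0: "t0 \<in> {-e<..<e}"
  define S where "S = {-e<..<e} \<times> (UNIV :: 'a set)"
  have "open S" by (simp add: S_def open_Times)
  have "((\<lambda>(t, x). G t x) \<longlongrightarrow> G t0 x0) (at (t0, x0))"
    using cont_G t0 \<open>open S\<close> by (auto simp: continuous_on_eq_continuous_at S_def isCont_def)
  then have "\<forall>\<^sub>F p in at (t0, x0). dist (G (fst p) (snd p)) (G t0 x0) < 1"
    by (auto simp: case_prod_unfold dest: tendstoD[where e=1])
  then obtain d where "0 < d"
    and d: "\<And>p. p \<noteq> (t0, x0) \<Longrightarrow> dist p (t0, x0) < d \<Longrightarrow> dist (G (fst p) (snd p)) (G t0 x0) < 1"
    by (auto simp: eventually_at)
  obtain r where "0 < r" and r: "ball t0 r \<subseteq> {-e<..<e}"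
    using t0 by (meson open_contains_ball open_greaterThanLessThan)
  define \<delta> where "\<delta> = min r (d/2)"
  have "0 < \<delta>" using \<open>0 < r\<close> \<open>0 < d\<close> by (simp add: \<delta>_def)
  define M where "M = norm (G t0 x0) + 1"
  have bound: "norm (F t x - F t0 x) \<le> M * norm (t - t0)" if "dist t t0 < \<delta>" "dist x x0 < \<delta>" for t x
    proof (rule differentiable_bound)
      show "convex (ball t0 \<delta>)" by simp
      fix u assume u: "u \<in> ball t0 \<delta>"
      then have "u \<in> {-e<..<e}" using r by (auto simp: \<delta>_def)
      from deriv[OF this]
      show "((\<lambda>u. F u x) has_derivative (\<lambda>h. h *\<^sub>R G u x)) (at u within ball t0 \<delta>)"
        by (auto simp: has_vector_derivative_def intro: has_derivative_at_withinI)
      have "norm (G u x) \<le> M"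
      proof (cases "(u, x) = (t0, x0)")
        case True
        then show ?thesis by (simp add: M_def)
      next
        case False
        have "dist (u, x) (t0, x0) \<le> dist u t0 + dist x x0"
          by (simp add: dist_Pair_Pair sqrt_sum_squares_le_sum)
        also have "\<dots> < d" using u that by (auto simp: \<delta>_def dist_commute)
        finally have "dist (G u x) (G t0 x0) < 1" using d[of "(u, x)"] False by auto
        then show ?thesis
          using norm_triangle_ineq2[of "G u x" "G t0 x0"] by (simp add: M_def dist_norm)
      qed
      then show "onorm (\<lambda>h. h *\<^sub>R G u x) \<le> M"
        by (intro onorm_le) (simp add: mult.commute[of M] mult_left_mono)
    qed (use that \<open>0 < \<delta>\<close> in \<open>auto simp: dist_commute\<close>)
  have "((\<lambda>p. F (fst p) (snd p) - F t0 (snd p)) \<longlongrightarrow> 0) (at (t0, x0) within S)"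
  proof (rule Lim_null_comparison)
    have "\<forall>\<^sub>F p in at (t0, x0) within S. dist p (t0, x0) < \<delta>"
      using \<open>0 < \<delta>\<close> by (auto simp: eventually_at)
    then show "\<forall>\<^sub>F p in at (t0, x0) within S. norm (F (fst p) (snd p) - F t0 (snd p)) \<le> M * norm (fst p - t0)"
    proof eventually_elim
      case (elim p)
      then show ?case
        using dist_fst_le[of p "(t0, x0)"] dist_snd_le[of p "(t0, x0)"]
        by (intro bound) auto
    qed
    show "((\<lambda>p. M * norm (fst p - t0)) \<longlongrightarrow> 0) (at (t0, x0) within S)"
      by (auto intro!: tendsto_eq_intros)
  qed
  moreover have "((\<lambda>p. F t0 (snd p)) \<longlongrightarrow> F t0 x0) (at (t0, x0) within S)"
  proof -
    have "isCont (F t0) x0" using cont_F[OF t0] by (simp add: continuous_on_eq_continuous_at)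
    then show ?thesis
      by (rule isCont_tendsto_compose) (auto intro!: tendsto_eq_intros)
  qed
  ultimately have "((\<lambda>p. F (fst p) (snd p)) \<longlongrightarrow> F t0 x0) (at (t0, x0) within S)"
    using tendsto_add by fastforce
  then show "((\<lambda>(t, x). F t x) \<longlongrightarrow> F t0 x0) (at (t0, x0) within {-e<..<e} \<times> UNIV)"
    by (simp add: S_def case_prod_unfold)
qed

text \<open>Time and space derivatives are interchanged, so that \<open>G1 0\<close> and
  \<open>G2 0\<close> turn out to be the derivatives of the initial velocity and hence the same for
  all families. The mean value theorem in time bounds
  \<open>F1 u - F1 0 - u *\<^sub>R G1 0 x\<close> by \<eta> times the absolute value of u; the mean
  value theorem in space transfers this bound to \<open>\<phi>\<close>; dividing by u and letting u
  tend to 0 gives the claim.\<close>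

lemma has_derivative_time_derivative:
  fixes \<phi> G0 :: "real \<Rightarrow> 'a::real_normed_vector \<Rightarrow> 'b::real_normed_vector" and F1 G1 :: "real \<Rightarrow> 'a \<Rightarrow> 'a \<Rightarrow>\<^sub>L 'b"
  assumes "0 < e"
    and \<phi>: "\<And>t x. t \<in> {-e<..<e} \<Longrightarrow> (\<phi> t has_derivative blinfun_apply (F1 t x)) (at x)"
    and G0: "\<And>t x. t \<in> {-e<..<e} \<Longrightarrow> ((\<lambda>u. \<phi> u x) has_vector_derivative G0 t x) (at t)"
    and G1: "\<And>t x. t \<in> {-e<..<e} \<Longrightarrow> ((\<lambda>u. F1 u x) has_vector_derivative G1 t x) (at t)"
    and cont: "continuous_on ({-e<..<e} \<times> UNIV) (\<lambda>(t, x). G1 t x)"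
  shows "(G0 0 has_derivative blinfun_apply (G1 0 x)) (at x)"
  unfolding has_derivative_at_alt
proof (intro conjI allI impI)
  show "bounded_linear (blinfun_apply (G1 0 x))" by (rule blinfun.bounded_linear_right)
  fix \<eta> :: real assume "0 < \<eta>"
  have "open ({-e<..<e} \<times> (UNIV :: 'a set))" by (simp add: open_Times)
  then have "((\<lambda>(t, x). G1 t x) \<longlongrightarrow> G1 0 x) (at (0, x))"
    using cont \<open>0 < e\<close> by (auto simp: continuous_on_eq_continuous_at isCont_def)
  then have "\<forall>\<^sub>F p in at (0, x). dist (G1 (fst p) (snd p)) (G1 0 x) < \<eta>"
    using \<open>0 < \<eta>\<close> by (auto simp: case_prod_unfold dest: tendstoD[where e=\<eta>])
  then obtain d where "0 < d"
    and d: "\<And>p. p \<noteq> (0, x) \<Longrightarrow> dist p (0, x) < d \<Longrightarrow> dist (G1 (fst p) (snd p)) (G1 0 x) < \<eta>"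
    by (auto simp: eventually_at)
  define \<delta> where "\<delta> = min e (d/2)"
  have "0 < \<delta>" using \<open>0 < e\<close> \<open>0 < d\<close> by (simp add: \<delta>_def)
  have near: "norm (G1 u z - G1 0 x) \<le> \<eta>" if "\<bar>u\<bar> < \<delta>" "dist z x < \<delta>" for u z
  proof (cases "(u, z) = (0, x)")
    case True
    then show ?thesis using \<open>0 < \<eta>\<close> by simp
  next
    case False
    have "dist (u, z) (0, x) \<le> \<bar>u\<bar> + dist z x"
      using sqrt_sum_squares_le_sum[of "\<bar>u\<bar>" "dist z x"] by (simp add: dist_Pair_Pair)
    also have "\<dots> < d" using that by (auto simp: \<delta>_def)
    finally show ?thesis using d[of "(u, z)"] False by (auto simp: dist_norm less_imp_le)
  qed
  have F1_bound: "norm (F1 u z - F1 0 z - u *\<^sub>R G1 0 x) \<le> \<eta> * \<bar>u\<bar>" if "\<bar>u\<bar> < \<delta>" "dist z x < \<delta>" for u z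
  proof -
    have "norm ((F1 u z - u *\<^sub>R G1 0 x) - (F1 0 z - 0 *\<^sub>R G1 0 x)) \<le> \<eta> * norm (u - 0)"
    proof (rule differentiable_bound[where S = "ball 0 \<delta>" and f' = "\<lambda>v h. h *\<^sub>R (G1 v z - G1 0 x)"])
      fix v assume v: "v \<in> ball (0::real) \<delta>"
      then have "v \<in> {-e<..<e}" by (auto simp: \<delta>_def)
      have "((\<lambda>u. u *\<^sub>R G1 0 x) has_vector_derivative G1 0 x) (at v)"
        by (auto intro!: derivative_eq_intros)
      from has_vector_derivative_diff[OF G1[OF \<open>v \<in> {-e<..<e}\<close>] this]
      show "((\<lambda>u. F1 u z - u *\<^sub>R G1 0 x) has_derivative (\<lambda>h. h *\<^sub>R (G1 v z - G1 0 x))) (at v within ball 0 \<delta>)"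
        unfolding has_vector_derivative_def by (rule has_derivative_at_withinI)
      show "onorm (\<lambda>h. h *\<^sub>R (G1 v z - G1 0 x)) \<le> \<eta>"
        using near[of v z] v that by (intro onorm_le) (simp add: mult.commute[of \<eta>] mult_left_mono)
    qed (use that \<open>0 < \<delta>\<close> in auto)
    then show ?thesis by (simp add: algebra_simps)
  qed
  show "\<exists>d>0. \<forall>y. norm (y - x) < d \<longrightarrow>
      norm (G0 0 y - G0 0 x - blinfun_apply (G1 0 x) (y - x)) \<le> \<eta> * norm (y - x)"
  proof (intro exI[of _ \<delta>] conjI allI impI)
    fix y assume y: "norm (y - x) < \<delta>"
    have key: "norm ((\<phi> u y - \<phi> 0 y - u *\<^sub>R G1 0 x y) - (\<phi> u x - \<phi> 0 x - u *\<^sub>R G1 0 x x)) \<le> \<eta> * \<bar>u\<bar> * norm (y - x)"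
      if u: "\<bar>u\<bar> < \<delta>" for u
    proof (rule differentiable_bound[where S = "ball x \<delta>" and f' = "\<lambda>z. blinfun_apply (F1 u z - F1 0 z - u *\<^sub>R G1 0 x)"])
      fix z assume z: "z \<in> ball x \<delta>"
      have "u \<in> {-e<..<e}" "0 \<in> {-e<..<e}" using u \<open>0 < e\<close> by (auto simp: \<delta>_def)
      then have d: "(\<phi> u has_derivative blinfun_apply (F1 u z)) (at z within ball x \<delta>)"
        "(\<phi> 0 has_derivative blinfun_apply (F1 0 z)) (at z within ball x \<delta>)"
        by (simp_all only: has_derivative_at_withinI[OF \<phi>])
      have "((\<lambda>z. u *\<^sub>R blinfun_apply (G1 0 x) z) has_derivative (\<lambda>z. u *\<^sub>R blinfun_apply (G1 0 x) z))
          (at z within ball x \<delta>)"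
        by (intro bounded_linear_imp_has_derivative bounded_linear_const_scaleR blinfun.bounded_linear_right)
      from has_derivative_diff[OF has_derivative_diff[OF d] this]
      show "((\<lambda>z. \<phi> u z - \<phi> 0 z - u *\<^sub>R blinfun_apply (G1 0 x) z) has_derivative
          blinfun_apply (F1 u z - F1 0 z - u *\<^sub>R G1 0 x)) (at z within ball x \<delta>)"
        by (rule has_derivative_eq_rhs) (simp add: fun_eq_iff blinfun.diff_left blinfun.scaleR_left)
      show "onorm (blinfun_apply (F1 u z - F1 0 z - u *\<^sub>R G1 0 x)) \<le> \<eta> * \<bar>u\<bar>"
        using F1_bound[OF u, of z] z by (simp add: norm_blinfun.rep_eq[symmetric] dist_commute)
    qed (use y \<open>0 < \<delta>\<close> in \<open>auto simp: dist_norm norm_minus_commute\<close>)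
    have lim: "((\<lambda>u. ((\<phi> u y - \<phi> 0 y) /\<^sub>R u - (\<phi> u x - \<phi> 0 x) /\<^sub>R u) - G1 0 x (y - x))
        \<longlongrightarrow> (G0 0 y - G0 0 x) - G1 0 x (y - x)) (at 0)"
      using has_vector_derivative_tendsto[OF G0[of 0 x]] has_vector_derivative_tendsto[OF G0[of 0 y]] \<open>0 < e\<close>
      by (intro tendsto_diff tendsto_const) simp_all
    have "\<forall>\<^sub>F u in at (0::real). \<bar>u\<bar> < \<delta> \<and> u \<noteq> 0"
      using \<open>0 < \<delta>\<close> by (auto simp: eventually_at)
    then have "\<forall>\<^sub>F u in at 0. norm (((\<phi> u y - \<phi> 0 y) /\<^sub>R u - (\<phi> u x - \<phi> 0 x) /\<^sub>R u) - G1 0 x (y - x))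
        \<le> \<eta> * norm (y - x)"
    proof eventually_elim
      case (elim u)
      have "((\<phi> u y - \<phi> 0 y) /\<^sub>R u - (\<phi> u x - \<phi> 0 x) /\<^sub>R u) - G1 0 x (y - x)
          = ((\<phi> u y - \<phi> 0 y - u *\<^sub>R G1 0 x y) - (\<phi> u x - \<phi> 0 x - u *\<^sub>R G1 0 x x)) /\<^sub>R u"
      proof -
        have "(p - q) /\<^sub>R u - (p' - q') /\<^sub>R u - (a - b)
            = ((p - q - u *\<^sub>R a) - (p' - q' - u *\<^sub>R b)) /\<^sub>R u" for p q p' q' a b :: 'b
          using elim by (simp add: scaleR_diff_right)
        then show ?thesis by (simp only: blinfun.diff_right)
      qed
      then have "norm (((\<phi> u y - \<phi> 0 y) /\<^sub>R u - (\<phi> u x - \<phi> 0 x) /\<^sub>R u) - G1 0 x (y - x))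
          = norm ((\<phi> u y - \<phi> 0 y - u *\<^sub>R G1 0 x y) - (\<phi> u x - \<phi> 0 x - u *\<^sub>R G1 0 x x)) / \<bar>u\<bar>"
        by (simp add: divide_inverse mult.commute)
      also have "\<dots> \<le> (\<eta> * \<bar>u\<bar> * norm (y - x)) / \<bar>u\<bar>"
        using elim key[of u] by (intro divide_right_mono) auto
      finally show ?case using elim by simp
    qed
    then show "norm (G0 0 y - G0 0 x - blinfun_apply (G1 0 x) (y - x)) \<le> \<eta> * norm (y - x)"
      by (rule tendsto_upperbound[OF tendsto_norm[OF lim]]) simp
  qed (use \<open>0 < \<delta>\<close> in simp)
qed

text \<open>T has a derivative only at s itself, so the mean value theorem is applied to c minus its
  quadratic Taylor polynomial, on the part of I no farther from s than u; there the derivative of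
  the difference is already of order \<open>o(u - s)\<close>.\<close>

lemma taylor_second_order:
  fixes c T :: "real \<Rightarrow> 'a::real_normed_vector"
  assumes "is_interval I" "s \<in> I"
    and c: "\<And>u. u \<in> I \<Longrightarrow> (c has_vector_derivative T u) (at u within I)"
    and T: "(T has_vector_derivative k) (at s within I)"
  shows "((\<lambda>u. (2 / (u - s)\<^sup>2) *\<^sub>R (c u - c s - (u - s) *\<^sub>R T s)) \<longlongrightarrow> k) (at s within I)"
proof (rule tendstoI)
  fix \<eta> :: real assume "0 < \<eta>"
  define \<eta>' where "\<eta>' = \<eta> / 4"
  have "0 < \<eta>'" using \<open>0 < \<eta>\<close> by (simp add: \<eta>'_def)
  then obtain d where "0 < d"
    and d: "\<And>u. u \<in> I \<Longrightarrow> norm (u - s) < d \<Longrightarrow> norm (T u - T s - (u - s) *\<^sub>R k) \<le> \<eta>' * norm (u - s)"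
    using T unfolding has_vector_derivative_def has_derivative_within_alt by blast
  have "dist ((2 / (u - s)\<^sup>2) *\<^sub>R (c u - c s - (u - s) *\<^sub>R T s)) k < \<eta>"
    if u: "u \<in> I" "u \<noteq> s" "dist u s < d" for u
  proof -
    define J where "J = I \<inter> cball s \<bar>u - s\<bar>"
    define g where "g v = c v - v *\<^sub>R T s - ((v - s)\<^sup>2 / 2) *\<^sub>R k" for v
    have "norm (g u - g s) \<le> (\<eta>' * \<bar>u - s\<bar>) * norm (u - s)"
    proof (rule differentiable_bound[where S = J and f' = "\<lambda>v h. h *\<^sub>R (T v - T s - (v - s) *\<^sub>R k)"])
      show "convex J"
        unfolding J_def using assms(1) by (intro convex_Int convex_cball) (simp add: is_interval_convex)
      fix v assume v: "v \<in> J"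
      have "(c has_vector_derivative T v) (at v within J)"
        using v c[of v] by (auto simp: J_def intro: has_vector_derivative_within_subset)
      moreover have "((\<lambda>v. v *\<^sub>R T s) has_vector_derivative T s) (at v within J)"
        by (auto intro!: derivative_eq_intros)
      moreover have "((\<lambda>v. ((v - s)\<^sup>2 / 2) *\<^sub>R k) has_vector_derivative (v - s) *\<^sub>R k) (at v within J)"
        by (auto intro!: derivative_eq_intros)
      ultimately have "(g has_vector_derivative (T v - T s - (v - s) *\<^sub>R k)) (at v within J)"
        unfolding g_def by (intro has_vector_derivative_diff)
      then show "(g has_derivative (\<lambda>h. h *\<^sub>R (T v - T s - (v - s) *\<^sub>R k))) (at v within J)"
        by (simp add: has_vector_derivative_def)
      have "norm (v - s) \<le> \<bar>u - s\<bar>" using v by (auto simp: J_def dist_real_def)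
      then have "norm (T v - T s - (v - s) *\<^sub>R k) \<le> \<eta>' * norm (v - s)"
        using d[of v] v u by (simp add: J_def dist_real_def)
      also have "\<dots> \<le> \<eta>' * \<bar>u - s\<bar>"
        using \<open>norm (v - s) \<le> \<bar>u - s\<bar>\<close> \<open>0 < \<eta>'\<close> by (intro mult_left_mono) auto
      finally have "norm (T v - T s - (v - s) *\<^sub>R k) \<le> \<eta>' * \<bar>u - s\<bar>" .
      then show "onorm (\<lambda>h. h *\<^sub>R (T v - T s - (v - s) *\<^sub>R k)) \<le> \<eta>' * \<bar>u - s\<bar>"
        by (intro onorm_le) (simp add: mult.commute[of "\<eta>' * \<bar>u - s\<bar>"] mult_left_mono)
    qed (use u assms in \<open>auto simp: J_def dist_real_def\<close>)
    moreover have "g u - g s = c u - c s - (u - s) *\<^sub>R T s - ((u - s)\<^sup>2 / 2) *\<^sub>R k"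
      by (simp add: g_def algebra_simps)
    ultimately have *: "norm (c u - c s - (u - s) *\<^sub>R T s - ((u - s)\<^sup>2 / 2) *\<^sub>R k) \<le> \<eta>' * (u - s)\<^sup>2"
      by (simp add: power2_eq_square mult.assoc)
    have "(2 / (u - s)\<^sup>2) *\<^sub>R (c u - c s - (u - s) *\<^sub>R T s) - k
        = (2 / (u - s)\<^sup>2) *\<^sub>R (c u - c s - (u - s) *\<^sub>R T s - ((u - s)\<^sup>2 / 2) *\<^sub>R k)"
      using u by (simp add: scaleR_diff_right)
    then have "dist ((2 / (u - s)\<^sup>2) *\<^sub>R (c u - c s - (u - s) *\<^sub>R T s)) k
        = (2 / (u - s)\<^sup>2) * norm (c u - c s - (u - s) *\<^sub>R T s - ((u - s)\<^sup>2 / 2) *\<^sub>R k)"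
      by (simp add: dist_norm)
    also have "\<dots> \<le> (2 / (u - s)\<^sup>2) * (\<eta>' * (u - s)\<^sup>2)"
      using * by (intro mult_left_mono) auto
    also have "\<dots> < \<eta>" using u \<open>0 < \<eta>\<close> by (simp add: \<eta>'_def)
    finally show ?thesis .
  qed
  then show "\<forall>\<^sub>F u in at s within I. dist ((2 / (u - s)\<^sup>2) *\<^sub>R (c u - c s - (u - s) *\<^sub>R T s)) k < \<eta>"
    using \<open>0 < d\<close> by (auto simp: eventually_at)
qed

section \<open>Curvature vectors as limits of chords of the link\<close>

definition normal_part :: "'a::real_inner \<Rightarrow> 'a \<Rightarrow> 'a" where
  "normal_part T v = v - (v \<bullet> T) *\<^sub>R T"

lemma bounded_linear_normal_part: "bounded_linear (normal_part T)"
  unfolding normal_part_def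
  by (intro bounded_linear_sub bounded_linear_ident
      bounded_linear_scaleR_const[THEN bounded_linear_compose] bounded_linear_inner_left)

lemmas normal_part_linear =
  bounded_linear.linear[OF bounded_linear_normal_part, THEN linear_diff]
  bounded_linear.linear[OF bounded_linear_normal_part, THEN linear_scale]
  bounded_linear.linear[OF bounded_linear_normal_part, THEN linear_0]

lemmas tendsto_normal_part = bounded_linear.tendsto[OF bounded_linear_normal_part]

lemma normal_part_self: "norm T = 1 \<Longrightarrow> normal_part T T = 0"
  by (simp add: normal_part_def norm_eq_1)

text \<open>The limit determines the curvature vector without reference to a chart.\<close>

lemma has_curvature_limit:
  assumes "has_curvature L y k"
  obtains T0 where "norm T0 = 1" "y \<in> L" "at y within L \<noteq> bot"
    "((\<lambda>q. (2 / (norm (q - y))\<^sup>2) *\<^sub>R normal_part T0 (q - y)) \<longlongrightarrow> k) (at y within L)"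
proof -
  from assms obtain U I c cinv T s where "open U" "is_interval I" "s \<in> I" "I \<noteq> {s}" and y: "c s = y"
    and hom: "homeomorphism I (L \<inter> U) c cinv"
    and c: "\<And>u. u \<in> I \<Longrightarrow> (c has_vector_derivative T u) (at u within I)"
    and norm_T: "\<And>u. u \<in> I \<Longrightarrow> norm (T u) = 1"
    and T: "(T has_vector_derivative k) (at s within I)"
    unfolding has_curvature_def by blast
  have "s islimpt I"
    using \<open>is_interval I\<close> \<open>s \<in> I\<close> \<open>I \<noteq> {s}\<close>
    by (intro connected_imp_perfect) (auto simp: is_interval_connected_1)
  then have ne: "at s within I \<noteq> bot" by (simp add: trivial_limit_within)
  have T_tendsto: "(T \<longlongrightarrow> T s) (at s within I)"
    using T by (metis continuous_within has_vector_derivative_continuous)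
  \<comment> \<open>Unit vectors have orthogonal sum and difference; in the limit this makes k
    orthogonal to the tangent, without any differentiation of the norm.\<close>
  have lim0: "((\<lambda>u. ((T u - T s) /\<^sub>R (u - s)) \<bullet> (T u + T s)) \<longlongrightarrow> k \<bullet> (T s + T s)) (at s within I)"
    by (intro tendsto_intros has_vector_derivative_tendsto T T_tendsto)
  have const: "((T u - T s) /\<^sub>R (u - s)) \<bullet> (T u + T s) = 0" if "u \<in> I" for u
    using norm_T[OF that] norm_T[OF \<open>s \<in> I\<close>]
    by (simp add: norm_eq_1 inner_diff_left inner_diff_right inner_add_right inner_commute)
  have "\<forall>\<^sub>F u in at s within I. u \<in> I" by (simp add: eventually_at_filter)
  then have "\<forall>\<^sub>F u in at s within I. ((T u - T s) /\<^sub>R (u - s)) \<bullet> (T u + T s) = 0"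
    by eventually_elim (rule const)
  with lim0 have "((\<lambda>u. 0) \<longlongrightarrow> k \<bullet> (T s + T s)) (at s within I)"
    by (rule Lim_transform_eventually)
  then have "k \<bullet> T s + k \<bullet> T s = 0"
    using tendsto_const_iff[OF ne] by (metis inner_add_right)
  then have k_perp: "k \<bullet> T s = 0" by simp
  have "((\<lambda>u. norm ((c u - c s) /\<^sub>R (u - s))) \<longlongrightarrow> 1) (at s within I)"
    using tendsto_norm[OF has_vector_derivative_tendsto[OF c[OF \<open>s \<in> I\<close>]]] norm_T[OF \<open>s \<in> I\<close>] by simp
  \<comment> \<open>The projection removes the first-order term, and the ratio of chord length to
    parameter difference tends to 1, so that the parameter can be replaced by the chord
    length.\<close>
  then have "((\<lambda>u. inverse ((norm ((c u - c s) /\<^sub>R (u - s)))\<^sup>2) *\<^sub>R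
      normal_part (T s) ((2 / (u - s)\<^sup>2) *\<^sub>R (c u - c s - (u - s) *\<^sub>R T s)))
      \<longlongrightarrow> inverse (1\<^sup>2) *\<^sub>R normal_part (T s) k) (at s within I)"
    by (intro tendsto_intros tendsto_normal_part taylor_second_order \<open>is_interval I\<close> \<open>s \<in> I\<close> c T) auto
  also have "inverse (1\<^sup>2) *\<^sub>R normal_part (T s) k = k"
    using k_perp by (simp add: normal_part_def)
  finally have lim: "((\<lambda>u. (2 / (norm (c u - y))\<^sup>2) *\<^sub>R normal_part (T s) (c u - y)) \<longlongrightarrow> k) (at s within I)"
  proof (rule Lim_transform_eventually)
    have "inverse ((norm ((c u - c s) /\<^sub>R (u - s)))\<^sup>2) *\<^sub>R
      normal_part (T s) ((2 / (u - s)\<^sup>2) *\<^sub>R (c u - c s - (u - s) *\<^sub>R T s)) =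
      (2 / (norm (c u - y))\<^sup>2) *\<^sub>R normal_part (T s) (c u - y)" if "u \<noteq> s" for u
    proof -
      have "normal_part (T s) ((2 / (u - s)\<^sup>2) *\<^sub>R (c u - c s - (u - s) *\<^sub>R T s))
          = (2 / (u - s)\<^sup>2) *\<^sub>R normal_part (T s) (c u - y)"
        using norm_T[OF \<open>s \<in> I\<close>] by (simp only: normal_part_linear normal_part_self y) simp
      moreover have "inverse ((norm ((c u - c s) /\<^sub>R (u - s)))\<^sup>2) = (u - s)\<^sup>2 / (norm (c u - y))\<^sup>2"
        by (simp add: y power_mult_distrib divide_inverse power_inverse mult.commute)
      ultimately show ?thesis using that by simp
    qed
    then show "\<forall>\<^sub>F u in at s within I. inverse ((norm ((c u - c s) /\<^sub>R (u - s)))\<^sup>2) *\<^sub>R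
      normal_part (T s) ((2 / (u - s)\<^sup>2) *\<^sub>R (c u - c s - (u - s) *\<^sub>R T s)) =
      (2 / (norm (c u - y))\<^sup>2) *\<^sub>R normal_part (T s) (c u - y)"
      by (auto simp: eventually_at_filter)
  qed
  have "y \<in> L \<inter> U"
    using hom \<open>s \<in> I\<close> y by (auto simp: homeomorphism_def)
  have at_eq: "at y within L = at y within (L \<inter> U)"
    using \<open>y \<in> L \<inter> U\<close> \<open>open U\<close> by (intro at_within_nhd[of _ U]) auto
  have cinv_y: "cinv y = s" "\<And>q. q \<in> L \<inter> U \<Longrightarrow> cinv q \<in> I" "\<And>q. q \<in> L \<inter> U \<Longrightarrow> c (cinv q) = q"
    using hom \<open>s \<in> I\<close> y by (auto simp: homeomorphism_def)
  have "continuous (at y within (L \<inter> U)) cinv"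
    using hom \<open>y \<in> L \<inter> U\<close> by (auto simp: homeomorphism_def continuous_on_eq_continuous_within)
  then have "(cinv \<longlongrightarrow> s) (at y within (L \<inter> U))"
    by (simp add: continuous_within cinv_y)
  moreover have "q \<noteq> y \<longrightarrow> q \<in> L \<inter> U \<longrightarrow> cinv q \<in> I \<and> cinv q \<noteq> s" for q
    using cinv_y(2,3)[of q] y by auto
  ultimately have "filterlim cinv (at s within I) (at y within (L \<inter> U))"
    unfolding filterlim_at eventually_at_filter by (blast intro: always_eventually)
  \<comment> \<open>Composition with the inverse chart replaces the parameter by a point q of the
    link, and the parametrization disappears from the limit.\<close>
  from filterlim_compose[OF lim this]
  have "((\<lambda>q. (2 / (norm (c (cinv q) - y))\<^sup>2) *\<^sub>R normal_part (T s) (c (cinv q) - y)) \<longlongrightarrow> k)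
      (at y within (L \<inter> U))" .
  then have lim': "((\<lambda>q. (2 / (norm (q - y))\<^sup>2) *\<^sub>R normal_part (T s) (q - y)) \<longlongrightarrow> k) (at y within L)"
    unfolding at_eq by (rule Lim_transform_eventually) (use cinv_y in \<open>auto simp: eventually_at_filter\<close>)
  have "filterlim c (at y within L) (at s within I)"
    unfolding filterlim_at
  proof
    show "(c \<longlongrightarrow> y) (at s within I)"
      using c[OF \<open>s \<in> I\<close>] y by (metis continuous_within has_vector_derivative_continuous)
    have "c u \<in> L \<and> c u \<noteq> y" if "u \<in> I" "u \<noteq> s" for u
      using hom that \<open>s \<in> I\<close> y unfolding homeomorphism_def by (metis IntE imageI)
    then show "\<forall>\<^sub>F u in at s within I. c u \<in> L \<and> c u \<noteq> y"
      by (auto simp: eventually_at_filter)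
  qed
  then have "at y within L \<noteq> bot"
    using ne by (metis filterlim_def filtermap_bot_iff le_bot)
  with lim' norm_T[OF \<open>s \<in> I\<close>] \<open>y \<in> L \<inter> U\<close> that show ?thesis by blast
qed

text \<open>Two charts might have different tangents. But the chord directions
  \<open>sgn (q - y)\<close> lose their part normal to either tangent in the limit, so each tangent
  is plus or minus the other. The projection does not see the sign, and both curvature vectors are
  the same limit.\<close>

lemma has_curvature_unique:
  assumes "has_curvature L y k" "has_curvature L y k'"
  shows "k = k'"
proof -
  let ?F = "at y within L"
  let ?e = "\<lambda>q. sgn (q - y)"
  obtain T where T: "norm T = 1" and ne: "?F \<noteq> bot"
    and k: "((\<lambda>q. (2 / (norm (q - y))\<^sup>2) *\<^sub>R normal_part T (q - y)) \<longlongrightarrow> k) ?F"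
    using has_curvature_limit[OF assms(1)] .
  obtain T' where T': "norm T' = 1"
    and k': "((\<lambda>q. (2 / (norm (q - y))\<^sup>2) *\<^sub>R normal_part T' (q - y)) \<longlongrightarrow> k') ?F"
    using has_curvature_limit[OF assms(2)] .
  have null: "((\<lambda>q. normal_part S (?e q)) \<longlongrightarrow> 0) ?F"
    if "((\<lambda>q. (2 / (norm (q - y))\<^sup>2) *\<^sub>R normal_part S (q - y)) \<longlongrightarrow> \<kappa>) ?F" for S \<kappa>
  proof -
    have "((\<lambda>q. (norm (q - y) / 2) *\<^sub>R (2 / (norm (q - y))\<^sup>2) *\<^sub>R normal_part S (q - y))
        \<longlongrightarrow> (norm (y - y) / 2) *\<^sub>R \<kappa>) ?F"
      by (intro tendsto_intros that) auto
    moreover have "(norm (q - y) / 2) *\<^sub>R (2 / (norm (q - y))\<^sup>2) *\<^sub>R normal_part S (q - y) = normal_part S (?e q)"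
      for q
      by (simp add: sgn_div_norm normal_part_linear power2_eq_square field_simps)
    ultimately show ?thesis by simp
  qed
  have "((\<lambda>q. normal_part T' (?e q) - normal_part T' (normal_part T (?e q))) \<longlongrightarrow> 0 - normal_part T' 0) ?F"
    by (intro tendsto_diff tendsto_normal_part null[OF k] null[OF k'])
  then have "((\<lambda>q. (?e q \<bullet> T) *\<^sub>R normal_part T' T) \<longlongrightarrow> 0) ?F"
    by (simp add: normal_part_def[of T] normal_part_linear)
  then have "((\<lambda>q. (norm ((?e q \<bullet> T) *\<^sub>R normal_part T' T))\<^sup>2) \<longlongrightarrow> (norm (0 :: space))\<^sup>2) ?F"
    by (intro tendsto_intros)
  then have zero: "((\<lambda>q. (?e q \<bullet> T)\<^sup>2 * (norm (normal_part T' T))\<^sup>2) \<longlongrightarrow> 0) ?F"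
    by (simp add: power_mult_distrib)
  have "((\<lambda>q. 1 - (norm (normal_part T (?e q)))\<^sup>2) \<longlongrightarrow> 1 - (norm (0 :: space))\<^sup>2) ?F"
    by (intro tendsto_intros null[OF k])
  then have "((\<lambda>q. 1 - (norm (normal_part T (?e q)))\<^sup>2) \<longlongrightarrow> 1) ?F"
    by simp
  then have one: "((\<lambda>q. (?e q \<bullet> T)\<^sup>2) \<longlongrightarrow> 1) ?F"
  proof (rule Lim_transform_eventually)
    have "1 - (norm (normal_part T v))\<^sup>2 = (v \<bullet> T)\<^sup>2" if "norm v = 1" for v
      using that T unfolding power2_norm_eq_inner normal_part_def
      by (simp add: norm_eq_1 inner_diff_left inner_diff_right inner_commute power2_eq_square)
    then show "\<forall>\<^sub>F q in ?F. 1 - (norm (normal_part T (?e q)))\<^sup>2 = (?e q \<bullet> T)\<^sup>2"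
      by (auto simp: eventually_at_filter norm_sgn)
  qed
  have "((\<lambda>q. (?e q \<bullet> T)\<^sup>2 * (norm (normal_part T' T))\<^sup>2) \<longlongrightarrow> 1 * (norm (normal_part T' T))\<^sup>2) ?F"
    by (intro tendsto_intros one)
  from tendsto_unique[OF ne this zero] have "normal_part T' T = 0"
    by simp
  then have "T = (T \<bullet> T') *\<^sub>R T'" by (simp add: normal_part_def)
  moreover have "(T \<bullet> T')\<^sup>2 = 1"
    by (metis T T' \<open>T = (T \<bullet> T') *\<^sub>R T'\<close> mult.right_neutral norm_scaleR power2_abs power_one real_norm_def)
  ultimately have "normal_part T v = normal_part T' v" for v
    unfolding normal_part_def
    by (metis (no_types, lifting) inner_scaleR_right mult.assoc mult.commute mult.left_neutral power2_eq_square scaleR_scaleR)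
  then show ?thesis
    using tendsto_unique[OF ne k] k' by simp
qed

section \<open>Bounds for the radius of curvature\<close>

lemma curvature_eq: "has_curvature L y k \<Longrightarrow> curvature L y = k"
  unfolding curvature_def by (blast intro: has_curvature_unique)

text \<open>Punctured neighbourhoods of x avoid the finite set E, so the \<open>Limsup\<close> does
  not see it. As x is a limit point, the filter is not trivial and the \<open>Limsup\<close> is
  nonnegative instead of minus infinity, as the antitonicity of \<open>inverse\<close> on extended
  reals requires.\<close>

lemma curvature_radius_ge:
  assumes "0 < M" "finite E"
    and bound: "\<And>y k. y \<notin> E \<Longrightarrow> has_curvature L y k \<Longrightarrow> norm k \<le> M"
    and x: "x islimpt {y. \<exists>k. has_curvature L y k}"
  shows "ereal (1 / M) \<le> curvature_radius L x"
proof -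
  let ?S = "{y. \<exists>k. has_curvature L y k}"
  let ?l = "Limsup (at x within ?S) (\<lambda>y. ereal (norm (curvature L y)))"
  have "at x within ?S \<noteq> bot" using x by (simp add: trivial_limit_within)
  then have "0 \<le> ?l"
    by (intro le_Limsup) auto
  have "\<forall>\<^sub>F y in at x within ?S. y \<notin> E"
  proof -
    have "open (- (E - {x}))" by (intro open_Compl finite_imp_closed finite_Diff \<open>finite E\<close>)
    then have "\<forall>\<^sub>F y in at x within ?S. y \<in> - (E - {x})"
      by (intro eventually_at_topological[THEN iffD2]) blast
    moreover have "\<forall>\<^sub>F y in at x within ?S. y \<noteq> x"
      by (simp add: eventually_at_filter)
    ultimately show ?thesis by eventually_elim auto
  qed
  moreover have "\<forall>\<^sub>F y in at x within ?S. y \<in> ?S"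
    by (simp add: eventually_at_filter)
  ultimately have "\<forall>\<^sub>F y in at x within ?S. ereal (norm (curvature L y)) \<le> ereal M"
    by eventually_elim (use bound in \<open>auto simp: curvature_eq\<close>)
  then have "?l \<le> ereal M" by (rule Limsup_bounded)
  then have "inverse (ereal M) \<le> inverse ?l"
    using \<open>0 \<le> ?l\<close> by (intro ereal_inverse_antimono)
  then show ?thesis
    using \<open>0 < M\<close> by (simp add: curvature_radius_def divide_inverse)
qed

text \<open>One way p of approaching x already bounds the \<open>Limsup\<close> from below. At a
  junction it will be the approach through the arc alone.\<close>

lemma curvature_radius_le:
  assumes "F \<noteq> bot" and p: "filterlim p (at x within {y. \<exists>k. has_curvature L y k}) F"
    and lim: "((\<lambda>s. norm (curvature L (p s))) \<longlongrightarrow> m) F" and "0 < m"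
  shows "curvature_radius L x \<le> ereal (1 / m)"
proof -
  let ?S = "{y. \<exists>k. has_curvature L y k}"
  let ?g = "\<lambda>y. ereal (norm (curvature L y))"
  have "((\<lambda>s. ?g (p s)) \<longlongrightarrow> ereal m) F"
    using lim by simp
  then have "ereal m = Limsup F (\<lambda>s. ?g (p s))"
    using \<open>F \<noteq> bot\<close> by (intro lim_imp_Limsup[symmetric])
  also have "\<dots> \<le> Limsup (filtermap p F) ?g"
    by (rule Limsup_filtermap_ge)
  also have "\<dots> \<le> Limsup (at x within ?S) ?g"
    unfolding Limsup_def using p by (intro INF_superset_mono) (auto simp: filterlim_def le_filter_def)
  finally have "inverse (Limsup (at x within ?S) ?g) \<le> inverse (ereal m)"
    using \<open>0 < m\<close> by (intro ereal_inverse_antimono) auto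
  then show ?thesis
    using \<open>0 < m\<close> by (simp add: curvature_radius_def divide_inverse)
qed

text \<open>Images of a unit-speed curve under a diffeomorphism lose unit speed, while
  \<open>has_curvature\<close> asks for it. The arclength v has an inverse w with derivative
  \<open>1 / norm c'\<close>, and \<open>c \<circ> w\<close> is the chart; the classical curvature
  formula results, with the second derivative required at s only.\<close>

lemma has_curvature_regular_parametrization:
  fixes c c' :: "real \<Rightarrow> space"
  assumes s: "s \<in> {a<..<b}"
    and c: "\<And>u. u \<in> {a..b} \<Longrightarrow> (c has_vector_derivative c' u) (at u)"
    and regular: "\<And>u. u \<in> {a..b} \<Longrightarrow> c' u \<noteq> 0"
    and cont: "continuous_on {a..b} c'"
    and acc: "(c' has_vector_derivative acc) (at s)"
    and "open U" and hom: "homeomorphism {a<..<b} (L \<inter> U) c cinv"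
  obtains k where "has_curvature L (c s) k"
    "(norm k)\<^sup>2 = ((c' s \<bullet> c' s) * (acc \<bullet> acc) - (c' s \<bullet> acc)\<^sup>2) / (c' s \<bullet> c' s) ^ 3"
proof -
  define v where "v u = integral {a..u} (\<lambda>x. norm (c' x))" for u
  have v: "(v has_real_derivative norm (c' u)) (at u)" if "u \<in> {a<..<b}" for u
  proof -
    have "(v has_vector_derivative norm (c' u)) (at u within {a..b})"
      unfolding v_def using that
      by (intro integral_has_vector_derivative continuous_intros cont) auto
    then show ?thesis
      using that at_within_interior[of u "{a..b}"]
      by (simp add: has_real_derivative_iff_has_vector_derivative)
  qed
  have cont_v: "continuous_on {a<..<b} v"
    using v by (meson DERIV_isCont continuous_at_imp_continuous_on)
  have v_less: "v x < v y" if "x \<in> {a<..<b}" "y \<in> {a<..<b}" "x < y" for x y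
  proof (rule DERIV_pos_imp_increasing[OF \<open>x < y\<close>])
    fix z assume "x \<le> z" "z \<le> y"
    then have "z \<in> {a<..<b}" using that by auto
    with v[OF this] regular[of z] show "\<exists>D. (v has_real_derivative D) (at z) \<and> 0 < D"
      by (intro exI[of _ "norm (c' z)"]) auto
  qed
  have inj: "inj_on v {a<..<b}"
    by (rule linorder_inj_onI) (use v_less in fastforce)+
  define J where "J = v ` {a<..<b}"
  define w where "w = the_inv_into {a<..<b} v"
  have w: "w (v u) = u" if "u \<in> {a<..<b}" for u
    using that inj by (simp add: w_def the_inv_into_f_f)
  have deriv_w: "(w has_real_derivative inverse (norm (c' u))) (at (v u))" if "u \<in> {a<..<b}" for u
    unfolding has_field_derivative_def
  proof (rule has_derivative_inverse_strong[where S = "{a<..<b}" and f = v])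
    show "(v has_derivative (*) (norm (c' u))) (at u)"
      using v[OF that] by (simp add: has_field_derivative_def)
    show "(*) (norm (c' u)) \<circ> (*) (inverse (norm (c' u))) = id"
      using regular[of u] that by (auto simp: fun_eq_iff)
  qed (use that cont_v w in auto)
  have "homeomorphism J {a<..<b} w v"
  proof (rule homeomorphismI)
    show "continuous_on J w"
    proof (rule continuous_at_imp_continuous_on, rule ballI)
      fix r assume "r \<in> J"
      then obtain u where "u \<in> {a<..<b}" "r = v u" by (auto simp: J_def)
      then show "isCont w r" using DERIV_isCont[OF deriv_w] by blast
    qed
    show "w ` J \<subseteq> {a<..<b}" using w by (simp add: J_def image_subset_iff)
    show "w (v u) = u" if "u \<in> {a<..<b}" for u using w[OF that] .
    show "v (w r) = r" if "r \<in> J" for r using that w by (auto simp: J_def)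
  qed (use cont_v in \<open>simp_all add: J_def\<close>)
  then have hom': "homeomorphism J (L \<inter> U) (c \<circ> w) (v \<circ> cinv)"
    using hom by (rule homeomorphism_compose)
  have "is_interval J"
    unfolding J_def is_interval_connected_1
    by (intro connected_continuous_image cont_v) simp
  have "J \<noteq> {v s}"
  proof -
    have "(s + b) / 2 \<in> {a<..<b}" "s < (s + b) / 2" using s by auto
    then have "v s < v ((s + b) / 2)" using v_less[OF s] by blast
    then show ?thesis using \<open>(s + b) / 2 \<in> {a<..<b}\<close> unfolding J_def
      by (metis imageI less_irrefl singletonD)
  qed
  define T where "T r = sgn (c' (w r))" for r
  define n where "n = norm (c' s)"
  have "0 < n" using regular[of s] s by (simp add: n_def)
  \<comment> \<open>The part of the acceleration orthogonal to the velocity, divided by the squared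
    speed.\<close>
  define k where "k = (1 / n\<^sup>2) *\<^sub>R acc - ((c' s \<bullet> acc) / n ^ 4) *\<^sub>R c' s"
  have "(T has_vector_derivative k) (at (v s))"
  proof -
    have "((\<lambda>u. norm (c' u)) has_vector_derivative (acc \<bullet> sgn (c' s))) (at s)"
    proof -
      have "(norm has_derivative (\<lambda>h. h \<bullet> sgn (c' s))) (at (c' s))"
        using regular[of s] s by (intro has_derivative_norm) auto
      from vector_derivative_diff_chain_within[of c' acc s UNIV norm, OF acc has_derivative_at_withinI[OF this]]
      show ?thesis by (simp add: o_def)
    qed
    then have "((\<lambda>u. inverse (norm (c' u))) has_real_derivative - (inverse n * (acc \<bullet> sgn (c' s)) * inverse n)) (at s)"
      unfolding n_def using regular[of s] s
      by (intro DERIV_inverse') (auto simp: has_real_derivative_iff_has_vector_derivative)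
    from has_vector_derivative_scaleR[OF this acc]
    have "((\<lambda>u. sgn (c' u)) has_vector_derivative
        (inverse n *\<^sub>R acc + (- (inverse n * (acc \<bullet> sgn (c' s)) * inverse n)) *\<^sub>R c' s)) (at s)"
      by (simp add: sgn_div_norm n_def)
    moreover have "(w has_vector_derivative inverse n) (at (v s))"
      using deriv_w[OF s] by (simp add: n_def has_real_derivative_iff_has_vector_derivative)
    ultimately have "(T has_vector_derivative inverse n *\<^sub>R
        (inverse n *\<^sub>R acc + (- (inverse n * (acc \<bullet> sgn (c' s)) * inverse n)) *\<^sub>R c' s)) (at (v s))"
      using vector_diff_chain_at[of w "inverse n" "v s" "\<lambda>u. sgn (c' u)"] w[OF s]
      by (simp add: T_def[abs_def] o_def)
    also have "inverse n *\<^sub>R (inverse n *\<^sub>R acc + (- (inverse n * (acc \<bullet> sgn (c' s)) * inverse n)) *\<^sub>R c' s) = k"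
    proof -
      have "acc \<bullet> sgn (c' s) = (c' s \<bullet> acc) / n"
        by (simp add: sgn_div_norm n_def inner_commute divide_inverse mult.commute)
      then have "inverse n * - (inverse n * (acc \<bullet> sgn (c' s)) * inverse n) = - ((c' s \<bullet> acc) / n ^ 4)"
        by (simp add: power4_eq_xxxx divide_inverse mult_ac)
      moreover have "inverse n * inverse n = 1 / n\<^sup>2"
        by (simp add: power2_eq_square divide_inverse)
      ultimately show ?thesis
        by (simp only: k_def scaleR_add_right scaleR_scaleR) simp
    qed
    finally show ?thesis .
  qed
  moreover have "(c \<circ> w has_vector_derivative T r) (at r within J) \<and> norm (T r) = 1" if r: "r \<in> J" for r
  proof
    obtain u where u: "u \<in> {a<..<b}" "r = v u" using r unfolding J_def by blast
    have "(w has_vector_derivative inverse (norm (c' u))) (at r)"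
      using deriv_w[OF u(1)] u by (simp add: has_real_derivative_iff_has_vector_derivative)
    then have "(c \<circ> w has_vector_derivative inverse (norm (c' u)) *\<^sub>R c' u) (at r)"
      using vector_diff_chain_at[of w "inverse (norm (c' u))" r c "c' u"] c[of u] w[OF u(1)] u by simp
    then show "(c \<circ> w has_vector_derivative T r) (at r within J)"
      using w[OF u(1)] u by (simp add: T_def sgn_div_norm has_vector_derivative_at_within)
    show "norm (T r) = 1"
      using w[OF u(1)] u regular[of u] by (simp add: T_def norm_sgn)
  qed
  moreover have "(c \<circ> w) (v s) = c s" "v s \<in> J" using w[OF s] s by (auto simp: J_def)
  ultimately have "has_curvature L (c s) k"
    unfolding has_curvature_def using \<open>open U\<close> \<open>is_interval J\<close> \<open>J \<noteq> {v s}\<close> hom'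
    by (intro exI[of _ U] exI[of _ J] exI[of _ "c \<circ> w"] exI[of _ "v \<circ> cinv"] exI[of _ T] exI[of _ "v s"])
      (simp add: has_vector_derivative_at_within)
  moreover have "(norm k)\<^sup>2 = ((c' s \<bullet> c' s) * (acc \<bullet> acc) - (c' s \<bullet> acc)\<^sup>2) / (c' s \<bullet> c' s) ^ 3"
  proof -
    have n2: "c' s \<bullet> c' s = n\<^sup>2" by (simp add: n_def power2_norm_eq_inner)
    define p q where "p = 1 / n\<^sup>2" and "q = (c' s \<bullet> acc) / n ^ 4"
    have "k \<bullet> k = p * p * (acc \<bullet> acc) - 2 * p * q * (c' s \<bullet> acc) + q * q * n\<^sup>2"
      unfolding k_def p_def[symmetric] q_def[symmetric]
      by (simp add: inner_diff_left inner_diff_right inner_commute[of acc "c' s"] n2 algebra_simps)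
    also have "\<dots> = (n\<^sup>2 * (acc \<bullet> acc) - (c' s \<bullet> acc)\<^sup>2) / (n\<^sup>2) ^ 3"
    proof -
      have q: "q = (c' s \<bullet> acc) * p\<^sup>2" by (simp add: p_def q_def power_divide flip: power_mult)
      have np: "n\<^sup>2 * p = 1" using \<open>0 < n\<close> by (simp add: p_def)
      have "(n\<^sup>2 * A - X\<^sup>2) / (n\<^sup>2) ^ 3 = (n\<^sup>2 * A - X\<^sup>2) * p ^ 3" for A X
        by (simp add: p_def power_divide)
      also have "(n\<^sup>2 * A - X\<^sup>2) * p ^ 3 = (n\<^sup>2 * p) * A * p\<^sup>2 - X\<^sup>2 * p ^ 3" for A X
        by (simp add: algebra_simps power2_eq_square power3_eq_cube)
      also have "(n\<^sup>2 * p) * A * p\<^sup>2 - X\<^sup>2 * p ^ 3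
          = p * p * A - 2 * p * (X * p\<^sup>2) * X + (X * p\<^sup>2) * (X * p\<^sup>2) * n\<^sup>2" for A X
      proof -
        have "(X * p\<^sup>2) * (X * p\<^sup>2) * n\<^sup>2 = X\<^sup>2 * p ^ 3 * (n\<^sup>2 * p)"
          by (simp add: power2_eq_square power3_eq_cube mult_ac)
        then show ?thesis
          unfolding np by (simp add: power2_eq_square power3_eq_cube mult_ac)
      qed
      finally show ?thesis unfolding q by simp
    qed
    finally show ?thesis by (simp add: power2_norm_eq_inner n2)
  qed
  ultimately show ?thesis using that by blast
qed

text \<open>Injectivity on the compact interval gives a homeomorphism onto the arc. The set U is the
  complement of B and of the rest of the arc, both closed, so that only the piece over the open
  interval remains.\<close>

lemma arc_chart:
  fixes c :: "real \<Rightarrow> space"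
  assumes "continuous_on {p..q} c" "inj_on c {p..q}" "closed B" "c ` {p..q} \<inter> B = {}"
    and "{a<..<b} \<subseteq> {p..q}"
  obtains U cinv where "open U" "homeomorphism {a<..<b} ((c ` {p..q} \<union> B) \<inter> U) c cinv"
proof -
  define U where "U = - (B \<union> c ` ({p..q} - {a<..<b}))"
  have "compact ({p..q} - {a<..<b})"
    by (simp add: compact_diff)
  then have "compact (c ` ({p..q} - {a<..<b}))"
    by (rule compact_continuous_image[rotated]) (use assms(1) continuous_on_subset in blast)
  then have "open U"
    unfolding U_def by (intro open_Compl closed_Un assms compact_imp_closed)
  obtain g where g: "homeomorphism {p..q} (c ` {p..q}) c g"
    using homeomorphism_compact[OF compact_Icc assms(1) refl assms(2)] by blast
  have "(c ` {p..q} \<union> B) \<inter> U = c ` {a<..<b}"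
  proof
    show "(c ` {p..q} \<union> B) \<inter> U \<subseteq> c ` {a<..<b}"
      unfolding U_def by blast
    have "c u \<notin> c ` ({p..q} - {a<..<b})" if "u \<in> {a<..<b}" for u
    proof
      assume "c u \<in> c ` ({p..q} - {a<..<b})"
      then obtain x where x: "c u = c x" "x \<in> {p..q}" "x \<notin> {a<..<b}" by blast
      moreover have "u \<in> {p..q}" using that assms(5) by blast
      ultimately have "u = x" using inj_onD[OF assms(2)] by blast
      then show False using x that by blast
    qed
    then show "c ` {a<..<b} \<subseteq> (c ` {p..q} \<union> B) \<inter> U"
      using assms(4,5) unfolding U_def by fast
  qed
  then have "homeomorphism {a<..<b} ((c ` {p..q} \<union> B) \<inter> U) c g"
    by (intro homeomorphism_of_subsets[OF g assms(5) order_refl]) (rule sym)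
  with \<open>open U\<close> that show ?thesis by blast
qed

text \<open>The midpoint of a closest pair has two nearest points, which bounds the reach from
  above. Two nearest points of a point closer than d/2 to the link are less than d apart, hence lie
  on the same component, and there uniqueness holds up to R, which is at least d/2.\<close>

lemma two_reach_eq_distance:
  assumes A: "compact A" "A \<noteq> {}" and B: "compact B" "B \<noteq> {}"
    and d: "0 < d" "d \<le> 2 * R" "\<And>a b. a \<in> A \<Longrightarrow> b \<in> B \<Longrightarrow> d \<le> dist a b"
    and attained: "a0 \<in> A" "b0 \<in> B" "dist a0 b0 = d"
    and unique_A: "\<And>p a b. a \<in> A \<Longrightarrow> b \<in> A \<Longrightarrow> (\<And>q. q \<in> A \<Longrightarrow> dist p a \<le> dist p q) \<Longrightarrow>
      dist p b = dist p a \<Longrightarrow> dist p a < R \<Longrightarrow> a = b"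
    and unique_B: "\<And>p a b. a \<in> B \<Longrightarrow> b \<in> B \<Longrightarrow> (\<And>q. q \<in> B \<Longrightarrow> dist p a \<le> dist p q) \<Longrightarrow>
      dist p b = dist p a \<Longrightarrow> dist p a < R \<Longrightarrow> a = b"
  shows "2 * reach (A \<union> B) = ereal d"
proof -
  let ?L = "A \<union> B"
  have L: "compact ?L" "?L \<noteq> {}" using A B by auto
  have "reach ?L = ereal (d / 2)"
  proof (rule antisym)
    show "reach ?L \<le> ereal (d / 2)"
      unfolding reach_def
    proof (rule Sup_least, clarify)
      fix r assume r: "\<forall>p. infdist p ?L < r \<longrightarrow> (\<exists>!q. q \<in> ?L \<and> dist p q = infdist p ?L)"
      have "r \<le> d / 2"
      proof (rule ccontr)
        assume "\<not> r \<le> d / 2"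
        define m where "m = midpoint a0 b0"
        have m: "dist m a0 = d / 2" "dist m b0 = d / 2"
          using attained by (simp_all add: m_def dist_midpoint dist_commute)
        have "infdist m ?L \<le> d / 2"
          using infdist_le[of a0 ?L m] attained m by simp
        with \<open>\<not> r \<le> d / 2\<close> have "infdist m ?L < r" by linarith
        with r have "\<exists>!q. q \<in> ?L \<and> dist m q = infdist m ?L" by blast
        then obtain q where q: "q \<in> ?L" "dist m q = infdist m ?L"
          and uniq: "\<And>q'. q' \<in> ?L \<Longrightarrow> dist m q' = infdist m ?L \<Longrightarrow> q' = q"
          by blast
        have "infdist m ?L = d / 2"
        proof (cases "q \<in> A")
          case True
          then have "d \<le> dist q b0" using d(3) attained by blast
          then show ?thesis
            using dist_triangle[of q b0 m] m q(2) \<open>infdist m ?L \<le> d / 2\<close> by (simp add: dist_commute)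
        next
          case False
          then have "d \<le> dist a0 q" using q d(3) attained by blast
          then show ?thesis
            using dist_triangle[of a0 q m] m q(2) \<open>infdist m ?L \<le> d / 2\<close> by (simp add: dist_commute)
        qed
        then have "a0 = q" "b0 = q"
          using attained m by (intro uniq; simp)+
        then show False using attained d by simp
      qed
      then show "ereal r \<le> ereal (d / 2)" by simp
    qed
    have "\<exists>!q. q \<in> ?L \<and> dist p q = infdist p ?L" if p: "infdist p ?L < d / 2" for p
    proof -
      obtain q where q: "q \<in> ?L" "infdist p ?L = dist p q"
        using infdist_attains_inf[OF compact_imp_closed[OF L(1)] L(2)] by metis
      have least: "dist p q \<le> dist p z" if "z \<in> ?L" for z
        using infdist_le[OF that, of p] q by simp
      have "z = q" if z: "z \<in> ?L" "dist p z = infdist p ?L" for z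
      proof -
        have "dist z q < d"
          using dist_triangle[of z q p] z q p by (simp add: dist_commute)
        then have "\<not> (z \<in> A \<and> q \<in> B)" "\<not> (q \<in> A \<and> z \<in> B)"
          using d(3)[of z q] d(3)[of q z] by (auto simp: dist_commute)
        then consider "z \<in> A" "q \<in> A" | "z \<in> B" "q \<in> B"
          using z(1) q(1) by blast
        moreover have eq: "dist p z = dist p q" and small: "dist p q < R"
          using z q p d(2) by linarith+
        ultimately show ?thesis
        proof cases
          case 1
          then show ?thesis
            using unique_A[OF 1(2,1) _ eq small] least by (metis UnI1)
        next
          case 2
          then show ?thesis
            using unique_B[OF 2(2,1) _ eq small] least by (metis UnI2)
        qed
      qed
      with q show ?thesis by (intro ex1I[of _ q]) auto
    qed
    then show "ereal (d / 2) \<le> reach ?L"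
      unfolding reach_def by (intro Sup_upper) blast
  qed
  then show ?thesis by simp
qed

section \<open>The kinky clasp\<close>

text \<open>
  The planes of the two components: the element \<open>(x, y, z) \<mapsto> (-y, x, -z)\<close> of \<open>2*2\<close> takes \<open>emb False x z\<close>
  to \<open>emb True x z\<close>.
\<close>

definition emb :: "bool \<Rightarrow> real \<Rightarrow> real \<Rightarrow> space" where
  "emb j x z = (if j then vector [0, x, - z] else vector [x, 0, z])"

lemma emb_simps:
  "emb j x z \<bullet> emb j x' z' = x * x' + z * z'"
  "emb j x z + emb j x' z' = emb j (x + x') (z + z')"
  "emb j x z - emb j x' z' = emb j (x - x') (z - z')"
  "c *\<^sub>R emb j x z = emb j (c * x) (c * z)"
  "emb j x z = 0 \<longleftrightarrow> x = 0 \<and> z = 0"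
  by (auto simp: emb_def inner_vec_def vec_eq_iff sum_3 forall_3)

lemma norm_emb: "norm (emb j x z) = sqrt (x\<^sup>2 + z\<^sup>2)"
  by (simp add: norm_eq_sqrt_inner emb_simps power2_eq_square)

lemma emb_eq: "emb j x z = x *\<^sub>R emb j 1 0 + z *\<^sub>R emb j 0 1"
  by (simp add: emb_simps)

lemma has_vector_derivative_emb:
  assumes "(f has_real_derivative f') (at x within S)" "(g has_real_derivative g') (at x within S)"
  shows "((\<lambda>x. emb j (f x) (g x)) has_vector_derivative emb j f' g') (at x within S)"
  unfolding emb_eq[of j "f _"] emb_eq[of j f']
  by (rule has_vector_derivative_add; rule has_vector_derivative_scaleR[OF _ has_vector_derivative_const, simplified])
    (use assms in auto)

lemma continuous_on_emb:
  assumes "continuous_on S f" "continuous_on S g"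
  shows "continuous_on S (\<lambda>x. emb j (f x) (g x))"
  unfolding emb_eq[of j "f _"] by (intro continuous_intros assms)

lemma abs_sin_diff_le: "\<bar>sin y - sin x\<bar> \<le> \<bar>y - x\<bar>"
  and abs_cos_diff_le: "\<bar>cos y - cos x\<bar> \<le> \<bar>y - x\<bar>" for x y :: real
proof -
  have "norm (sin y - sin x) \<le> 1 * norm (y - x)"
    by (rule field_differentiable_bound[of UNIV sin cos]) (auto intro!: derivative_eq_intros)
  then show "\<bar>sin y - sin x\<bar> \<le> \<bar>y - x\<bar>" by simp
  have "norm (cos y - cos x) \<le> 1 * norm (y - x)"
    by (rule field_differentiable_bound[of UNIV cos "\<lambda>x. - sin x"]) (auto intro!: derivative_eq_intros)
  then show "\<bar>cos y - cos x\<bar> \<le> \<bar>y - x\<bar>" by simp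
qed

lemma sin_taylor_quadratic: "\<bar>sin y - sin x - (y - x) * cos x\<bar> \<le> (y - x)\<^sup>2"
  and cos_taylor_quadratic: "\<bar>cos x - cos y - (y - x) * sin x\<bar> \<le> (y - x)\<^sup>2" for x y :: real
proof -
  let ?S = "closed_segment x y"
  have near: "\<bar>u - x\<bar> \<le> \<bar>y - x\<bar>" if "u \<in> ?S" for u
    using that by (auto simp: closed_segment_eq_real_ivl split: if_splits)
  have "norm ((sin y - y * cos x) - (sin x - x * cos x)) \<le> \<bar>y - x\<bar> * norm (y - x)"
  proof (rule field_differentiable_bound[of ?S _ "\<lambda>u. cos u - cos x"])
    fix u assume "u \<in> ?S"
    then show "norm (cos u - cos x) \<le> \<bar>y - x\<bar>"
      using near abs_cos_diff_le[of u x] by (metis order_trans real_norm_def)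
    show "((\<lambda>u. sin u - u * cos x) has_real_derivative cos u - cos x) (at u within ?S)"
      by (auto intro!: derivative_eq_intros)
  qed auto
  then show "\<bar>sin y - sin x - (y - x) * cos x\<bar> \<le> (y - x)\<^sup>2"
    by (simp add: algebra_simps power2_eq_square)
  have "norm ((- cos y - y * sin x) - (- cos x - x * sin x)) \<le> \<bar>y - x\<bar> * norm (y - x)"
  proof (rule field_differentiable_bound[of ?S _ "\<lambda>u. sin u - sin x"])
    fix u assume "u \<in> ?S"
    then show "norm (sin u - sin x) \<le> \<bar>y - x\<bar>"
      using near abs_sin_diff_le[of u x] by (metis order_trans real_norm_def)
    show "((\<lambda>u. - cos u - u * sin x) has_real_derivative sin u - sin x) (at u within ?S)"
      by (auto intro!: derivative_eq_intros)
  qed auto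
  then show "\<bar>cos x - cos y - (y - x) * sin x\<bar> \<le> (y - x)\<^sup>2"
    by (simp add: algebra_simps power2_eq_square)
qed

text \<open>
  The components of the clasp are parametrized by arclength, with the tip at parameter \<open>0\<close> and the
  endpoints at \<open>l\<close> and \<open>-l\<close>; \<open>ang\<close> is the angle of the tangent.
\<close>

locale kink =
  fixes \<tau> \<sigma> l :: real
  assumes tau: "0 \<le> \<tau>" "\<tau> \<le> 1" and sigma: "1 \<le> \<sigma>" and l: "\<sigma> * arcsin \<tau> < l"
begin

definition "\<alpha> = arcsin \<tau>"

definition ang :: "real \<Rightarrow> real" where
  "ang s = max (- \<alpha>) (min \<alpha> (s / \<sigma>))"

text \<open>The signed length of the part of the curve between the arc and the point \<open>s\<close> of a leg.\<close>

definition slack :: "real \<Rightarrow> real" where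
  "slack s = s - \<sigma> * ang s"

text \<open>A point of the circle at the clamped angle, continued along the tangent by the signed
  slack. The slack is 0 on the arc, so one formula serves for the arc and both legs.\<close>

definition "px s = \<sigma> * sin (ang s) + slack s * cos (ang s)"
definition "pz s = \<sigma> - 1/2 - \<sigma> * cos (ang s) + slack s * sin (ang s)"

definition "crv j s = emb j (px s) (pz s)"
definition "tng j s = emb j (cos (ang s)) (sin (ang s))"
definition "nrm j s = emb j (- sin (ang s)) (cos (ang s))"

lemma alpha: "0 \<le> \<alpha>" "\<alpha> \<le> pi / 2" "sin \<alpha> = \<tau>" "cos \<alpha> = sqrt (1 - \<tau>\<^sup>2)" "\<sigma> * \<alpha> < l"
  using tau l arcsin_le_arcsin[of 0 \<tau>] arcsin_ubound[of \<tau>] by (auto simp: \<alpha>_def cos_arcsin)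

lemma sigma_pos: "0 < \<sigma>" using sigma by simp

lemma sigma_alpha_nonneg: "0 \<le> \<sigma> * \<alpha>" using sigma alpha(1) by simp

lemma ang_bounds: "- \<alpha> \<le> ang s" "ang s \<le> \<alpha>"
  using alpha(1) by (auto simp: ang_def)

lemma slack_cases:
  obtains "slack s = 0" "ang s = s / \<sigma>" "\<bar>s\<bar> \<le> \<sigma> * \<alpha>"
  | "0 < slack s" "ang s = \<alpha>" "slack s = s - \<sigma> * \<alpha>"
  | "slack s < 0" "ang s = - \<alpha>" "slack s = s + \<sigma> * \<alpha>"
proof -
  consider "\<bar>s\<bar> \<le> \<sigma> * \<alpha>" | "\<sigma> * \<alpha> < s" | "s < - (\<sigma> * \<alpha>)" by linarith
  then show thesis using sigma_alpha_nonneg alpha(1)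
  proof cases
    case 1
    then have "ang s = s / \<sigma>"
      using sigma_pos alpha(1) by (auto simp: ang_def max_def min_def field_simps abs_le_iff)
    then show ?thesis using that(1) 1 sigma_pos by (simp add: slack_def)
  next
    case 2
    then have "ang s = \<alpha>"
      using sigma_pos alpha(1) by (auto simp: ang_def max_def min_def field_simps)
    then show ?thesis using that(2) 2 by (simp add: slack_def)
  next
    case 3
    then have "s < \<sigma> * \<alpha>" using sigma_alpha_nonneg by linarith
    with 3 have "ang s = - \<alpha>"
      using sigma_pos alpha(1) by (auto simp: ang_def max_def min_def field_simps)
    then show ?thesis using that(3) 3 by (simp add: slack_def)
  qed
qed

lemma ang_arc: "\<bar>s\<bar> \<le> \<sigma> * \<alpha> \<Longrightarrow> ang s = s / \<sigma>"
  and slack_arc: "\<bar>s\<bar> \<le> \<sigma> * \<alpha> \<Longrightarrow> slack s = 0"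
  by (cases s rule: slack_cases; linarith)+

lemma ang_uminus: "ang (- s) = - ang s"
  using alpha(1) by (auto simp: ang_def max_def min_def)

lemma ang_lipschitz: "\<bar>ang s - ang s'\<bar> \<le> \<bar>s - s'\<bar> / \<sigma>"
proof -
  have "\<bar>max (-a) (min a x) - max (-a) (min a y)\<bar> \<le> \<bar>x - y\<bar>" for a x y :: real
    by (auto simp: max_def min_def)
  from this[of \<alpha> "s / \<sigma>" "s' / \<sigma>"] show ?thesis
    using sigma_pos by (simp add: ang_def abs_divide flip: diff_divide_distrib)
qed

lemma ang_lipschitz': "\<bar>ang s - ang s'\<bar> \<le> \<bar>s - s'\<bar>"
proof -
  have "\<bar>s - s'\<bar> / \<sigma> \<le> \<bar>s - s'\<bar> / 1"
    using sigma by (intro divide_left_mono) auto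
  then show ?thesis using ang_lipschitz[of s s'] by simp
qed

lemma continuous_on_ang: "continuous_on S ang"
  unfolding ang_def[abs_def] using sigma_pos by (intro continuous_intros) auto

lemma slack_le: "s \<in> {-l..l} \<Longrightarrow> \<bar>slack s\<bar> \<le> l - \<sigma> * \<alpha>"
  using alpha(5) by (cases s rule: slack_cases) auto

text \<open>The slack is nonzero only on a leg, where the angle has its extreme value of the same
  sign; no other angle lies beyond it, and angles differ by at most \<open>pi\<close>.\<close>

lemma slack_sin_nonneg: "0 \<le> slack s * sin (ang s - ang s')"
proof (cases s rule: slack_cases)
  case 2
  then have "0 \<le> sin (ang s - ang s')"
    using ang_bounds[of s'] alpha by (intro sin_ge_zero) auto
  with 2 show ?thesis by simp
next
  case 3
  then have "0 \<le> sin (ang s' - ang s)"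
    using ang_bounds[of s'] alpha by (intro sin_ge_zero) auto
  moreover have "sin (ang s - ang s') = - sin (ang s' - ang s)"
    by (metis minus_diff_eq sin_minus)
  ultimately show ?thesis using 3 by (simp add: mult_nonpos_nonneg)
qed simp

text \<open>If the angles differ and s' lies on a leg, then s is not beyond the junction of that
  leg, so the slack at s' is at most the distance of the parameters. This makes the term caused by
  the corner of \<open>ang\<close> quadratically small.\<close>

lemma slack_ang_le: "\<bar>slack s'\<bar> * \<bar>ang s' - ang s\<bar> \<le> (s' - s)\<^sup>2"
proof (cases "ang s' = ang s")
  case False
  have "\<bar>slack s'\<bar> \<le> \<bar>s' - s\<bar>"
  proof (cases s' rule: slack_cases)
    case 2
    with False ang_bounds[of s] have "ang s < \<alpha>" by auto
    then have "s \<le> \<sigma> * \<alpha>" by (cases s rule: slack_cases) (use sigma_alpha_nonneg in auto)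
    with 2 show ?thesis by auto
  next
    case 3
    with False ang_bounds[of s] have "- \<alpha> < ang s" by auto
    then have "- (\<sigma> * \<alpha>) \<le> s" by (cases s rule: slack_cases) (use sigma_alpha_nonneg in auto)
    with 3 show ?thesis by auto
  qed simp
  then have "\<bar>slack s'\<bar> * \<bar>ang s' - ang s\<bar> \<le> \<bar>s' - s\<bar> * \<bar>s' - s\<bar>"
    using ang_lipschitz' by (intro mult_mono) auto
  then show ?thesis by (simp add: power2_eq_square)
qed simp

text \<open>At the junctions \<open>ang\<close> and \<open>slack\<close> have corners, but these
  cancel: the remainder is bounded by a multiple of \<open>(y - s)\<^sup>2\<close> at every
  parameter, so no case distinction is made.\<close>

lemma has_real_derivative_px: "(px has_real_derivative cos (ang s)) (at s)"
  and has_real_derivative_pz: "(pz has_real_derivative sin (ang s)) (at s)"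
proof -
  have ang2: "\<sigma> * (ang y - ang s)\<^sup>2 \<le> \<sigma> * (y - s)\<^sup>2" for y
    using abs_le_square_iff[THEN iffD1, OF ang_lipschitz'[of y s]] sigma_pos by (intro mult_left_mono) auto
  have bound: "\<bar>\<sigma> * A + slack y * B\<bar> \<le> (\<sigma> + 1) * (y - s)\<^sup>2"
    if "\<bar>A\<bar> \<le> (ang y - ang s)\<^sup>2" "\<bar>B\<bar> \<le> \<bar>ang y - ang s\<bar>" for A B y
  proof -
    have "\<bar>\<sigma> * A\<bar> \<le> \<sigma> * (ang y - ang s)\<^sup>2"
      using that sigma_pos by (simp add: abs_mult)
    moreover have "\<bar>slack y * B\<bar> \<le> (y - s)\<^sup>2"
      using that mult_left_mono[of "\<bar>B\<bar>" "\<bar>ang y - ang s\<bar>" "\<bar>slack y\<bar>"] slack_ang_le[of y s]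
      by (simp add: abs_mult)
    ultimately show ?thesis using ang2[of y] by (simp add: algebra_simps)
  qed
  show "(px has_real_derivative cos (ang s)) (at s)"
  proof (rule has_real_derivative_quadratic)
    fix y
    \<comment> \<open>Uses \<open>y - s = \<sigma> * (ang y - ang s) + (slack y - slack s)\<close>;
      the slack at s cancels against its own tangent.\<close>
    have "px y - px s - (y - s) * cos (ang s) =
        \<sigma> * (sin (ang y) - sin (ang s) - (ang y - ang s) * cos (ang s)) + slack y * (cos (ang y) - cos (ang s))"
      by (simp add: px_def slack_def algebra_simps)
    also have "\<bar>\<dots>\<bar> \<le> (\<sigma> + 1) * (y - s)\<^sup>2"
      by (intro bound sin_taylor_quadratic abs_cos_diff_le)
    finally show "\<bar>px y - px s - (y - s) * cos (ang s)\<bar> \<le> (\<sigma> + 1) * (y - s)\<^sup>2" .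
  qed
  show "(pz has_real_derivative sin (ang s)) (at s)"
  proof (rule has_real_derivative_quadratic)
    fix y
    have "pz y - pz s - (y - s) * sin (ang s) =
        \<sigma> * (cos (ang s) - cos (ang y) - (ang y - ang s) * sin (ang s)) + slack y * (sin (ang y) - sin (ang s))"
      by (simp add: pz_def slack_def algebra_simps)
    also have "\<bar>\<dots>\<bar> \<le> (\<sigma> + 1) * (y - s)\<^sup>2"
      by (intro bound abs_sin_diff_le cos_taylor_quadratic)
    finally show "\<bar>pz y - pz s - (y - s) * sin (ang s)\<bar> \<le> (\<sigma> + 1) * (y - s)\<^sup>2" .
  qed
qed

lemma has_vector_derivative_crv: "(crv j has_vector_derivative tng j s) (at s within S)"
  unfolding crv_def[abs_def] tng_def
  by (intro has_vector_derivative_emb has_field_derivative_at_within[OF has_real_derivative_px]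
      has_field_derivative_at_within[OF has_real_derivative_pz])

lemma continuous_on_crv: "continuous_on S (crv j)"
  using has_vector_derivative_crv by (meson continuous_on_eq_continuous_within has_vector_derivative_continuous)

lemma continuous_on_tng: "continuous_on S (tng j)"
  unfolding tng_def[abs_def] by (intro continuous_on_emb continuous_intros continuous_on_ang)

lemma norm_tng [simp]: "norm (tng j s) = 1"
  and norm_nrm [simp]: "norm (nrm j s) = 1"
  by (simp_all add: tng_def nrm_def norm_emb)

lemma inner_tng_nrm [simp]: "tng j s \<bullet> nrm j s = 0" "nrm j s \<bullet> tng j s = 0"
  by (simp_all add: tng_def nrm_def emb_simps)

lemma tng_lipschitz: "(2 / \<sigma>)-lipschitz_on S (tng j)"
proof (rule lipschitz_onI)
  fix x y
  have "dist (tng j x) (tng j y) \<le> \<bar>cos (ang x) - cos (ang y)\<bar> + \<bar>sin (ang x) - sin (ang y)\<bar>"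
    using sqrt_sum_squares_le_sum_abs by (simp add: dist_norm tng_def emb_simps norm_emb)
  also have "\<dots> \<le> 2 * \<bar>ang x - ang y\<bar>"
    using abs_cos_diff_le[of "ang x" "ang y"] abs_sin_diff_le[of "ang x" "ang y"] by simp
  also have "\<dots> \<le> 2 / \<sigma> * dist x y"
    using ang_lipschitz[of x y] by (simp add: dist_real_def)
  finally show "dist (tng j x) (tng j y) \<le> 2 / \<sigma> * dist x y" .
qed (use sigma_pos in simp)

lemma has_vector_derivative_tng_arc:
  assumes "\<bar>s\<bar> < \<sigma> * \<alpha>"
  shows "(tng j has_vector_derivative (1 / \<sigma>) *\<^sub>R nrm j s) (at s)"
    and "(nrm j has_vector_derivative - (1 / \<sigma>) *\<^sub>R tng j s) (at s)"
proof -
  have ang: "ang x = x / \<sigma>" if "x \<in> {- (\<sigma> * \<alpha>)<..<\<sigma> * \<alpha>}" for x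
    using that by (intro ang_arc) auto
  have s: "s \<in> {- (\<sigma> * \<alpha>)<..<\<sigma> * \<alpha>}" using assms by auto
  have "((\<lambda>x. emb j (cos (x / \<sigma>)) (sin (x / \<sigma>))) has_vector_derivative
      emb j (- sin (s / \<sigma>) * (1 / \<sigma>)) (cos (s / \<sigma>) * (1 / \<sigma>))) (at s)"
    using sigma_pos by (intro has_vector_derivative_emb) (auto intro!: derivative_eq_intros)
  then have "((\<lambda>x. emb j (cos (x / \<sigma>)) (sin (x / \<sigma>))) has_vector_derivative (1 / \<sigma>) *\<^sub>R nrm j s) (at s)"
    by (simp add: nrm_def emb_simps ang[OF s])
  then show "(tng j has_vector_derivative (1 / \<sigma>) *\<^sub>R nrm j s) (at s)"
    by (rule has_vector_derivative_transform_within_open[OF _ _ s]) (auto simp: tng_def ang)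
  have "((\<lambda>x. emb j (- sin (x / \<sigma>)) (cos (x / \<sigma>))) has_vector_derivative
      emb j (- cos (s / \<sigma>) * (1 / \<sigma>)) (- sin (s / \<sigma>) * (1 / \<sigma>))) (at s)"
    using sigma_pos by (intro has_vector_derivative_emb) (auto intro!: derivative_eq_intros)
  then have "((\<lambda>x. emb j (- sin (x / \<sigma>)) (cos (x / \<sigma>))) has_vector_derivative - (1 / \<sigma>) *\<^sub>R tng j s) (at s)"
    by (simp add: tng_def emb_simps ang[OF s])
  then show "(nrm j has_vector_derivative - (1 / \<sigma>) *\<^sub>R tng j s) (at s)"
    by (rule has_vector_derivative_transform_within_open[OF _ _ s]) (auto simp: nrm_def ang)
qed

lemma has_vector_derivative_leg:
  assumes "\<sigma> * \<alpha> < \<bar>s\<bar>"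
  shows "(tng j has_vector_derivative 0) (at s)" "(nrm j has_vector_derivative 0) (at s)"
    "(ang has_real_derivative 0) (at s)"
proof -
  define S where "S = (if 0 < s then {\<sigma> * \<alpha><..} else {..<- (\<sigma> * \<alpha>)})"
  have S: "open S" "s \<in> S" using assms alpha(1) sigma_pos by (auto simp: S_def)
  have ang: "ang x = ang s" if "x \<in> S" for x
    using that S(2) sigma_alpha_nonneg
    by (cases x rule: slack_cases; cases s rule: slack_cases) (auto simp: S_def split: if_splits)
  show "(tng j has_vector_derivative 0) (at s)"
    by (rule has_vector_derivative_transform_within_open[OF _ S, of "\<lambda>_. tng j s"])
      (auto simp: tng_def ang)
  show "(nrm j has_vector_derivative 0) (at s)"
    by (rule has_vector_derivative_transform_within_open[OF _ S, of "\<lambda>_. nrm j s"])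
      (auto simp: nrm_def ang)
  show "(ang has_real_derivative 0) (at s)"
    by (rule has_field_derivative_transform_within_open[OF _ S, of "\<lambda>_. ang s"]) (auto simp: ang)
qed

section \<open>Chords in the frame at one of their endpoints\<close>

lemma chord_tangential:
  "(crv j b - crv j a) \<bullet> tng j a =
    \<sigma> * sin (ang b - ang a) + slack b * cos (ang b - ang a) - slack a"
proof -
  have "cos t * (\<sigma> * sin p + q * cos p - (\<sigma> * sin t + r * cos t))
      + sin t * (- \<sigma> * cos p + q * sin p + \<sigma> * cos t - r * sin t)
      = \<sigma> * sin (p - t) + q * cos (p - t) - r * ((sin t)\<^sup>2 + (cos t)\<^sup>2)" for p q r t
    unfolding sin_diff cos_diff by algebra
  from this[of "ang a" "ang b" "slack b" "slack a"] show ?thesis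
    by (simp add: crv_def tng_def emb_simps px_def pz_def algebra_simps)
qed

text \<open>A rotation by \<open>- ang a\<close> makes the tangent at a horizontal, so that the
  components of the chord depend on the angles only through their difference. Both summands of the
  normal component are nonnegative: the curve bends to one side.\<close>

lemma chord_normal:
  "(crv j b - crv j a) \<bullet> nrm j a = slack b * sin (ang b - ang a) + \<sigma> * (1 - cos (ang b - ang a))"
proof -
  have "- sin t * (\<sigma> * sin p + q * cos p - (\<sigma> * sin t + r * cos t))
      + cos t * (- \<sigma> * cos p + q * sin p + \<sigma> * cos t - r * sin t)
      = q * sin (p - t) + \<sigma> * (((sin t)\<^sup>2 + (cos t)\<^sup>2) - cos (p - t))" for p q r t
    unfolding sin_diff cos_diff by algebra
  from this[of "ang a" "ang b" "slack b" "slack a"] show ?thesis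
    by (simp add: crv_def nrm_def emb_simps px_def pz_def algebra_simps)
qed

lemma chord_decomposition:
  "crv j b - crv j a = ((crv j b - crv j a) \<bullet> tng j a) *\<^sub>R tng j a + ((crv j b - crv j a) \<bullet> nrm j a) *\<^sub>R nrm j a"
proof -
  have "x = (x * c + z * s) * c + (z * c - x * s) * (- s)" "z = (x * c + z * s) * s + (z * c - x * s) * c"
    if "s\<^sup>2 + c\<^sup>2 = 1" for x z s c :: real
    using that by algebra+
  from this[OF sin_cos_squared_add]
  show ?thesis
    unfolding crv_def tng_def nrm_def emb_simps
    by (simp add: emb_def algebra_simps)
qed

text \<open>
  The curve lies at distance \<open>\<sigma>\<close> from a convex set, so that the balls of radius \<open>\<sigma>\<close> tangent to it
  contain none of its points.
\<close>

lemma normal_part_chord: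
  "norm (normal_part (tng j a) (crv j b - crv j a)) \<le> (norm (crv j b - crv j a))\<^sup>2 / (2 * \<sigma>)"
proof -
  define D where "D = ang b - ang a"
  define X where "X = (crv j b - crv j a) \<bullet> tng j a"
  define Y where "Y = (crv j b - crv j a) \<bullet> nrm j a"
  define q r where "q = slack b" and "r = slack a"
  have X: "X = \<sigma> * sin D + q * cos D - r" and Y: "Y = q * sin D + \<sigma> * (1 - cos D)"
    by (simp_all add: X_def Y_def D_def q_def r_def chord_tangential chord_normal)
  have chord: "crv j b - crv j a = X *\<^sub>R tng j a + Y *\<^sub>R nrm j a"
    unfolding X_def Y_def by (rule chord_decomposition)
  have "normal_part (tng j a) (crv j b - crv j a) = Y *\<^sub>R nrm j a"
    unfolding normal_part_def X_def[symmetric] by (simp add: chord)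
  moreover have "0 \<le> Y"
    using slack_sin_nonneg[of b a] sigma_pos by (simp add: Y q_def D_def)
  \<comment> \<open>Says that the endpoint b is outside the open disc of radius \<sigma> that
    touches the curve at a, whose centre has coordinates 0 and \<sigma> in the frame.\<close>
  moreover have "2 * \<sigma> * Y \<le> X\<^sup>2 + Y\<^sup>2"
  proof -
    have "X\<^sup>2 + Y\<^sup>2 - 2 * \<sigma> * Y = q\<^sup>2 + r\<^sup>2 - 2 * q * r * cos D - 2 * \<sigma> * (r * sin D)"
    proof -
      have "(\<sigma> * S + q * C - r)\<^sup>2 + (q * S + \<sigma> * (1 - C))\<^sup>2 - 2 * \<sigma> * (q * S + \<sigma> * (1 - C)) =
          (\<sigma>\<^sup>2 + q\<^sup>2) * (S\<^sup>2 + C\<^sup>2) - \<sigma>\<^sup>2 + r\<^sup>2 - 2 * q * r * C - 2 * \<sigma> * (r * S)" for S C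
        by (simp add: power2_eq_square algebra_simps)
      from this[of "sin D" "cos D"] show ?thesis
        unfolding X Y by simp
    qed
    moreover have "0 \<le> (q\<^sup>2 + r\<^sup>2 - 2 * q * r * cos D)"
    proof -
      have "\<bar>2 * q * r * cos D\<bar> = (2 * \<bar>q\<bar> * \<bar>r\<bar>) * \<bar>cos D\<bar>" by (simp add: abs_mult)
      also have "\<dots> \<le> (2 * \<bar>q\<bar> * \<bar>r\<bar>) * 1" by (intro mult_left_mono) auto
      finally have "2 * q * r * cos D \<le> 2 * \<bar>q\<bar> * \<bar>r\<bar>" by linarith
      moreover have "0 \<le> (\<bar>q\<bar> - \<bar>r\<bar>)\<^sup>2" by simp
      then have "2 * \<bar>q\<bar> * \<bar>r\<bar> \<le> q\<^sup>2 + r\<^sup>2" by (simp add: power2_diff)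
      ultimately show ?thesis by linarith
    qed
    moreover have "r * sin D \<le> 0"
    proof -
      have "sin D = - sin (ang a - ang b)" unfolding D_def by (metis minus_diff_eq sin_minus)
      then show ?thesis using slack_sin_nonneg[of a b] by (simp add: r_def)
    qed
    then have "2 * \<sigma> * (r * sin D) \<le> 0"
      using sigma_pos by (simp add: mult_nonneg_nonpos[of "2 * \<sigma>" "r * sin D"])
    ultimately show ?thesis by linarith
  qed
  moreover have "(norm (crv j b - crv j a))\<^sup>2 = X\<^sup>2 + Y\<^sup>2"
  proof -
    have "tng j a \<bullet> tng j a = 1" "nrm j a \<bullet> nrm j a = 1"
      by (simp_all only: norm_eq_1[symmetric] norm_tng norm_nrm)
    then show ?thesis
      unfolding power2_norm_eq_inner chord
      by (simp add: inner_add_left inner_add_right power2_eq_square)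
  qed
  ultimately show ?thesis
    using sigma_pos by (simp add: field_simps)
qed

lemma ang_l: "ang l = \<alpha>"
  by (cases l rule: slack_cases) (use alpha(5) sigma_alpha_nonneg in auto)

text \<open>The curve turns by at most \<open>pi\<close>, and no slack is larger than that of the
  ends, so the curve stays on the inner side of the normal planes at its ends. This gives the sign
  of the first-order condition for a nearest point that is an endpoint.\<close>

lemma chord_endpoints:
  assumes "s \<in> {-l..l}"
  shows "0 \<le> (crv j s - crv j (- l)) \<bullet> tng j (- l)" "(crv j s - crv j l) \<bullet> tng j l \<le> 0"
proof -
  have ends: "ang l = \<alpha>" "slack l = l - \<sigma> * \<alpha>" "ang (- l) = - \<alpha>" "slack (- l) = \<sigma> * \<alpha> - l"
    by (simp_all add: ang_l ang_uminus slack_def)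
  have cos: "\<bar>slack s * cos D\<bar> \<le> l - \<sigma> * \<alpha>" for D
    using mult_mono[OF slack_le[OF assms] abs_cos_le_one[of D]] alpha(5) by (simp add: abs_mult)
  have "0 \<le> sin (ang s + \<alpha>)"
    using ang_bounds[of s] alpha by (intro sin_ge_zero) auto
  then have "0 \<le> \<sigma> * sin (ang s + \<alpha>)" using sigma_pos by simp
  then show "0 \<le> (crv j s - crv j (- l)) \<bullet> tng j (- l)"
    using cos[of "ang s + \<alpha>"] unfolding chord_tangential ends by (simp add: abs_le_iff)
  have "0 \<le> sin (\<alpha> - ang s)"
    using ang_bounds[of s] alpha by (intro sin_ge_zero) auto
  then have "0 \<le> \<sigma> * sin (\<alpha> - ang s)" using sigma_pos by simp
  moreover have "\<sigma> * sin (ang s - \<alpha>) = - (\<sigma> * sin (\<alpha> - ang s))"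
    by (metis minus_diff_eq mult_minus_right sin_minus)
  ultimately show "(crv j s - crv j l) \<bullet> tng j l \<le> 0"
    using cos[of "ang s - \<alpha>"] unfolding chord_tangential ends by (simp add: abs_le_iff)
qed

text \<open>A vanishing chord has vanishing normal component, a sum of nonnegative terms, which
  forces equal angles; the tangential component then forces equal slack, and angle and slack
  determine the parameter.\<close>

lemma inj_crv: "inj_on (crv j) S"
proof (rule inj_onI)
  fix a b assume eq: "crv j a = crv j b"
  define D where "D = ang b - ang a"
  have 1: "slack b * sin D + \<sigma> * (1 - cos D) = 0" and 2: "\<sigma> * sin D + slack b * cos D = slack a"
    using chord_normal[of j b a] chord_tangential[of j b a] eq by (simp_all add: D_def)
  have "0 \<le> slack b * sin D" unfolding D_def by (rule slack_sin_nonneg)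
  moreover have "0 \<le> \<sigma> * (1 - cos D)" using sigma_pos by simp
  ultimately have "cos D = 1" using 1 sigma_pos by (auto simp: add_nonneg_eq_0_iff)
  moreover have "\<bar>D\<bar> \<le> pi" using ang_bounds[of a] ang_bounds[of b] alpha(2) by (auto simp: D_def)
  ultimately have "D = 0"
    using cos_inj_pi[of "\<bar>D\<bar>" 0] by simp
  then show "a = b" using 2 by (simp add: D_def slack_def)
qed

lemma crv_0: "crv j 0 = emb j 0 (- 1/2)" "tng j 0 = emb j 1 0" "nrm j 0 = emb j 0 1"
proof -
  have "ang 0 = 0" "slack 0 = 0" using alpha(1) sigma_pos by (simp_all add: ang_arc slack_arc)
  then show "crv j 0 = emb j 0 (- 1/2)" "tng j 0 = emb j 1 0" "nrm j 0 = emb j 0 1"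
    by (simp_all add: crv_def tng_def nrm_def px_def pz_def)
qed

text \<open>With \<zeta> the height above the tip,
  \<open>(px s)\<^sup>2 + (\<zeta> s)\<^sup>2 - 2 * \<zeta> s\<close> equals
  \<open>(slack s)\<^sup>2 + 2 * (\<sigma> - 1) * \<zeta> s\<close>. It is nonnegative because
  \<sigma> is at least 1, and says that the component stays outside the open unit ball about the tip
  of the other. The squared distance is 1 plus these two expressions plus the product term
  \<open>2 * (\<zeta> s * \<zeta> s')\<close>.\<close>

lemma components_distance:
  "1 \<le> (crv False s - crv True s') \<bullet> (crv False s - crv True s')"
proof -
  define \<zeta> where "\<zeta> s = pz s + 1/2" for s
  have \<zeta>: "0 \<le> \<zeta> s" for s
  proof -
    have "\<sigma> * cos (ang s) \<le> \<sigma> * 1" using sigma_pos by (intro mult_left_mono) auto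
    then show ?thesis
      using slack_sin_nonneg[of s 0] ang_arc[of 0] sigma_alpha_nonneg by (simp add: \<zeta>_def pz_def)
  qed
  have q: "0 \<le> (px s)\<^sup>2 + (\<zeta> s)\<^sup>2 - 2 * \<zeta> s" for s
  proof -
    have "(px s)\<^sup>2 + (\<zeta> s)\<^sup>2 - 2 * \<zeta> s = (slack s)\<^sup>2 + 2 * (\<sigma> - 1) * \<zeta> s"
    proof -
      have "(\<sigma> * S + r * C)\<^sup>2 + (\<sigma> - \<sigma> * C + r * S)\<^sup>2 =
          (\<sigma>\<^sup>2 + r\<^sup>2) * (S\<^sup>2 + C\<^sup>2) - \<sigma>\<^sup>2 + 2 * \<sigma> * (\<sigma> - \<sigma> * C + r * S)" for r S C
        by (simp add: power2_eq_square algebra_simps)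
      from this[of "sin (ang s)" "slack s" "cos (ang s)"] show ?thesis
        by (simp add: \<zeta>_def px_def pz_def algebra_simps)
    qed
    then show ?thesis using \<zeta>[of s] sigma by simp
  qed
  have "(crv False s - crv True s') \<bullet> (crv False s - crv True s') = (px s)\<^sup>2 + (px s')\<^sup>2 + (pz s + pz s')\<^sup>2"
    by (simp add: crv_def emb_def inner_vec_def sum_3 power2_eq_square algebra_simps)
  also have "\<dots> = 1 + ((px s)\<^sup>2 + (\<zeta> s)\<^sup>2 - 2 * \<zeta> s) + ((px s')\<^sup>2 + (\<zeta> s')\<^sup>2 - 2 * \<zeta> s') + 2 * (\<zeta> s * \<zeta> s')"
    by (simp add: \<zeta>_def power2_eq_square algebra_simps)
  finally show ?thesis using q[of s] q[of s'] mult_nonneg_nonneg[OF \<zeta>[of s] \<zeta>[of s']] by linarith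
qed

lemma tips_distance: "crv False 0 - crv True 0 = - nrm False 0" "nrm True 0 = - nrm False 0"
  by (auto simp: crv_0 emb_def vec_eq_iff forall_3)

lemma has_vector_derivative_compose_crv:
  assumes "\<And>x. (f has_derivative blinfun_apply (A x)) (at x)"
  shows "((\<lambda>s. f (crv j s)) has_vector_derivative blinfun_apply (A (crv j s)) (tng j s)) (at s)"
  using vector_derivative_diff_chain_within[of "crv j" "tng j s" s UNIV f, OF has_vector_derivative_crv
      has_derivative_at_withinI[OF assms]] by (simp add: o_def)

end

section \<open>Perturbed clasps\<close>

text \<open>The squared curvature of a curve with velocity v and acceleration a.\<close>

definition curv2 :: "space \<Rightarrow> space \<Rightarrow> real" where
  "curv2 v a = ((v \<bullet> v) * (a \<bullet> a) - (v \<bullet> a)\<^sup>2) / (v \<bullet> v) ^ 3"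



lemma curv2_le: "v \<noteq> 0 \<Longrightarrow> curv2 v a \<le> (norm a)\<^sup>2 / (norm v) ^ 4"
proof -
  assume "v \<noteq> 0"
  have "curv2 v a \<le> ((v \<bullet> v) * (a \<bullet> a)) / (v \<bullet> v) ^ 3"
    unfolding curv2_def by (intro divide_right_mono) auto
  also have "\<dots> = (norm a)\<^sup>2 / (norm v) ^ 4"
    using \<open>v \<noteq> 0\<close> unfolding power2_norm_eq_inner[symmetric] by (simp add: field_simps eval_nat_numeral)
  finally show ?thesis .
qed

lemma derivative_at_interval_minimum:
  fixes f :: "real \<Rightarrow> real"
  assumes "(f has_real_derivative d) (at x)" "x \<in> {a..b}" "\<And>y. y \<in> {a..b} \<Longrightarrow> f x \<le> f y"
  shows "x < b \<Longrightarrow> 0 \<le> d" "a < x \<Longrightarrow> d \<le> 0"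
proof -
  assume "x < b"
  show "0 \<le> d"
  proof (rule ccontr)
    assume "\<not> 0 \<le> d"
    then obtain e where "0 < e" and e: "\<forall>h>0. h < e \<longrightarrow> f (x + h) < f x"
      using DERIV_neg_dec_right[OF assms(1)] by auto
    define h where "h = min (e/2) (b - x)"
    have "0 < h" "h < e" "x + h \<in> {a..b}"
      using \<open>0 < e\<close> \<open>x < b\<close> assms(2) by (auto simp: h_def)
    then show False using e assms(3)[of "x + h"] by fastforce
  qed
next
  assume "a < x"
  show "d \<le> 0"
  proof (rule ccontr)
    assume "\<not> d \<le> 0"
    then obtain e where "0 < e" and e: "\<forall>h>0. h < e \<longrightarrow> f (x - h) < f x"
      using DERIV_pos_inc_left[OF assms(1)] by auto
    define h where "h = min (e/2) (x - a)"
    have "0 < h" "h < e" "x - h \<in> {a..b}"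
      using \<open>0 < e\<close> \<open>a < x\<close> assms(2) by (auto simp: h_def)
    then show False using e assms(3)[of "x - h"] by fastforce
  qed
qed

lemma islimpt_open_interval:
  fixes a b :: real
  assumes "a < b" "s \<in> {a..b}"
  shows "s islimpt {a<..<b}"
proof -
  consider "s = a" | "s = b" | "s \<in> interior {a<..<b}" using assms by force
  then show ?thesis
    by cases (use assms(1) in \<open>auto intro: islimpt_greaterThanLessThan1 islimpt_greaterThanLessThan2
      interior_limit_point\<close>)
qed

context kink
begin

definition "base = crv False ` {-l..l} \<union> crv True ` {-l..l}"

text \<open>The curvature vector of the unperturbed component. The value 0 at the junctions is a
  mere default; they are excluded from \<open>smooth_params\<close>.\<close>

definition "kv j s = (if \<bar>s\<bar> < \<sigma> * \<alpha> then (1 / \<sigma>) *\<^sub>R nrm j s else 0)"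

definition "smooth_params = {s. \<bar>s\<bar> < l \<and> \<bar>s\<bar> \<noteq> \<sigma> * \<alpha>}"

lemma crv_in_base: "s \<in> {-l..l} \<Longrightarrow> crv j s \<in> base"
  unfolding base_def by (cases j) simp_all

lemma crv_neq: "crv j u \<noteq> crv (\<not> j) v"
proof -
  have ne: "crv False u \<noteq> crv True v" for u v
    using components_distance[of u v] by auto
  show ?thesis using ne[of u v] ne[of v u, symmetric] by (cases j) simp_all
qed

lemma l_pos: "0 < l" using alpha(5) sigma_alpha_nonneg by linarith

lemma has_vector_derivative_tng:
  "s \<in> smooth_params \<Longrightarrow> (tng j has_vector_derivative kv j s) (at s)"
  unfolding smooth_params_def kv_def
  using has_vector_derivative_tng_arc(1)[of s j] has_vector_derivative_leg(1)[of s j]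
  by (cases "\<bar>s\<bar> < \<sigma> * \<alpha>") auto

lemma islimpt_smooth_params: "s \<in> {-l..l} \<Longrightarrow> s islimpt smooth_params"
proof -
  assume s: "s \<in> {-l..l}"
  have "s islimpt {-l<..<l}"
    using s l_pos by (intro islimpt_open_interval) auto
  moreover have "{-l<..<l} \<subseteq> {\<sigma> * \<alpha>, - (\<sigma> * \<alpha>)} \<union> smooth_params"
    unfolding smooth_params_def by auto
  ultimately have "s islimpt ({\<sigma> * \<alpha>, - (\<sigma> * \<alpha>)} \<union> smooth_params)"
    by (rule islimpt_subset)
  then show ?thesis by (simp add: islimpt_insert)
qed

end

text \<open>Closeness is asked for on a ball, because mean value estimates between points of
  \<open>base\<close> run along segments that leave \<open>base\<close>. The constant 1/20 preserves
  unique nearest points on each component up to distance 3/4; the second derivative is measured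
  against \<open>1 / \<sigma>\<close>, the curvature of the arc, so that the legs stay far from
  critical curvature.\<close>

locale near_identity = kink +
  fixes \<phi> :: "space \<Rightarrow> space" and F1 :: "space \<Rightarrow> space \<Rightarrow>\<^sub>L space"
    and F2 :: "space \<Rightarrow> space \<Rightarrow>\<^sub>L (space \<Rightarrow>\<^sub>L space)" and B :: real
  assumes inj_phi: "inj \<phi>"
    and F1: "\<And>x. (\<phi> has_derivative blinfun_apply (F1 x)) (at x)"
    and F2: "\<And>x. (F1 has_derivative blinfun_apply (F2 x)) (at x)"
    and cont_F2: "continuous_on UNIV F2"
    and base_ball: "base \<subseteq> cball 0 B"
    and F1_near: "\<And>x. x \<in> cball 0 B \<Longrightarrow> norm (F1 x - id_blinfun) \<le> 1 / 20"
    and F2_near: "\<And>x. x \<in> cball 0 B \<Longrightarrow> norm (F2 x) \<le> 1 / (20 * \<sigma>)"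
begin

definition "vel j s = blinfun_apply (F1 (crv j s)) (tng j s)"
text \<open>The second derivative of the moved curve where the tangent has derivative k. The vector
  k is left open: it is \<open>kv j s\<close> at smooth parameters, but the arc formula
  \<open>(1 / \<sigma>) *\<^sub>R nrm j s\<close> is used up to and including the junctions.\<close>

definition "acc k j s = blinfun_apply (blinfun_apply (F2 (crv j s)) (tng j s)) (tng j s) + blinfun_apply (F1 (crv j s)) k"

lemma crv_ball: "s \<in> {-l..l} \<Longrightarrow> crv j s \<in> cball 0 B"
  using subsetD[OF base_ball crv_in_base] .

lemma F2_near': "x \<in> cball 0 B \<Longrightarrow> norm (F2 x) \<le> 1 / 20"
proof -
  assume "x \<in> cball 0 B"
  have "1 / (20 * \<sigma>) \<le> 1 / (20 * 1)" using sigma by (intro divide_left_mono) auto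
  then show ?thesis using F2_near[OF \<open>x \<in> cball 0 B\<close>] by simp
qed

lemma has_vector_derivative_image: "((\<lambda>s. \<phi> (crv j s)) has_vector_derivative vel j s) (at s)"
  unfolding vel_def by (rule has_vector_derivative_compose_crv[OF F1])

lemma has_vector_derivative_vel:
  assumes "(tng j has_vector_derivative k) (at s)"
  shows "(vel j has_vector_derivative acc k j s) (at s)"
  using bounded_bilinear.has_vector_derivative[OF bounded_bilinear_blinfun_apply
      has_vector_derivative_compose_crv[OF F2] assms]
  unfolding vel_def[abs_def] acc_def by (simp add: add.commute)

lemma continuous_on_F1: "continuous_on S F1"
  using F2 by (meson continuous_at_imp_continuous_on has_derivative_continuous)

lemma continuous_on_phi: "continuous_on S \<phi>"
  using F1 by (meson continuous_at_imp_continuous_on has_derivative_continuous)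

lemma continuous_on_vel: "continuous_on S (vel j)"
  unfolding vel_def[abs_def]
  by (intro continuous_intros continuous_on_tng continuous_on_compose2[OF continuous_on_F1[of UNIV] continuous_on_crv])
    auto

lemma continuous_on_acc: "continuous_on S k \<Longrightarrow> continuous_on S (\<lambda>s. acc (k s) j s)"
  unfolding acc_def[abs_def]
  by (intro continuous_intros continuous_on_tng continuous_on_compose2[OF continuous_on_F1[of UNIV] continuous_on_crv]
      continuous_on_compose2[OF cont_F2 continuous_on_crv]) auto

lemma F1_apply_near: "x \<in> cball 0 B \<Longrightarrow> norm (blinfun_apply (F1 x) v - v) \<le> 1 / 20 * norm v"
proof -
  assume x: "x \<in> cball 0 B"
  have "blinfun_apply (F1 x) v - v = blinfun_apply (F1 x - id_blinfun) v"
    by (simp add: blinfun.diff_left)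
  also have "norm \<dots> \<le> norm (F1 x - id_blinfun) * norm v" by (rule norm_blinfun)
  also have "\<dots> \<le> 1 / 20 * norm v" using F1_near[OF x] by (intro mult_right_mono) auto
  finally show ?thesis .
qed

lemma norm_vel: "s \<in> {-l..l} \<Longrightarrow> 19 / 20 \<le> norm (vel j s)"
  using F1_apply_near[OF crv_ball[of s j], of "tng j s"]
    norm_triangle_ineq2[of "tng j s" "tng j s - vel j s"]
  by (simp add: vel_def norm_minus_commute)

lemma vel_nonzero: "s \<in> {-l..l} \<Longrightarrow> vel j s \<noteq> 0"
  using norm_vel[of s j] by auto

lemma image_has_curvature:
  assumes s: "s \<in> smooth_params"
  obtains k where "has_curvature (\<phi> ` base) (\<phi> (crv j s)) k" "(norm k)\<^sup>2 = curv2 (vel j s) (acc (kv j s) j s)"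
proof -
  define A where "A = (\<lambda>s. \<phi> (crv j s)) ` {-l..l}"
  define A' where "A' = (\<lambda>s. \<phi> (crv (\<not> j) s)) ` {-l..l}"
  have comp: "continuous_on S (\<lambda>s. \<phi> (crv i s))" for S i
    by (rule continuous_on_compose2[OF continuous_on_phi[of UNIV] continuous_on_crv]) auto
  have "compact A'" unfolding A'_def by (intro compact_continuous_image comp) simp
  have inj: "inj_on (\<lambda>s. \<phi> (crv j s)) {-l..l}"
    by (rule comp_inj_on[OF inj_crv inj_on_subset[OF inj_phi subset_UNIV], unfolded o_def])
  have "A \<inter> A' = {}"
    unfolding A_def A'_def
  proof (rule equals0I)
    fix y assume "y \<in> (\<lambda>s. \<phi> (crv j s)) ` {-l..l} \<inter> (\<lambda>s. \<phi> (crv (\<not> j) s)) ` {-l..l}"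
    then obtain u v where "y = \<phi> (crv j u)" "y = \<phi> (crv (\<not> j) v)"
      by (elim IntE imageE)
    then have "crv j u = crv (\<not> j) v" by (simp add: inj_eq[OF inj_phi])
    then show False using crv_neq by simp
  qed
  have union: "\<phi> ` base = A \<union> A'"
    unfolding base_def A_def A'_def by (cases j) (simp_all add: image_Un image_image Un_commute)
  obtain U cinv where "open U" and hom: "homeomorphism {-l<..<l} ((A \<union> A') \<inter> U) (\<lambda>s. \<phi> (crv j s)) cinv"
    using arc_chart[OF comp[of "{-l..l}" j] inj compact_imp_closed[OF \<open>compact A'\<close>], folded A_def,
        OF \<open>A \<inter> A' = {}\<close> greaterThanLessThan_subseteq_atLeastAtMost_iff[THEN iffD2]]
    by blast
  have "s \<in> {-l<..<l}" using s by (auto simp: smooth_params_def)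
  then obtain k where "has_curvature (A \<union> A') (\<phi> (crv j s)) k"
    "(norm k)\<^sup>2 = curv2 (vel j s) (acc (kv j s) j s)"
    unfolding curv2_def
    by (rule has_curvature_regular_parametrization[OF _ has_vector_derivative_image vel_nonzero
          continuous_on_vel has_vector_derivative_vel[OF has_vector_derivative_tng[OF s]] \<open>open U\<close> hom])
  then show ?thesis using that unfolding union by blast
qed

text \<open>Endpoints and junctions, where the charts over open intervals do not give the curvature.
  Being finitely many, they do not influence any \<open>Limsup\<close>.\<close>

definition "special = (\<lambda>(j, s). \<phi> (crv j s)) ` (UNIV \<times> {l, - l, \<sigma> * \<alpha>, - (\<sigma> * \<alpha>)})"

lemma finite_special: "finite special" unfolding special_def by simp

lemma base_cases:
  assumes "y \<in> \<phi> ` base"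
  obtains j s where "s \<in> {-l..l}" "y = \<phi> (crv j s)"
  using assms unfolding base_def image_Un by (elim UnE imageE) simp_all

lemma curvature_image_cases:
  assumes "has_curvature (\<phi> ` base) y k" "y \<notin> special"
  obtains j s where "s \<in> smooth_params" "y = \<phi> (crv j s)" "(norm k)\<^sup>2 = curv2 (vel j s) (acc (kv j s) j s)"
proof -
  obtain T where "y \<in> \<phi> ` base" using has_curvature_limit[OF assms(1)] by metis
  then obtain j s where s: "s \<in> {-l..l}" "y = \<phi> (crv j s)" by (rule base_cases)
  have "s \<notin> {l, - l, \<sigma> * \<alpha>, - (\<sigma> * \<alpha>)}"
    using assms(2) s(2) unfolding special_def by (auto simp: image_iff)
  then have "s \<in> smooth_params" using s(1) by (auto simp: smooth_params_def abs_if split: if_splits)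
  moreover from this obtain k' where k': "has_curvature (\<phi> ` base) y k'"
    "(norm k')\<^sup>2 = curv2 (vel j s) (acc (kv j s) j s)"
    unfolding s(2) by (rule image_has_curvature)
  moreover have "k = k'" using has_curvature_unique assms(1) k'(1) by blast
  ultimately show ?thesis using that s(2) by blast
qed

lemma filterlim_image:
  assumes "s \<in> {-l..l}" "G \<subseteq> smooth_params"
  shows "filterlim (\<lambda>s. \<phi> (crv j s)) (at (\<phi> (crv j s)) within {y. \<exists>k. has_curvature (\<phi> ` base) y k}) (at s within G)"
  unfolding filterlim_at
proof
  have "continuous_on UNIV (\<lambda>s. \<phi> (crv j s))"
    by (rule continuous_on_compose2[OF continuous_on_phi[of UNIV] continuous_on_crv]) auto
  then show "((\<lambda>s. \<phi> (crv j s)) \<longlongrightarrow> \<phi> (crv j s)) (at s within G)"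
    by (metis UNIV_I continuous_on_def tendsto_within_subset top_greatest)
  have "u \<noteq> s \<longrightarrow> u \<in> G \<longrightarrow> \<phi> (crv j u) \<in> {y. \<exists>k. has_curvature (\<phi> ` base) y k} \<and> \<phi> (crv j u) \<noteq> \<phi> (crv j s)" for u
  proof (intro impI conjI)
    assume "u \<noteq> s" "u \<in> G"
    then have "u \<in> smooth_params" using assms(2) by blast
    then show "\<phi> (crv j u) \<in> {y. \<exists>k. has_curvature (\<phi> ` base) y k}"
      using image_has_curvature[of u j] by blast
    show "\<phi> (crv j u) \<noteq> \<phi> (crv j s)"
      using inj_crv[of j UNIV] inj_phi \<open>u \<noteq> s\<close> by (auto simp: inj_on_def)
  qed
  then show "\<forall>\<^sub>F u in at s within G. \<phi> (crv j u) \<in> {y. \<exists>k. has_curvature (\<phi> ` base) y k} \<and> \<phi> (crv j u) \<noteq> \<phi> (crv j s)"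
    unfolding eventually_at_filter by (rule always_eventually[OF allI])
qed

lemma curvature_radius_image_ge:
  assumes "0 < M" and M: "\<And>j s. s \<in> smooth_params \<Longrightarrow> curv2 (vel j s) (acc (kv j s) j s) \<le> M\<^sup>2"
    and "x \<in> \<phi> ` base"
  shows "ereal (1 / M) \<le> curvature_radius (\<phi> ` base) x"
proof (rule curvature_radius_ge[OF \<open>0 < M\<close> finite_special])
  fix y k assume y: "y \<notin> special" "has_curvature (\<phi> ` base) y k"
  obtain j s where "s \<in> smooth_params" "(norm k)\<^sup>2 = curv2 (vel j s) (acc (kv j s) j s)"
    by (rule curvature_image_cases[OF y(2,1)])
  then have "(norm k)\<^sup>2 \<le> M\<^sup>2" using M by simp
  then show "norm k \<le> M" using \<open>0 < M\<close> by (auto intro: power2_le_imp_le[OF _ less_imp_le])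
next
  obtain j s where s: "s \<in> {-l..l}" "x = \<phi> (crv j s)" using base_cases[OF assms(3)] .
  have "at s within smooth_params \<noteq> bot"
    using islimpt_smooth_params[OF s(1)] by (simp add: trivial_limit_within)
  then have "at x within {y. \<exists>k. has_curvature (\<phi> ` base) y k} \<noteq> bot"
    using filterlim_image[OF s(1) order_refl, of j] unfolding s(2) filterlim_def
    by (auto simp: bot_unique filtermap_bot_iff)
  then show "x islimpt {y. \<exists>k. has_curvature (\<phi> ` base) y k}"
    by (simp add: trivial_limit_within)
qed

text \<open>The point is approached through the open arc only. At a junction this is the one-sided
  limit in which the curvature of the arc persists; \<open>0 < \<alpha>\<close> makes every point of
  the closed arc a limit point of the open one.\<close>

lemma curvature_radius_image_le:
  assumes "0 < \<alpha>" "\<bar>s\<bar> \<le> \<sigma> * \<alpha>"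
    and pos: "0 < curv2 (vel j s) (acc ((1 / \<sigma>) *\<^sub>R nrm j s) j s)"
  shows "curvature_radius (\<phi> ` base) (\<phi> (crv j s)) \<le>
    ereal (1 / sqrt (curv2 (vel j s) (acc ((1 / \<sigma>) *\<^sub>R nrm j s) j s)))"
proof (rule curvature_radius_le)
  define A where "A = {- (\<sigma> * \<alpha>)<..<\<sigma> * \<alpha>}"
  have "0 < \<sigma> * \<alpha>" using assms sigma_pos by simp
  have sub: "A \<subseteq> smooth_params" using alpha(5) unfolding A_def smooth_params_def by auto
  have s: "s \<in> {-l..l}" using assms(2) alpha(5) by auto
  have "s islimpt A"
    using \<open>0 < \<sigma> * \<alpha>\<close> assms(2) unfolding A_def by (intro islimpt_open_interval) auto
  then show "at s within A \<noteq> bot" by (simp add: trivial_limit_within)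
  show "filterlim (\<lambda>s. \<phi> (crv j s)) (at (\<phi> (crv j s)) within {y. \<exists>k. has_curvature (\<phi> ` base) y k}) (at s within A)"
    by (rule filterlim_image[OF s sub])
  let ?f = "\<lambda>s. sqrt (curv2 (vel j s) (acc ((1 / \<sigma>) *\<^sub>R nrm j s) j s))"
  have "continuous_on {-l..l} ?f"
    unfolding curv2_def nrm_def[abs_def] using vel_nonzero
    by (intro continuous_intros continuous_on_vel continuous_on_acc continuous_on_emb continuous_on_ang) auto
  then have "(?f \<longlongrightarrow> ?f s) (at s within {-l..l})"
    using s by (simp only: continuous_on_def)
  moreover have "A \<subseteq> {-l..l}" using alpha(5) by (auto simp: A_def)
  ultimately have "(?f \<longlongrightarrow> ?f s) (at s within A)"
    by (rule tendsto_within_subset)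
  then show "((\<lambda>s. norm (curvature (\<phi> ` base) (\<phi> (crv j s)))) \<longlongrightarrow> ?f s) (at s within A)"
  proof (rule Lim_transform_eventually)
    have "u \<in> A \<longrightarrow> ?f u = norm (curvature (\<phi> ` base) (\<phi> (crv j u)))" for u
    proof
      assume "u \<in> A"
      then have "u \<in> smooth_params" using sub by blast
      then obtain k where "has_curvature (\<phi> ` base) (\<phi> (crv j u)) k" "(norm k)\<^sup>2 = curv2 (vel j u) (acc (kv j u) j u)"
        by (rule image_has_curvature)
      moreover have "kv j u = (1 / \<sigma>) *\<^sub>R nrm j u" using \<open>u \<in> A\<close> by (auto simp: kv_def A_def)
      ultimately show "?f u = norm (curvature (\<phi> ` base) (\<phi> (crv j u)))"
        by (simp add: curvature_eq real_sqrt_unique)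
    qed
    then show "\<forall>\<^sub>F u in at s within A. ?f u = norm (curvature (\<phi> ` base) (\<phi> (crv j u)))"
      unfolding eventually_at_filter by (intro always_eventually allI) simp
  qed
  show "0 < ?f s" using pos by simp
qed

end

section \<open>Reach of the perturbed link\<close>

context near_identity
begin

definition "gap2 z = (\<phi> (crv False (fst z)) - \<phi> (crv True (snd z))) \<bullet> (\<phi> (crv False (fst z)) - \<phi> (crv True (snd z)))"

lemma F1_lipschitz:
  assumes "x \<in> cball 0 B" "y \<in> cball 0 B"
  shows "norm (F1 x - F1 y) \<le> 1 / 20 * norm (x - y)"
proof (rule differentiable_bound[OF convex_cball])
  fix z :: space assume z: "z \<in> cball 0 B"
  show "(F1 has_derivative blinfun_apply (F2 z)) (at z within cball 0 B)"
    by (rule has_derivative_at_withinI[OF F2])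
  show "onorm (blinfun_apply (F2 z)) \<le> 1 / 20"
    using F2_near'[OF z] by (simp add: norm_blinfun.rep_eq)
qed (use assms in auto)

lemma phi_first_order:
  assumes "x \<in> cball 0 B" "y \<in> cball 0 B"
  shows "norm (\<phi> y - \<phi> x - blinfun_apply (F1 x) (y - x)) \<le> 1 / 20 * (norm (y - x))\<^sup>2"
proof -
  let ?S = "cball 0 B \<inter> cball x (norm (y - x))"
  have "norm ((\<phi> y - blinfun_apply (F1 x) y) - (\<phi> x - blinfun_apply (F1 x) x)) \<le> (1 / 20 * norm (y - x)) * norm (y - x)"
  proof (rule differentiable_bound[where S = ?S and f' = "\<lambda>z. blinfun_apply (F1 z - F1 x)"])
    show "convex ?S" by (intro convex_Int convex_cball)
    fix z assume z: "z \<in> ?S"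
    have "((\<lambda>z. \<phi> z - blinfun_apply (F1 x) z) has_derivative (\<lambda>h. blinfun_apply (F1 z) h - blinfun_apply (F1 x) h)) (at z)"
      by (rule has_derivative_diff[OF F1 bounded_linear_imp_has_derivative[OF blinfun.bounded_linear_right]])
    then show "((\<lambda>z. \<phi> z - blinfun_apply (F1 x) z) has_derivative blinfun_apply (F1 z - F1 x)) (at z within ?S)"
      by (rule has_derivative_at_withinI[OF has_derivative_eq_rhs]) (simp add: fun_eq_iff blinfun.diff_left)
    have "norm (F1 z - F1 x) \<le> 1 / 20 * norm (z - x)"
      using F1_lipschitz[of z x] z assms by simp
    also have "\<dots> \<le> 1 / 20 * norm (y - x)"
      using z by (simp add: dist_norm norm_minus_commute)
    finally show "onorm (blinfun_apply (F1 z - F1 x)) \<le> 1 / 20 * norm (y - x)"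
      by (simp add: norm_blinfun.rep_eq)
  qed (use assms in \<open>auto simp: dist_norm norm_minus_commute\<close>)
  then show ?thesis
    by (simp add: blinfun.diff_right power2_eq_square algebra_simps)
qed

lemma phi_expansion:
  assumes "x \<in> cball 0 B" "y \<in> cball 0 B"
  shows "norm (\<phi> y - \<phi> x - (y - x)) \<le> 1 / 20 * norm (y - x)"
proof -
  have "norm ((\<phi> y - y) - (\<phi> x - x)) \<le> 1 / 20 * norm (y - x)"
  proof (rule differentiable_bound[OF convex_cball, where f' = "\<lambda>z. blinfun_apply (F1 z - id_blinfun)"])
    fix z :: space assume z: "z \<in> cball 0 B"
    have "((\<lambda>z. \<phi> z - z) has_derivative (\<lambda>h. blinfun_apply (F1 z) h - h)) (at z)"
      by (rule has_derivative_diff[OF F1 has_derivative_ident])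
    then show "((\<lambda>z. \<phi> z - z) has_derivative blinfun_apply (F1 z - id_blinfun)) (at z within cball 0 B)"
      by (rule has_derivative_at_withinI[OF has_derivative_eq_rhs]) (simp add: fun_eq_iff blinfun.diff_left)
    show "onorm (blinfun_apply (F1 z - id_blinfun)) \<le> 1 / 20"
      using F1_near[OF z] by (simp add: norm_blinfun.rep_eq)
  qed (use assms in auto)
  then show ?thesis by (simp add: algebra_simps)
qed

text \<open>At an interior parameter the squared distance has derivative 0. At an endpoint only one
  sign of the derivative is excluded, but all chords of the unperturbed curve point inwards, and the
  product still has the right sign.\<close>

lemma nearest_point_first_order:
  assumes s: "s \<in> {-l..l}" "u \<in> {-l..l}"
    and nearest: "\<And>v. v \<in> {-l..l} \<Longrightarrow> dist p (\<phi> (crv j s)) \<le> dist p (\<phi> (crv j v))"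
  shows "((p - \<phi> (crv j s)) \<bullet> vel j s) * ((crv j u - crv j s) \<bullet> tng j s) \<le> 0"
proof -
  define f where "f v = (p - \<phi> (crv j v)) \<bullet> (p - \<phi> (crv j v))" for v
  have "((\<lambda>v. p - \<phi> (crv j v)) has_vector_derivative (0 - vel j s)) (at s)"
    by (intro has_vector_derivative_diff has_vector_derivative_const has_vector_derivative_image)
  from bounded_bilinear.has_vector_derivative[OF bounded_bilinear_inner this this]
  have "(f has_real_derivative - 2 * ((p - \<phi> (crv j s)) \<bullet> vel j s)) (at s)"
    unfolding f_def[abs_def] has_real_derivative_iff_has_vector_derivative by (simp add: inner_commute)
  moreover have "f s \<le> f v" if "v \<in> {-l..l}" for v
    using power_mono[OF nearest[OF that], of 2] by (simp add: f_def dist_norm power2_norm_eq_inner)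
  ultimately have d: "s < l \<Longrightarrow> (p - \<phi> (crv j s)) \<bullet> vel j s \<le> 0" "-l < s \<Longrightarrow> 0 \<le> (p - \<phi> (crv j s)) \<bullet> vel j s"
    using derivative_at_interval_minimum[of f "- 2 * ((p - \<phi> (crv j s)) \<bullet> vel j s)" s "-l" l] s(1) by auto
  consider "s = -l" | "s = l" | "-l < s" "s < l" using s(1) by force
  then show ?thesis
  proof cases
    case 1
    then show ?thesis using d(1) chord_endpoints(1)[OF s(2), of j] l_pos by (auto intro: mult_nonpos_nonneg)
  next
    case 2
    then show ?thesis using d(2) chord_endpoints(2)[OF s(2), of j] l_pos by (auto intro: mult_nonneg_nonpos)
  next
    case 3
    then have "(p - \<phi> (crv j s)) \<bullet> vel j s = 0" using d by force
    then show ?thesis by simp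
  qed
qed

text \<open>
  Federer's criterion: chords of \<open>crv j\<close> deviate quadratically from the tangent, and \<open>\<phi>\<close> nearly
  preserves the constant, so that focal points have distance at least \<open>3/4\<close>.
\<close>

lemma nearest_point_unique:
  assumes a: "a \<in> (\<lambda>s. \<phi> (crv j s)) ` {-l..l}" and b: "b \<in> (\<lambda>s. \<phi> (crv j s)) ` {-l..l}"
    and nearest: "\<And>q. q \<in> (\<lambda>s. \<phi> (crv j s)) ` {-l..l} \<Longrightarrow> dist p a \<le> dist p q"
    and eq: "dist p b = dist p a" and small: "dist p a < 3 / 4"
  shows "a = b"
proof -
  obtain s u where s: "s \<in> {-l..l}" "a = \<phi> (crv j s)" and u: "u \<in> {-l..l}" "b = \<phi> (crv j u)"
    using a b by (elim imageE)
  define w where "w = p - a"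
  define D where "D = crv j u - crv j s"
  define X where "X = D \<bullet> tng j s"
  define N where "N = normal_part (tng j s) D"
  define r where "r = b - a - blinfun_apply (F1 (crv j s)) D"
  define n where "n = norm D"
  have ball: "crv j s \<in> cball 0 B" "crv j u \<in> cball 0 B" by (rule crv_ball s u)+
  \<comment> \<open>The chord is split into its tangential part, governed by the first-order
    condition, and a normal part and a Taylor remainder, both quadratic in n.\<close>
  have "b - a = X *\<^sub>R vel j s + blinfun_apply (F1 (crv j s)) N + r"
    by (simp add: r_def N_def normal_part_def X_def vel_def blinfun.diff_right blinfun.scaleR_right)
  then have "w \<bullet> (b - a) = X * (w \<bullet> vel j s) + w \<bullet> (blinfun_apply (F1 (crv j s)) N + r)"
    by (simp add: inner_add_right)
  moreover have "X * (w \<bullet> vel j s) \<le> 0"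
    using nearest_point_first_order[OF s(1) u(1), of p j] nearest s(2)
    by (simp add: w_def X_def D_def mult.commute)
  \<comment> \<open>Here 23/40 is 21/20 times 1/2, from the normal part of the chord, plus 1/20 from
    the remainder.\<close>
  moreover have "w \<bullet> (blinfun_apply (F1 (crv j s)) N + r) \<le> norm w * (23 / 40 * n\<^sup>2)"
  proof -
    have "norm N \<le> n\<^sup>2 / (2 * \<sigma>)"
      unfolding N_def D_def n_def by (rule normal_part_chord)
    also have "\<dots> \<le> n\<^sup>2 / 2"
      using sigma by (intro divide_left_mono) auto
    finally have N: "norm N \<le> n\<^sup>2 / 2" .
    have "norm (blinfun_apply (F1 (crv j s)) N) \<le> 21 / 20 * norm N"
      using F1_apply_near[OF ball(1), of N] norm_triangle_sub[of "blinfun_apply (F1 (crv j s)) N" N] by simp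
    moreover have "norm r \<le> 1 / 20 * n\<^sup>2"
      using phi_first_order[OF ball] by (simp add: r_def s u D_def n_def)
    ultimately have "norm (blinfun_apply (F1 (crv j s)) N + r) \<le> 23 / 40 * n\<^sup>2"
      using N norm_triangle_ineq[of "blinfun_apply (F1 (crv j s)) N" r] by simp
    then show ?thesis
      using norm_cauchy_schwarz[of w] mult_left_mono[of _ "23 / 40 * n\<^sup>2" "norm w"]
      by (meson norm_ge_zero order_trans)
  qed
  ultimately have upper: "w \<bullet> (b - a) \<le> norm w * (23 / 40 * n\<^sup>2)" by linarith
  have "19 / 20 * n \<le> norm (b - a)"
    using phi_expansion[OF ball] norm_triangle_sub[of D "b - a"]
    by (simp add: s u D_def n_def norm_minus_commute)
  then have "(19 / 20 * n)\<^sup>2 \<le> (norm (b - a))\<^sup>2"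
    by (intro power_mono) (auto simp: n_def)
  \<comment> \<open>Expansion of the equality of the distances from p to a and to b.\<close>
  also have "(norm (b - a))\<^sup>2 = 2 * (w \<bullet> (b - a))"
  proof -
    have "(p - b) \<bullet> (p - b) = (p - a) \<bullet> (p - a)"
      using eq by (metis dist_norm power2_norm_eq_inner)
    moreover have "p - b = w - (b - a)" by (simp add: w_def)
    ultimately show ?thesis
      by (simp add: power2_norm_eq_inner w_def[symmetric] inner_diff_left inner_diff_right inner_commute)
  qed
  also have "\<dots> \<le> 23 / 20 * (norm w * n\<^sup>2)" using upper by simp
  finally have le: "361 / 400 * n\<^sup>2 \<le> 23 / 20 * (norm w * n\<^sup>2)"
    by (simp add: power_mult_distrib power2_eq_square)
  have "n = 0"
  proof (rule ccontr)
    assume "n \<noteq> 0"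
    then have "0 < n\<^sup>2" by simp
    \<comment> \<open>The contradiction is numerical: 23/20 times 3/4 is 345/400, less than 361/400,
      the square of 19/20.\<close>
    have "norm w * n\<^sup>2 \<le> 3 / 4 * n\<^sup>2"
      using small by (intro mult_right_mono) (auto simp: w_def dist_norm)
    then show False using le \<open>0 < n\<^sup>2\<close> by linarith
  qed
  then show ?thesis by (simp add: n_def D_def s u)
qed

text \<open>The bound 9/4 is the square of twice 3/4: up to there, half the distance of the
  components stays within the range in which each of them has unique nearest points.\<close>

lemma two_reach_image:
  assumes z0: "z0 \<in> {-l..l} \<times> {-l..l}" and least: "\<And>z. z \<in> {-l..l} \<times> {-l..l} \<Longrightarrow> gap2 z0 \<le> gap2 z"
    and small: "gap2 z0 \<le> 9 / 4"
  shows "2 * reach (\<phi> ` base) = ereal (sqrt (gap2 z0))"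
proof -
  define A where "A j = (\<lambda>s. \<phi> (crv j s)) ` {-l..l}" for j
  have "compact (A j)" for j
    unfolding A_def
    by (intro compact_continuous_image continuous_on_compose2[OF continuous_on_phi[of UNIV] continuous_on_crv]) auto
  moreover have "A j \<noteq> {}" for j using l_pos by (simp add: A_def)
  moreover have sqrt_gap: "sqrt (gap2 (s, u)) = dist (\<phi> (crv False s)) (\<phi> (crv True u))" for s u
    by (simp add: gap2_def dist_norm norm_eq_sqrt_inner)
  then have "0 < sqrt (gap2 z0)"
    using crv_neq[of False] inj_phi by (cases z0) (simp add: inj_eq)
  moreover have "sqrt (gap2 z0) \<le> 2 * (3 / 4)"
    using real_sqrt_le_mono[OF small] by (simp add: real_sqrt_divide)
  moreover have "sqrt (gap2 z0) \<le> dist a b" if ab: "a \<in> A False" "b \<in> A True" for a b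
  proof -
    obtain s u where "s \<in> {-l..l}" "u \<in> {-l..l}" "a = \<phi> (crv False s)" "b = \<phi> (crv True u)"
      using ab unfolding A_def by (elim imageE)
    then show ?thesis using real_sqrt_le_mono[OF least[of "(s, u)"]] sqrt_gap[of s u] by simp
  qed
  moreover have "\<phi> (crv False (fst z0)) \<in> A False" "\<phi> (crv True (snd z0)) \<in> A True"
    using z0 unfolding A_def by auto
  moreover have "dist (\<phi> (crv False (fst z0))) (\<phi> (crv True (snd z0))) = sqrt (gap2 z0)"
    using sqrt_gap[of "fst z0" "snd z0"] by simp
  ultimately have "2 * reach (A False \<union> A True) = ereal (sqrt (gap2 z0))"
    by (intro two_reach_eq_distance[where R = "3/4"]) (auto simp: A_def intro!: nearest_point_unique)
  then show ?thesis by (simp add: A_def base_def image_Un image_image)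
qed

end

text \<open>The square of the radius of curvature divided by \<sigma>. Its denominator contains the
  Gram determinant of v and a, whose positivity has to be maintained along a family.\<close>

definition rho2 :: "real \<Rightarrow> space \<Rightarrow> space \<Rightarrow> real" where
  "rho2 \<sigma> v a = (v \<bullet> v) ^ 3 / (\<sigma>\<^sup>2 * ((v \<bullet> v) * (a \<bullet> a) - (v \<bullet> a)\<^sup>2))"

definition rho2_deriv :: "real \<Rightarrow> space \<Rightarrow> space \<Rightarrow> space \<Rightarrow> space \<Rightarrow> real" where
  "rho2_deriv \<sigma> v v' a a' =
    (6 * (v \<bullet> v)\<^sup>2 * (v \<bullet> v') * ((v \<bullet> v) * (a \<bullet> a) - (v \<bullet> a)\<^sup>2) -
     (v \<bullet> v) ^ 3 * (2 * (v \<bullet> v') * (a \<bullet> a) + 2 * (v \<bullet> v) * (a \<bullet> a') - 2 * (v \<bullet> a) * (v' \<bullet> a + v \<bullet> a')))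
    / (\<sigma>\<^sup>2 * ((v \<bullet> v) * (a \<bullet> a) - (v \<bullet> a)\<^sup>2)\<^sup>2)"

lemma rho2_eq: "0 < \<sigma> \<Longrightarrow> rho2 \<sigma> v a = 1 / (\<sigma>\<^sup>2 * curv2 v a)"
  by (simp add: rho2_def curv2_def divide_inverse mult_ac)

lemma has_real_derivative_inner:
  assumes "(f has_vector_derivative f') (at t within S)" "(g has_vector_derivative g') (at t within S)"
  shows "((\<lambda>t. f t \<bullet> g t) has_real_derivative f t \<bullet> g' + f' \<bullet> g t) (at t within S)"
  unfolding has_real_derivative_iff_has_vector_derivative
  by (rule bounded_bilinear.has_vector_derivative[OF bounded_bilinear_inner assms])

lemma has_real_derivative_rho2:
  assumes v: "(v has_vector_derivative v') (at t)" and a: "(a has_vector_derivative a') (at t)"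
    and pos: "0 < \<sigma>" "(v t \<bullet> v t) * (a t \<bullet> a t) - (v t \<bullet> a t)\<^sup>2 \<noteq> 0"
  shows "((\<lambda>t. rho2 \<sigma> (v t) (a t)) has_real_derivative rho2_deriv \<sigma> (v t) v' (a t) a') (at t)"
proof -
  have p: "((\<lambda>t. v t \<bullet> v t) has_real_derivative 2 * (v t \<bullet> v')) (at t)"
    using has_real_derivative_inner[OF v v] by (simp add: inner_commute)
  have q: "((\<lambda>t. a t \<bullet> a t) has_real_derivative 2 * (a t \<bullet> a')) (at t)"
    using has_real_derivative_inner[OF a a] by (simp add: inner_commute)
  have r: "((\<lambda>t. v t \<bullet> a t) has_real_derivative (v' \<bullet> a t + v t \<bullet> a')) (at t)"
    using has_real_derivative_inner[OF v a] by (simp add: add.commute)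
  define N where "N t = (v t \<bullet> v t) * (a t \<bullet> a t) - (v t \<bullet> a t)\<^sup>2" for t
  define N' where "N' = 2 * (v t \<bullet> v') * (a t \<bullet> a t) + 2 * (v t \<bullet> v t) * (a t \<bullet> a')
      - 2 * (v t \<bullet> a t) * (v' \<bullet> a t + v t \<bullet> a')"
  have N: "(N has_real_derivative N') (at t)"
    unfolding N_def[abs_def] N'_def by (rule derivative_eq_intros p q r refl)+ simp
  have "N t \<noteq> 0" using pos by (simp add: N_def)
  have cube: "((\<lambda>t. (v t \<bullet> v t) ^ 3) has_real_derivative 6 * (v t \<bullet> v t)\<^sup>2 * (v t \<bullet> v')) (at t)"
    using DERIV_power[OF p, of 3] by (simp add: mult_ac)
  have "((\<lambda>t. (v t \<bullet> v t) ^ 3 / (\<sigma>\<^sup>2 * N t)) has_real_derivative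
      (6 * (v t \<bullet> v t)\<^sup>2 * (v t \<bullet> v') * (\<sigma>\<^sup>2 * N t) - (v t \<bullet> v t) ^ 3 * (\<sigma>\<^sup>2 * N')) / ((\<sigma>\<^sup>2 * N t) * (\<sigma>\<^sup>2 * N t))) (at t)"
    using \<open>N t \<noteq> 0\<close> pos by (intro DERIV_divide cube DERIV_cmult N) auto
  also have "(6 * (v t \<bullet> v t)\<^sup>2 * (v t \<bullet> v') * (\<sigma>\<^sup>2 * N t) - (v t \<bullet> v t) ^ 3 * (\<sigma>\<^sup>2 * N')) / ((\<sigma>\<^sup>2 * N t) * (\<sigma>\<^sup>2 * N t))
      = (6 * (v t \<bullet> v t)\<^sup>2 * (v t \<bullet> v') * N t - (v t \<bullet> v t) ^ 3 * N') / (\<sigma>\<^sup>2 * (N t)\<^sup>2)"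
  proof -
    have "(X * (c * n) - Y * (c * n')) / ((c * n) * (c * n)) = (X * n - Y * n') / (c * n\<^sup>2)"
      if "c \<noteq> 0" for X Y c n n' :: real
    proof -
      have "(X * (c * n) - Y * (c * n')) / ((c * n) * (c * n)) = (c * (X * n - Y * n')) / (c * (c * n\<^sup>2))"
        by (simp add: algebra_simps power2_eq_square)
      then show ?thesis using that by simp
    qed
    then show ?thesis using pos by simp
  qed
  finally show ?thesis
    by (simp add: rho2_def rho2_deriv_def N_def N'_def)
qed

context kink
begin

definition "base_gap z = (crv False (fst z) - crv True (snd z)) \<bullet> (crv False (fst z) - crv True (snd z))"
definition "square = {-l..l} \<times> {-l..l}"
definition "bend = {- (\<sigma> * \<alpha>)..\<sigma> * \<alpha>}"

lemma compact_square: "compact square" and square_nonempty: "(0, 0) \<in> square"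
  and compact_bend: "compact bend" and zero_in_bend: "0 \<in> bend"
  using l_pos sigma_alpha_nonneg by (auto simp: square_def bend_def compact_Times)

lemma base_gap_tips: "base_gap (0, 0) = 1" "(INF z\<in>square. base_gap z) = 1"
proof -
  show tips: "base_gap (0, 0) = 1" by (simp add: base_gap_def tips_distance dot_square_norm)
  have "(INF z\<in>square. base_gap z) = base_gap (0, 0)"
  proof (rule cInf_eq_minimum)
    show "base_gap (0, 0) \<in> base_gap ` square" by (rule imageI[OF square_nonempty])
    show "base_gap (0, 0) \<le> x" if "x \<in> base_gap ` square" for x
      using that components_distance unfolding tips by (auto simp: base_gap_def)
  qed
  then show "(INF z\<in>square. base_gap z) = 1" by (simp only: tips)
qed

lemma bend_subset: "s \<in> bend \<Longrightarrow> s \<in> {-l..l}"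
  using alpha(5) by (auto simp: bend_def)

end

section \<open>Thickness of the perturbed link\<close>

context near_identity
begin

abbreviation "radius2 j s \<equiv> rho2 \<sigma> (vel j s) (acc ((1 / \<sigma>) *\<^sub>R nrm j s) j s)"

lemma continuous_on_gap2: "continuous_on S gap2"
  unfolding gap2_def[abs_def]
  by (intro continuous_intros continuous_on_compose2[OF continuous_on_phi[of UNIV]]
      continuous_on_compose2[OF continuous_on_crv[of UNIV]]) auto

text \<open>A leg is straight, so its image is accelerated only by the second derivative of the map.
  The resulting bound 1/4, in units of \<open>1 / \<sigma>\<^sup>2\<close>, is matched by the
  threshold 4 for \<open>radius2\<close> in the formula for thickness.\<close>

lemma curv2_leg_le:
  assumes "s \<in> smooth_params" "\<sigma> * \<alpha> < \<bar>s\<bar>"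
  shows "curv2 (vel j s) (acc (kv j s) j s) \<le> 1 / (4 * \<sigma>\<^sup>2)"
proof -
  have s: "s \<in> {-l..l}" using assms(1) by (auto simp: smooth_params_def)
  have "acc (kv j s) j s = blinfun_apply (blinfun_apply (F2 (crv j s)) (tng j s)) (tng j s)"
    using assms(2) by (simp add: kv_def acc_def)
  also have "norm \<dots> \<le> norm (blinfun_apply (F2 (crv j s)) (tng j s))"
    using norm_blinfun[of "blinfun_apply (F2 (crv j s)) (tng j s)" "tng j s"] by simp
  also have "\<dots> \<le> norm (F2 (crv j s))"
    using norm_blinfun[of "F2 (crv j s)" "tng j s"] by simp
  also have "\<dots> \<le> 1 / (20 * \<sigma>)" by (rule F2_near[OF crv_ball[OF s]])
  finally have "(norm (acc (kv j s) j s))\<^sup>2 \<le> (1 / (20 * \<sigma>))\<^sup>2"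
    by (intro power_mono) auto
  moreover have "(19 / 20) ^ 4 \<le> (norm (vel j s)) ^ 4"
    using norm_vel[OF s] by (intro power_mono) auto
  ultimately have "(norm (acc (kv j s) j s))\<^sup>2 / (norm (vel j s)) ^ 4 \<le> (1 / (20 * \<sigma>))\<^sup>2 / (19 / 20) ^ 4"
    by (intro frac_le) auto
  also have "\<dots> \<le> 1 / (4 * \<sigma>\<^sup>2)"
    using sigma_pos by (simp add: power_divide power_mult_distrib field_simps)
  finally show ?thesis
    using curv2_le[OF vel_nonzero[OF s]] by (meson order_trans)
qed

text \<open>Reduces thickness, with its reach and limsup, to infima of continuous functions over
  fixed compact sets, to which Danskin's theorem applies. The two smallness conditions say that
  neither self-contact of a component nor the curvature of a leg can be decisive.\<close>

lemma thickness_image: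
  assumes "0 < \<alpha>"
    and nondeg: "\<And>j s. s \<in> bend \<Longrightarrow> 0 < curv2 (vel j s) (acc ((1 / \<sigma>) *\<^sub>R nrm j s) j s)"
    and gap_small: "(INF z\<in>square. gap2 z) \<le> 9 / 4"
    and radius_small: "(INF s\<in>bend. radius2 False s) \<le> 4"
  shows "thickness \<sigma> (\<phi> ` base) =
    ereal (sqrt (min (INF z\<in>square. gap2 z) (min (INF s\<in>bend. radius2 False s) (INF s\<in>bend. radius2 True s))))"
proof -
  obtain z0 where z0: "z0 \<in> square" "\<And>z. z \<in> square \<Longrightarrow> gap2 z0 \<le> gap2 z"
    using continuous_attains_inf[OF compact_square _ continuous_on_gap2] square_nonempty by blast
  have "(INF z\<in>square. gap2 z) = gap2 z0"
    using z0 by (intro cInf_eq_minimum) auto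
  then have reach: "2 * reach (\<phi> ` base) = ereal (sqrt (INF z\<in>square. gap2 z))"
    using two_reach_image[of z0] z0 gap_small by (simp add: square_def)
  have radius2: "radius2 j s = 1 / (\<sigma>\<^sup>2 * curv2 (vel j s) (acc ((1 / \<sigma>) *\<^sub>R nrm j s) j s))" for j s
    by (rule rho2_eq[OF sigma_pos])
  have "continuous_on bend (radius2 j)" for j
  proof -
    have "continuous_on bend (\<lambda>s. curv2 (vel j s) (acc ((1 / \<sigma>) *\<^sub>R nrm j s) j s))"
      unfolding curv2_def nrm_def[abs_def] using vel_nonzero[OF bend_subset]
      by (intro continuous_intros continuous_on_vel continuous_on_acc continuous_on_emb continuous_on_ang) auto
    then show ?thesis
      unfolding radius2 using nondeg[of _ j] sigma_pos by (intro continuous_intros) (auto simp: less_imp_neq[symmetric])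
  qed
  then have "\<exists>s\<in>bend. \<forall>u\<in>bend. radius2 j s \<le> radius2 j u" for j
    using continuous_attains_inf[OF compact_bend] zero_in_bend by blast
  then obtain s0 where s0: "s0 j \<in> bend" "\<And>u. u \<in> bend \<Longrightarrow> radius2 j (s0 j) \<le> radius2 j u" for j
    by metis
  have inf: "(INF s\<in>bend. radius2 j s) = radius2 j (s0 j)" for j
    using s0 by (intro cInf_eq_minimum) auto
  define m where "m = min (INF s\<in>bend. radius2 False s) (INF s\<in>bend. radius2 True s)"
  obtain i where i: "m = radius2 i (s0 i)" and m_le: "\<And>j. m \<le> radius2 j (s0 j)"
  proof -
    have "m = radius2 False (s0 False) \<or> m = radius2 True (s0 True)" unfolding m_def inf by linarith
    moreover have "m \<le> radius2 j (s0 j)" for j by (cases j) (simp_all add: m_def inf)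
    ultimately show ?thesis using that by metis
  qed
  have "0 < m"
    unfolding i radius2 using nondeg[OF s0(1)] sigma_pos by simp
  have "m \<le> 4" using radius_small by (simp add: m_def)
  have "(INF x\<in>\<phi> ` base. curvature_radius (\<phi> ` base) x) = ereal (\<sigma> * sqrt m)"
  proof (rule antisym)
    have "s0 i \<in> {-l..l}" by (rule bend_subset[OF s0(1)])
    then have "(INF x\<in>\<phi> ` base. curvature_radius (\<phi> ` base) x) \<le> curvature_radius (\<phi> ` base) (\<phi> (crv i (s0 i)))"
      using crv_in_base by (intro INF_lower) simp
    also have "\<dots> \<le> ereal (1 / sqrt (curv2 (vel i (s0 i)) (acc ((1 / \<sigma>) *\<^sub>R nrm i (s0 i)) i (s0 i))))"
      using s0(1)[of i] nondeg[OF s0(1)] \<open>0 < \<alpha>\<close>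
      by (intro curvature_radius_image_le) (auto simp: bend_def abs_le_iff)
    also have "1 / sqrt (curv2 (vel i (s0 i)) (acc ((1 / \<sigma>) *\<^sub>R nrm i (s0 i)) i (s0 i))) = \<sigma> * sqrt m"
      unfolding i radius2 using sigma_pos by (simp add: real_sqrt_divide real_sqrt_mult)
    finally show "(INF x\<in>\<phi> ` base. curvature_radius (\<phi> ` base) x) \<le> ereal (\<sigma> * sqrt m)" .
    show "ereal (\<sigma> * sqrt m) \<le> (INF x\<in>\<phi> ` base. curvature_radius (\<phi> ` base) x)"
    proof (rule INF_greatest)
      fix x assume "x \<in> \<phi> ` base"
      define M where "M = 1 / (\<sigma> * sqrt m)"
      have M2: "M\<^sup>2 = 1 / (\<sigma>\<^sup>2 * m)" using \<open>0 < m\<close> by (simp add: M_def power_divide power_mult_distrib)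
      have "curv2 (vel j s) (acc (kv j s) j s) \<le> M\<^sup>2" if s: "s \<in> smooth_params" for j s
      proof (cases "\<bar>s\<bar> < \<sigma> * \<alpha>")
        case True
        then have "s \<in> bend" and kv: "kv j s = (1 / \<sigma>) *\<^sub>R nrm j s"
          by (auto simp: bend_def kv_def)
        let ?c = "curv2 (vel j s) (acc (kv j s) j s)"
        have "0 < ?c" using nondeg[OF \<open>s \<in> bend\<close>, of j] kv by simp
        have "m \<le> 1 / (\<sigma>\<^sup>2 * ?c)"
          using order_trans[OF m_le s0(2)[OF \<open>s \<in> bend\<close>], of j] kv by (simp add: radius2)
        then show ?thesis
          unfolding M2 using \<open>0 < ?c\<close> \<open>0 < m\<close> sigma_pos by (simp add: field_simps)
      next
        case False
        \<comment> \<open>On the legs only a lower bound of the radius matters: as m is at most 4,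
          they do not undercut the arcs.\<close>
        then have "\<sigma> * \<alpha> < \<bar>s\<bar>" using s by (auto simp: smooth_params_def)
        then have "curv2 (vel j s) (acc (kv j s) j s) \<le> 1 / (4 * \<sigma>\<^sup>2)"
          by (rule curv2_leg_le[OF s])
        also have "\<dots> \<le> 1 / (\<sigma>\<^sup>2 * m)"
          using \<open>m \<le> 4\<close> \<open>0 < m\<close> sigma_pos by (intro divide_left_mono) auto
        finally show ?thesis by (simp only: M2)
      qed
      moreover have "0 < M" using \<open>0 < m\<close> sigma_pos by (simp add: M_def)
      ultimately have "ereal (1 / M) \<le> curvature_radius (\<phi> ` base) x"
        using \<open>x \<in> \<phi> ` base\<close> by (intro curvature_radius_image_ge) auto
      then show "ereal (\<sigma> * sqrt m) \<le> curvature_radius (\<phi> ` base) x" by (simp add: M_def)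
    qed
  qed
  then have "ereal (1 / \<sigma>) * (INF x\<in>\<phi> ` base. curvature_radius (\<phi> ` base) x) = ereal (sqrt m)"
    using sigma_pos by simp
  then show ?thesis
    unfolding thickness_def reach m_def[symmetric] by (simp add: min_def)
qed

end

section \<open>Thickness of the clasp itself\<close>

context kink
begin

lemma bounded_base: obtains B where "base \<subseteq> cball 0 B"
proof -
  have "compact base"
    unfolding base_def by (intro compact_Un compact_continuous_image continuous_on_crv) auto
  then have "bounded base" by (rule compact_imp_bounded)
  then show ?thesis using that by (auto simp: bounded_iff subset_iff)
qed

lemma inner_frame_self [simp]: "tng j s \<bullet> tng j s = 1" "nrm j s \<bullet> nrm j s = 1"
  by (simp_all add: dot_square_norm)

lemma curv2_circle: "curv2 (tng j s) ((1 / \<sigma>) *\<^sub>R nrm j s) = 1 / \<sigma>\<^sup>2"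
  by (simp add: curv2_def power2_eq_square)

text \<open>The reach already gives the value 1, so for the curvature a lower bound suffices. In
  this way the case \<tau> = 0, without arcs and with infinite radius of curvature, is
  included.\<close>

lemma thickness_base: "thickness \<sigma> base = 1"
proof -
  obtain B where B: "base \<subseteq> cball 0 B" by (rule bounded_base)
  interpret id: near_identity \<tau> \<sigma> l id "\<lambda>_. id_blinfun" "\<lambda>_. 0" B
  proof
    show "(id has_derivative blinfun_apply id_blinfun) (at x)" for x :: space
      by (simp add: id_def)
    show "((\<lambda>_. id_blinfun) has_derivative blinfun_apply 0) (at x)" for x :: space
      by (simp add: zero_blinfun.rep_eq)
  qed (use B sigma_pos in \<open>auto intro: continuous_intros\<close>)
  have gap: "1 \<le> id.gap2 z" for z
    using components_distance by (simp add: id.gap2_def)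
  have "id.gap2 (0, 0) = 1"
    by (simp add: id.gap2_def tips_distance)
  with gap have "2 * reach base = 1"
    using id.two_reach_image[of "(0, 0)"] l_pos by simp
  moreover have "1 \<le> ereal (1 / \<sigma>) * (INF x\<in>base. curvature_radius base x)"
  proof -
    have "curv2 (id.vel j s) (id.acc (kv j s) j s) \<le> (1 / \<sigma>)\<^sup>2" for j s
      using curv2_circle[of j s] by (simp add: id.vel_def id.acc_def kv_def power_divide curv2_def)
    then have "ereal \<sigma> \<le> curvature_radius base x" if "x \<in> base" for x
      using id.curvature_radius_image_ge[of "1 / \<sigma>" x] that sigma_pos by simp
    then have "ereal \<sigma> \<le> (INF x\<in>base. curvature_radius base x)"
      by (rule INF_greatest)
    then have "ereal (1 / \<sigma>) * ereal \<sigma> \<le> ereal (1 / \<sigma>) * (INF x\<in>base. curvature_radius base x)"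
      using sigma_pos by (intro ereal_mult_left_mono) auto
    then show ?thesis using sigma_pos by (simp add: one_ereal_def)
  qed
  ultimately show ?thesis by (simp add: thickness_def min_def)
qed

end

section \<open>The first variation of thickness\<close>

locale kink_family = kink +
  fixes \<phi> :: "real \<Rightarrow> space \<Rightarrow> space" and F1 :: "real \<Rightarrow> space \<Rightarrow> space \<Rightarrow>\<^sub>L space"
    and F2 :: "real \<Rightarrow> space \<Rightarrow> space \<Rightarrow>\<^sub>L (space \<Rightarrow>\<^sub>L space)"
    and G0 :: "real \<Rightarrow> space \<Rightarrow> space" and G1 :: "real \<Rightarrow> space \<Rightarrow> space \<Rightarrow>\<^sub>L space"
    and G2 :: "real \<Rightarrow> space \<Rightarrow> space \<Rightarrow>\<^sub>L (space \<Rightarrow>\<^sub>L space)" and e :: real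
  assumes alpha_pos: "0 < arcsin \<tau>" and e: "0 < e"
    and inj_phi: "\<And>t. t \<in> {-e<..<e} \<Longrightarrow> inj (\<phi> t)"
    and F1: "\<And>t x. t \<in> {-e<..<e} \<Longrightarrow> (\<phi> t has_derivative blinfun_apply (F1 t x)) (at x)"
    and F2: "\<And>t x. t \<in> {-e<..<e} \<Longrightarrow> (F1 t has_derivative blinfun_apply (F2 t x)) (at x)"
    and cont_F2: "\<And>t. t \<in> {-e<..<e} \<Longrightarrow> continuous_on UNIV (F2 t)"
    and G0: "\<And>t x. t \<in> {-e<..<e} \<Longrightarrow> ((\<lambda>u. \<phi> u x) has_vector_derivative G0 t x) (at t)"
    and G1: "\<And>t x. t \<in> {-e<..<e} \<Longrightarrow> ((\<lambda>u. F1 u x) has_vector_derivative G1 t x) (at t)"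
    and G2: "\<And>t x. t \<in> {-e<..<e} \<Longrightarrow> ((\<lambda>u. F2 u x) has_vector_derivative G2 t x) (at t)"
    and cont_G0: "continuous_on ({-e<..<e} \<times> UNIV) (\<lambda>(t, x). G0 t x)"
    and cont_G1: "continuous_on ({-e<..<e} \<times> UNIV) (\<lambda>(t, x). G1 t x)"
    and cont_G2: "continuous_on ({-e<..<e} \<times> UNIV) (\<lambda>(t, x). G2 t x)"
    and phi_0: "\<phi> 0 = id"
begin

lemma F1_0: "F1 0 x = id_blinfun"
proof -
  have "(id has_derivative blinfun_apply (F1 0 x)) (at x)"
    using F1[of 0 x] e phi_0 by simp
  moreover have "(id has_derivative (\<lambda>x. x)) (at x)"
    unfolding id_def by (rule has_derivative_ident)
  ultimately have "blinfun_apply (F1 0 x) = (\<lambda>x. x)" by (rule has_derivative_unique)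
  then show ?thesis by (intro blinfun_eqI) simp
qed

lemma F2_0: "F2 0 x = 0"
proof -
  have "F1 0 = (\<lambda>_. id_blinfun)" using F1_0 by (rule ext)
  then have "((\<lambda>_. id_blinfun) has_derivative blinfun_apply (F2 0 x)) (at x)"
    using F2[of 0 x] e by simp
  from has_derivative_unique[OF this has_derivative_const] show ?thesis
    by (intro blinfun_eqI) simp
qed

lemma cont_phi: "continuous_on ({-e<..<e} \<times> UNIV) (\<lambda>(t, x). \<phi> t x)"
proof (rule continuous_on_time_derivative[OF G0 cont_G0])
  show "continuous_on UNIV (\<phi> t)" if "t \<in> {-e<..<e}" for t
    using has_derivative_continuous[OF F1[OF that]] by (simp add: continuous_on_eq_continuous_within)
qed

lemma cont_F1: "continuous_on ({-e<..<e} \<times> UNIV) (\<lambda>(t, x). F1 t x)"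
proof (rule continuous_on_time_derivative[OF G1 cont_G1])
  show "continuous_on UNIV (F1 t)" if "t \<in> {-e<..<e}" for t
    using has_derivative_continuous[OF F2[OF that]] by (simp add: continuous_on_eq_continuous_within)
qed

lemma cont_F2': "continuous_on ({-e<..<e} \<times> UNIV) (\<lambda>(t, x). F2 t x)"
  by (rule continuous_on_time_derivative[OF G2 cont_G2 cont_F2])

lemma cont_compose:
  assumes "continuous_on ({-e<..<e} \<times> UNIV) (\<lambda>(t, x). H t x)" "continuous_on S f" "continuous_on S g"
    and "\<And>p. p \<in> S \<Longrightarrow> f p \<in> {-e<..<e}"
  shows "continuous_on S (\<lambda>p. H (f p) (g p))"
proof -
  have "continuous_on S (\<lambda>p. (\<lambda>(t, x). H t x) (f p, g p))"
    by (rule continuous_on_compose2[OF assms(1)]) (use assms in \<open>auto intro!: continuous_intros\<close>)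
  then show ?thesis by simp
qed

text \<open>In this group of definitions a prime marks the time derivative. The acceleration is
  given by the arc formula at every parameter, which makes it continuous on the closed arc although
  \<open>tng\<close> is not differentiable at the junctions.\<close>

definition "vel_t t j s = blinfun_apply (F1 t (crv j s)) (tng j s)"
definition "vel_t' t j s = blinfun_apply (G1 t (crv j s)) (tng j s)"
definition "acc_t t j s = blinfun_apply (blinfun_apply (F2 t (crv j s)) (tng j s)) (tng j s)
  + blinfun_apply (F1 t (crv j s)) ((1 / \<sigma>) *\<^sub>R nrm j s)"
definition "acc_t' t j s = blinfun_apply (blinfun_apply (G2 t (crv j s)) (tng j s)) (tng j s)
  + blinfun_apply (G1 t (crv j s)) ((1 / \<sigma>) *\<^sub>R nrm j s)"
definition "den t j s = (vel_t t j s \<bullet> vel_t t j s) * (acc_t t j s \<bullet> acc_t t j s) - (vel_t t j s \<bullet> acc_t t j s)\<^sup>2"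
definition "gap_t t z = (\<phi> t (crv False (fst z)) - \<phi> t (crv True (snd z))) \<bullet> (\<phi> t (crv False (fst z)) - \<phi> t (crv True (snd z)))"
definition "gap_t' t z = 2 * ((\<phi> t (crv False (fst z)) - \<phi> t (crv True (snd z))) \<bullet> (G0 t (crv False (fst z)) - G0 t (crv True (snd z))))"

lemma has_vector_derivative_vel_t: "t \<in> {-e<..<e} \<Longrightarrow> ((\<lambda>t. vel_t t j s) has_vector_derivative vel_t' t j s) (at t)"
  unfolding vel_t_def vel_t'_def
  by (intro bounded_linear.has_vector_derivative[OF blinfun.bounded_linear_left] G1)

lemma has_vector_derivative_acc_t: "t \<in> {-e<..<e} \<Longrightarrow> ((\<lambda>t. acc_t t j s) has_vector_derivative acc_t' t j s) (at t)"
  unfolding acc_t_def acc_t'_def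
  by (intro has_vector_derivative_add bounded_linear.has_vector_derivative[OF blinfun.bounded_linear_left] G1 G2)

lemma has_real_derivative_gap_t: "t \<in> {-e<..<e} \<Longrightarrow> ((\<lambda>t. gap_t t z) has_real_derivative gap_t' t z) (at t)"
proof -
  assume t: "t \<in> {-e<..<e}"
  have "((\<lambda>t. \<phi> t (crv False (fst z)) - \<phi> t (crv True (snd z))) has_vector_derivative
      G0 t (crv False (fst z)) - G0 t (crv True (snd z))) (at t)"
    by (intro has_vector_derivative_diff G0 t)
  from has_real_derivative_inner[OF this this] show ?thesis
    unfolding gap_t_def[abs_def] gap_t'_def by (simp add: inner_commute)
qed

lemma continuous_on_tng_snd: "continuous_on S (\<lambda>p. tng j (snd p))"
  and continuous_on_nrm_snd: "continuous_on S (\<lambda>p. nrm j (snd p))"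
  and continuous_on_crv_snd: "continuous_on S (\<lambda>p. crv j (snd p))"
proof -
  have "continuous_on UNIV (nrm j)"
    unfolding nrm_def[abs_def] by (intro continuous_on_emb continuous_intros continuous_on_ang)
  then show "continuous_on S (\<lambda>p. nrm j (snd p))"
    by (rule continuous_on_compose2) (auto intro: continuous_intros)
  show "continuous_on S (\<lambda>p. tng j (snd p))"
    by (rule continuous_on_compose2[OF continuous_on_tng[of UNIV]]) (auto intro: continuous_intros)
  show "continuous_on S (\<lambda>p. crv j (snd p))"
    by (rule continuous_on_compose2[OF continuous_on_crv[of UNIV]]) (auto intro: continuous_intros)
qed

lemma continuous_on_family:
  assumes "d \<le> e"
  shows "continuous_on ({0..<d} \<times> K) (\<lambda>p. vel_t (fst p) j (snd p))"
    "continuous_on ({0..<d} \<times> K) (\<lambda>p. vel_t' (fst p) j (snd p))"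
    "continuous_on ({0..<d} \<times> K) (\<lambda>p. acc_t (fst p) j (snd p))"
    "continuous_on ({0..<d} \<times> K) (\<lambda>p. acc_t' (fst p) j (snd p))"
proof -
  have cont: "continuous_on ({0..<d} \<times> K) (\<lambda>p. H (fst p) (crv j (snd p)))"
    if "continuous_on ({-e<..<e} \<times> UNIV) (\<lambda>(t, x). H t x)" for H :: "real \<Rightarrow> space \<Rightarrow> 'b::topological_space"
    using assms by (intro cont_compose[OF that] continuous_on_crv_snd continuous_intros) auto
  show "continuous_on ({0..<d} \<times> K) (\<lambda>p. vel_t (fst p) j (snd p))"
    unfolding vel_t_def by (intro continuous_intros cont[OF cont_F1] continuous_on_tng_snd)
  show "continuous_on ({0..<d} \<times> K) (\<lambda>p. vel_t' (fst p) j (snd p))"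
    unfolding vel_t'_def by (intro continuous_intros cont[OF cont_G1] continuous_on_tng_snd)
  show "continuous_on ({0..<d} \<times> K) (\<lambda>p. acc_t (fst p) j (snd p))"
    unfolding acc_t_def
    by (intro continuous_intros cont[OF cont_F1] cont[OF cont_F2'] continuous_on_tng_snd continuous_on_nrm_snd)
  show "continuous_on ({0..<d} \<times> K) (\<lambda>p. acc_t' (fst p) j (snd p))"
    unfolding acc_t'_def
    by (intro continuous_intros cont[OF cont_G1] cont[OF cont_G2] continuous_on_tng_snd continuous_on_nrm_snd)
qed

lemma continuous_on_gap_t':
  assumes "d \<le> e"
  shows "continuous_on ({0..<d} \<times> K) (\<lambda>(t, z). gap_t' t z)"
proof -
  have crv: "continuous_on ({0..<d} \<times> K) (\<lambda>p. crv j (fst (snd p)))"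
    "continuous_on ({0..<d} \<times> K) (\<lambda>p. crv j (snd (snd p)))" for j
    by (rule continuous_on_compose2[OF continuous_on_crv[of UNIV]]; auto intro!: continuous_intros)+
  have cont: "continuous_on ({0..<d} \<times> K) (\<lambda>p. H (fst p) (crv j (fst (snd p))))"
    "continuous_on ({0..<d} \<times> K) (\<lambda>p. H (fst p) (crv j (snd (snd p))))"
    if "continuous_on ({-e<..<e} \<times> UNIV) (\<lambda>(t, x). H t x)" for H :: "real \<Rightarrow> space \<Rightarrow> 'b::topological_space" and j
    using assms by (intro cont_compose[OF that] crv continuous_intros; auto)+
  show ?thesis
    unfolding gap_t'_def case_prod_unfold
    by (intro continuous_intros cont[OF cont_phi] cont[OF cont_G0])
qed

lemma initial_values:
  "vel_t 0 j s = tng j s" "acc_t 0 j s = (1 / \<sigma>) *\<^sub>R nrm j s" "den 0 j s = 1 / \<sigma>\<^sup>2"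
  "gap_t 0 z = base_gap z"
  "gap_t' 0 z = 2 * ((crv False (fst z) - crv True (snd z)) \<bullet> (G0 0 (crv False (fst z)) - G0 0 (crv True (snd z))))"
  by (simp_all add: vel_t_def acc_t_def den_def gap_t_def gap_t'_def base_gap_def F1_0 F2_0 phi_0
      power2_eq_square)

text \<open>The spatial derivatives start at the identity and at 0, the Gram determinant
  \<open>den\<close> at \<open>1 / \<sigma>\<^sup>2\<close>; joint continuity keeps them close to
  these values on the compact ball and on the arcs.\<close>

lemma near_identity_eventually:
  obtains d where "0 < d" "d < e" "\<And>t. t \<in> {0..d} \<Longrightarrow> \<exists>B. near_identity \<tau> \<sigma> l (\<phi> t) (F1 t) (F2 t) B"
    "\<And>t j s. t \<in> {0..d} \<Longrightarrow> s \<in> bend \<Longrightarrow> 0 < den t j s"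
proof -
  obtain B where B: "base \<subseteq> cball 0 B" by (rule bounded_base)
  have cont: "continuous_on ({0..<e} \<times> K) (\<lambda>(t, x). H t x)"
    if "continuous_on ({-e<..<e} \<times> UNIV) (\<lambda>(t, x). H t x)" for K and H :: "real \<Rightarrow> space \<Rightarrow> 'b::topological_space"
    by (rule continuous_on_subset[OF that]) (use e in auto)
  obtain d1 where d1: "0 < d1" "d1 < e"
    "\<And>t x. t \<in> {0..d1} \<Longrightarrow> x \<in> cball 0 B \<Longrightarrow> dist (F1 t x) (F1 0 x) < 1 / 20"
    using uniformly_near_initial_time[OF compact_cball[of "0::space" B] e cont[OF cont_F1], of "1/20"] by auto
  obtain d2 where d2: "0 < d2" "d2 < e"
    "\<And>t x. t \<in> {0..d2} \<Longrightarrow> x \<in> cball 0 B \<Longrightarrow> dist (F2 t x) (F2 0 x) < 1 / (20 * \<sigma>)"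
    using uniformly_near_initial_time[OF compact_cball[of "0::space" B] e cont[OF cont_F2'], of "1/(20 * \<sigma>)"]
      sigma_pos by auto
  have "\<exists>d. 0 < d \<and> d < e \<and> (\<forall>t\<in>{0..d}. \<forall>s\<in>bend. 0 < den t j s)" for j
  proof -
    have "continuous_on ({0..<e} \<times> bend) (\<lambda>(t, s). den t j s)"
      unfolding den_def case_prod_unfold by (intro continuous_intros continuous_on_family) auto
    from uniformly_near_initial_time[OF compact_bend e this, of "1 / (2 * \<sigma>\<^sup>2)"] sigma_pos
    obtain d where d: "0 < d" "d < e"
      "\<And>t s. t \<in> {0..d} \<Longrightarrow> s \<in> bend \<Longrightarrow> dist (den t j s) (den 0 j s) < 1 / (2 * \<sigma>\<^sup>2)" by auto
    have "0 < den t j s" if "t \<in> {0..d}" "s \<in> bend" for t s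
    proof -
      have "1 / (2 * \<sigma>\<^sup>2) < 1 / \<sigma>\<^sup>2" using sigma_pos by (simp add: field_simps)
      then show ?thesis
        using d(3)[OF that] by (simp add: dist_real_def initial_values abs_if split: if_splits)
    qed
    with d show ?thesis by blast
  qed
  then obtain d3 where d3: "\<And>j. 0 < d3 j" "\<And>j. d3 j < e" "\<And>j t s. t \<in> {0..d3 j} \<Longrightarrow> s \<in> bend \<Longrightarrow> 0 < den t j s"
    by metis
  define d where "d = Min {d1, d2, d3 False, d3 True}"
  have d: "0 < d" "d < e" "d \<le> d1" "d \<le> d2" "d \<le> d3 j" for j
    unfolding d_def using d1 d2 d3 by (cases j; simp)+
  show ?thesis
  proof
    fix t assume t: "t \<in> {0..d}"
    then have te: "t \<in> {-e<..<e}" using d e by auto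
    have "near_identity \<tau> \<sigma> l (\<phi> t) (F1 t) (F2 t) B"
    proof
      fix x :: space assume x: "x \<in> cball 0 B"
      show "norm (F1 t x - id_blinfun) \<le> 1 / 20"
        using d1(3)[OF _ x, of t] t d by (simp add: F1_0 dist_norm)
      show "norm (F2 t x) \<le> 1 / (20 * \<sigma>)"
        using d2(3)[OF _ x, of t] t d by (simp add: F2_0 dist_norm)
    qed (use B inj_phi[OF te] F1[OF te] F2[OF te] cont_F2[OF te] in auto)
    then show "\<exists>B. near_identity \<tau> \<sigma> l (\<phi> t) (F1 t) (F2 t) B" by blast
  next
    fix t j s assume "t \<in> {0..d}" "s \<in> bend"
    then show "0 < den t j s" using d3(3)[of t j s] d(5)[of j] by auto
  qed (use d in auto)
qed

text \<open>The three squared infima all start at 1, so the one-sided derivative of their minimum is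
  the minimum of their derivatives; the factor 1/2 is the derivative of the square root at
  1.\<close>

lemma has_derivative_thickness:
  "((\<lambda>t. real_of_ereal (thickness \<sigma> (\<phi> t ` base))) has_real_derivative
     min (INF z\<in>{z\<in>square. gap_t 0 z = (INF z\<in>square. gap_t 0 z)}. gap_t' 0 z)
      (min (INF s\<in>bend. rho2_deriv \<sigma> (tng False s) (vel_t' 0 False s) ((1 / \<sigma>) *\<^sub>R nrm False s) (acc_t' 0 False s))
           (INF s\<in>bend. rho2_deriv \<sigma> (tng True s) (vel_t' 0 True s) ((1 / \<sigma>) *\<^sub>R nrm True s) (acc_t' 0 True s))) / 2)
   (at_right 0)"
proof -
  obtain d where d: "0 < d" "d < e" and near: "\<And>t. t \<in> {0..d} \<Longrightarrow> \<exists>B. near_identity \<tau> \<sigma> l (\<phi> t) (F1 t) (F2 t) B"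
    and den: "\<And>t j s. t \<in> {0..d} \<Longrightarrow> s \<in> bend \<Longrightarrow> 0 < den t j s"
    by (rule near_identity_eventually) blast
  define R where "R j t s = rho2 \<sigma> (vel_t t j s) (acc_t t j s)" for j t s
  define R' where "R' j t s = rho2_deriv \<sigma> (vel_t t j s) (vel_t' t j s) (acc_t t j s) (acc_t' t j s)" for j t s
  define mg where "mg t = (INF z\<in>square. gap_t t z)" for t
  define mR where "mR j t = (INF s\<in>bend. R j t s)" for j t
  have R0: "R j 0 s = 1" for j s
    using sigma_pos by (simp add: R_def initial_values rho2_def power2_eq_square)
  have mR0: "mR j 0 = 1" for j
    unfolding mR_def R0 using zero_in_bend by (intro cINF_const) auto
  have mg0: "mg 0 = 1" unfolding mg_def initial_values by (rule base_gap_tips)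
  have derivR: "(mR j has_real_derivative (INF s\<in>bend. R' j 0 s)) (at_right 0)" for j
  proof -
    have "((\<lambda>t. INF s\<in>bend. R j t s) has_real_derivative
        (INF s\<in>{s\<in>bend. R j 0 s = (INF s\<in>bend. R j 0 s)}. R' j 0 s)) (at_right 0)"
    proof (rule danskin[OF compact_bend _ d(1)])
      fix t s assume t: "t \<in> {0..<d}" and s: "s \<in> bend"
      have te: "t \<in> {-e<..<e}" using t d by auto
      show "((\<lambda>u. R j u s) has_real_derivative R' j t s) (at t)"
        unfolding R_def R'_def
        using den[of t s j] t s sigma_pos unfolding den_def
        by (intro has_real_derivative_rho2 has_vector_derivative_vel_t has_vector_derivative_acc_t te) auto
    next
      have nz: "den (fst p) j (snd p) \<noteq> 0" if "p \<in> {0..<d} \<times> bend" for p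
        using den[of "fst p" "snd p" j] that by (auto simp: mem_Times_iff)
      show "continuous_on ({0..<d} \<times> bend) (\<lambda>(t, s). R' j t s)"
        unfolding R'_def rho2_deriv_def case_prod_unfold
        using nz sigma_pos d(2) unfolding den_def
        by (intro continuous_intros continuous_on_family) auto
      show "continuous_on bend (R j 0)" unfolding R0[abs_def] by (simp add: R0)
    qed (use zero_in_bend in auto)
    \<comment> \<open>The squared radius is 1 along the whole unperturbed arc, so every point of
      \<open>bend\<close> is active; for the gap only the contact set is.\<close>
    then show ?thesis using mR0[of j] unfolding mR_def by (simp add: R0)
  qed
  have derivg: "(mg has_real_derivative (INF z\<in>{z\<in>square. gap_t 0 z = (INF z\<in>square. gap_t 0 z)}. gap_t' 0 z)) (at_right 0)"
    unfolding mg_def[abs_def]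
  proof (rule danskin[OF compact_square _ d(1)])
    fix t z assume "t \<in> {0..<d}"
    then have "t \<in> {-e<..<e}" using d by auto
    then show "((\<lambda>u. gap_t u z) has_real_derivative gap_t' t z) (at t)" by (rule has_real_derivative_gap_t)
  next
    show "continuous_on ({0..<d} \<times> square) (\<lambda>(t, z). gap_t' t z)"
      by (rule continuous_on_gap_t') (use d in simp)
    show "continuous_on square (gap_t 0)"
      unfolding initial_values[abs_def] base_gap_def[abs_def]
      by (intro continuous_intros continuous_on_compose2[OF continuous_on_crv[of UNIV]]) auto
  qed (use square_nonempty in auto)
  define m where "m t = min (mg t) (min (mR False t) (mR True t))" for t
  define D where "D = min (INF z\<in>{z\<in>square. gap_t 0 z = (INF z\<in>square. gap_t 0 z)}. gap_t' 0 z)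
      (min (INF s\<in>bend. R' False 0 s) (INF s\<in>bend. R' True 0 s))"
  have deriv_m: "(m has_real_derivative D) (at_right 0)"
    unfolding m_def[abs_def] D_def
    by (intro has_real_derivative_min_right derivg derivR) (simp_all add: mg0 mR0)
  have m0: "m 0 = 1" by (simp add: m_def mg0 mR0)
  then have "(sqrt has_real_derivative inverse (sqrt (m 0)) / 2) (at (m 0))"
    by (intro DERIV_real_sqrt) simp
  from DERIV_chain2[OF this deriv_m] m0
  have sqrt_m: "((\<lambda>t. sqrt (m t)) has_real_derivative D / 2) (at_right 0)" by simp
  have formula: "real_of_ereal (thickness \<sigma> (\<phi> t ` base)) = sqrt (m t)"
    if t: "t \<in> {0..d}" and small: "mg t \<le> 9 / 4" "mR False t \<le> 4" for t
  proof -
    obtain B where "near_identity \<tau> \<sigma> l (\<phi> t) (F1 t) (F2 t) B" using near[OF t] by blast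
    then interpret nt: near_identity \<tau> \<sigma> l "\<phi> t" "F1 t" "F2 t" B .
    have va: "nt.vel j s = vel_t t j s" "nt.acc ((1 / \<sigma>) *\<^sub>R nrm j s) j s = acc_t t j s" for j s
      by (simp_all add: nt.vel_def nt.acc_def vel_t_def acc_t_def)
    have gap: "nt.gap2 = gap_t t" by (simp add: nt.gap2_def[abs_def] gap_t_def[abs_def])
    have "0 < curv2 (vel_t t j s) (acc_t t j s)" if "s \<in> bend" for j s
    proof -
      have "0 < vel_t t j s \<bullet> vel_t t j s" using nt.vel_nonzero[OF bend_subset[OF that], of j] va by simp
      then show ?thesis using den[OF t that, of j] by (simp add: curv2_def den_def)
    qed
    then have "thickness \<sigma> (\<phi> t ` base) = ereal (sqrt (m t))"
      using nt.thickness_image alpha_pos small unfolding va gap m_def mg_def mR_def R_def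
      by (simp add: \<alpha>_def)
    then show ?thesis by simp
  qed
  have "\<forall>\<^sub>F t in at_right 0. real_of_ereal (thickness \<sigma> (\<phi> t ` base)) = sqrt (m t)"
  proof -
    \<comment> \<open>Differentiability from the right gives continuity, and 1 is below both
      thresholds, so the explicit formula holds for short times.\<close>
    have lim: "(mg \<longlongrightarrow> mg 0) (at_right 0)" "(mR False \<longlongrightarrow> mR False 0) (at_right 0)"
      using derivg derivR[of False] by (auto dest!: DERIV_continuous simp: continuous_within)
    have "\<forall>\<^sub>F t in at_right 0. mg t < 9 / 4" "\<forall>\<^sub>F t in at_right 0. mR False t < 4"
      by (rule order_tendstoD(2)[OF lim(1)], simp add: mg0) (rule order_tendstoD(2)[OF lim(2)], simp add: mR0)
    moreover have "\<forall>\<^sub>F t in at_right 0. t \<in> {0<..<d}"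
      using d(1) by (rule eventually_at_right_real)
    ultimately show ?thesis
      by eventually_elim (rule formula, auto)
  qed
  moreover have "real_of_ereal (thickness \<sigma> (\<phi> 0 ` base)) = sqrt (m 0)"
    using formula[of 0] d by (simp add: mg0 mR0)
  ultimately have "((\<lambda>t. real_of_ereal (thickness \<sigma> (\<phi> t ` base))) has_real_derivative D / 2) (at_right 0)"
    using sqrt_m has_field_derivative_cong_eventually[of "\<lambda>t. real_of_ereal (thickness \<sigma> (\<phi> t ` base))"
        "\<lambda>t. sqrt (m t)" 0 "{0<..}" "D / 2"] by simp
  then show ?thesis by (simp only: D_def R'_def initial_values)
qed

end

section \<open>Balancing the constraints\<close>

context kink
begin

text \<open>
  The density of the curvature multiplier along the half of the curve on the side \<open>\<epsilon>\<close> of its tip, with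
  its derivative. It solves \<open>f'' + f / \<sigma>\<^sup>2 = 1 / \<sigma>\<close> on the arc, with \<open>f = f' = 0\<close> at the junction.
\<close>

definition "weight \<epsilon> s = \<sigma> * (1 - cos (\<alpha> - \<epsilon> * ang s))"
definition "weight' \<epsilon> s = - \<epsilon> * sin (\<alpha> - \<epsilon> * ang s)"

text \<open>H is the boundary term of the integration by parts. On the arc its derivative is the
  density of the length variation plus \<open>weight\<close> times the variation of curvature; on a
  leg the weight vanishes and only the density remains. Since the weight is nonnegative and the
  curvature does not increase, this derivative is at most the density. The sign \<epsilon> selects
  one half of the component, because the weight has a corner at the tip.\<close>

lemma multiplier_half:
  fixes W W1 W2 :: "real \<Rightarrow> space" and \<epsilon> a b :: real and j
  defines "H \<equiv> \<lambda>s. W s \<bullet> tng j s + weight \<epsilon> s * (W1 s \<bullet> nrm j s - (W s \<bullet> tng j s) / \<sigma>) - weight' \<epsilon> s * (W s \<bullet> nrm j s)"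
  assumes W: "\<And>s. (W has_vector_derivative W1 s) (at s)"
    and W1: "\<And>s. \<bar>s\<bar> < \<sigma> * \<alpha> \<Longrightarrow> (W1 has_vector_derivative W2 s) (at s)"
    and cont: "continuous_on UNIV W1"
    and neg: "\<And>s. \<bar>s\<bar> < \<sigma> * \<alpha> \<Longrightarrow> W2 s \<bullet> nrm j s - 2 / \<sigma> * (W1 s \<bullet> tng j s) \<le> 0"
    and \<epsilon>: "\<epsilon>\<^sup>2 = 1" and ab: "a \<le> b" and side: "\<And>s. s \<in> {a<..<b} \<Longrightarrow> 0 < \<epsilon> * s"
  shows "H b - H a \<le> integral {a..b} (\<lambda>s. W1 s \<bullet> tng j s)"
proof -
  define h where "h s = W1 s \<bullet> tng j s +
    (if \<bar>s\<bar> < \<sigma> * \<alpha> then weight \<epsilon> s * (W2 s \<bullet> nrm j s - 2 / \<sigma> * (W1 s \<bullet> tng j s)) else 0)" for s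
  have cont_W: "continuous_on UNIV W"
    using W by (meson continuous_at_imp_continuous_on has_vector_derivative_continuous)
  have cont_nrm: "continuous_on UNIV (nrm j)"
    unfolding nrm_def[abs_def] by (intro continuous_on_emb continuous_intros continuous_on_ang)
  have \<epsilon>_cases: "\<epsilon> = 1 \<or> \<epsilon> = - 1" using \<epsilon> by (simp add: power2_eq_1_iff)
  have "(h has_integral (H b - H a)) {a..b}"
  \<comment> \<open>H is continuous everywhere and the junctions are only two points, so they may be
    left out.\<close>
  proof (rule fundamental_theorem_of_calculus_interior_strong[where S = "{\<sigma> * \<alpha>, - (\<sigma> * \<alpha>)}"])
    show "continuous_on {a..b} H"
      unfolding H_def weight_def weight'_def
      by (intro continuous_intros continuous_on_subset[OF cont_W] continuous_on_subset[OF cont]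
          continuous_on_subset[OF cont_nrm] continuous_on_tng continuous_on_ang) (use sigma_pos in auto)
    fix s assume s: "s \<in> {a<..<b} - {\<sigma> * \<alpha>, - (\<sigma> * \<alpha>)}"
    consider "\<bar>s\<bar> < \<sigma> * \<alpha>" | "\<sigma> * \<alpha> < \<bar>s\<bar>" using s by fastforce
    then have "(H has_real_derivative h s) (at s)"
    proof cases
      case 1
      note T = has_vector_derivative_tng_arc(1)[OF 1, of j] and N = has_vector_derivative_tng_arc(2)[OF 1, of j]
      define u w where "u = W s \<bullet> tng j s" and "w = W s \<bullet> nrm j s"
      have du: "((\<lambda>s. W s \<bullet> tng j s) has_real_derivative W1 s \<bullet> tng j s + w / \<sigma>) (at s)"
        using has_real_derivative_inner[OF W T] by (simp add: w_def add.commute)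
      have dw: "((\<lambda>s. W s \<bullet> nrm j s) has_real_derivative W1 s \<bullet> nrm j s - u / \<sigma>) (at s)"
        using has_real_derivative_inner[OF W N] by (simp add: u_def)
      have dw1: "((\<lambda>s. W1 s \<bullet> nrm j s) has_real_derivative W2 s \<bullet> nrm j s - (W1 s \<bullet> tng j s) / \<sigma>) (at s)"
        using has_real_derivative_inner[OF W1[OF 1] N] by simp
      have s': "s \<in> {- (\<sigma> * \<alpha>)<..<\<sigma> * \<alpha>}" using 1 by auto
      have dang: "(ang has_real_derivative 1 / \<sigma>) (at s)"
        by (rule has_field_derivative_transform_within_open[OF _ _ s', of "\<lambda>s. s / \<sigma>"])
          (use sigma_pos ang_arc in \<open>auto intro!: derivative_eq_intros simp: abs_le_iff\<close>)
      have df: "(weight \<epsilon> has_real_derivative weight' \<epsilon> s) (at s)"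
        unfolding weight_def[abs_def] weight'_def
        using sigma_pos by (auto intro!: derivative_eq_intros dang)
      have df': "(weight' \<epsilon> has_real_derivative cos (\<alpha> - \<epsilon> * ang s) / \<sigma>) (at s)"
        unfolding weight'_def[abs_def]
        using sigma_pos \<epsilon> by (auto intro!: derivative_eq_intros dang simp: power2_eq_square)
      have "(H has_real_derivative
          (W1 s \<bullet> tng j s + w / \<sigma>) + (weight' \<epsilon> s * (W1 s \<bullet> nrm j s - u / \<sigma>) +
            (W2 s \<bullet> nrm j s - (W1 s \<bullet> tng j s) / \<sigma> - (W1 s \<bullet> tng j s + w / \<sigma>) / \<sigma>) * weight \<epsilon> s)
          - (cos (\<alpha> - \<epsilon> * ang s) / \<sigma> * w + (W1 s \<bullet> nrm j s - u / \<sigma>) * weight' \<epsilon> s)) (at s)"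
        unfolding H_def u_def[symmetric] w_def[symmetric]
        using DERIV_diff[OF DERIV_add[OF du DERIV_mult[OF df DERIV_diff[OF dw1 DERIV_cdivide[OF du, of \<sigma>]]]] DERIV_mult[OF df' dw]]
        by (simp add: u_def w_def)
      moreover have "(W1 s \<bullet> tng j s + w / \<sigma>) + (weight' \<epsilon> s * (W1 s \<bullet> nrm j s - u / \<sigma>) +
            (W2 s \<bullet> nrm j s - (W1 s \<bullet> tng j s) / \<sigma> - (W1 s \<bullet> tng j s + w / \<sigma>) / \<sigma>) * weight \<epsilon> s)
          - (cos (\<alpha> - \<epsilon> * ang s) / \<sigma> * w + (W1 s \<bullet> nrm j s - u / \<sigma>) * weight' \<epsilon> s) = h s"
      proof -
        \<comment> \<open>The coefficient of w vanishes by the differential equation of the weight;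
          this is what determines its form.\<close>
        have "w / \<sigma> - w / \<sigma> / \<sigma> * weight \<epsilon> s - cos (\<alpha> - \<epsilon> * ang s) / \<sigma> * w = 0"
          using sigma_pos by (simp add: weight_def field_simps)
        moreover have "(a + w / \<sigma>) + (f' * q + (b - a / \<sigma> - (a + w / \<sigma>) / \<sigma>) * f) - (c / \<sigma> * w + q * f')
            = a + f * (b - 2 / \<sigma> * a) + (w / \<sigma> - w / \<sigma> / \<sigma> * f - c / \<sigma> * w)" for a b c f f' q
          by (simp add: algebra_simps diff_divide_distrib add_divide_distrib)
        ultimately show ?thesis using 1 by (simp only: h_def if_True add_0_right)
      qed
      ultimately show ?thesis by simp
    next
      case 2
      note T = has_vector_derivative_leg(1)[OF 2, of j] and A = has_vector_derivative_leg(3)[OF 2]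
      have "\<epsilon> * ang s = \<alpha>"
        using \<epsilon>_cases side[of s] s 2 sigma_alpha_nonneg by (cases s rule: slack_cases) auto
      define S where "S = {a<..<b} - {- (\<sigma> * \<alpha>)..\<sigma> * \<alpha>}"
      have "open S" "s \<in> S" using s 2 by (auto simp: S_def open_Diff)
      have "((\<lambda>s. W s \<bullet> tng j s) has_real_derivative W1 s \<bullet> tng j s) (at s)"
        using has_real_derivative_inner[OF W T] by simp
      then have "(H has_real_derivative W1 s \<bullet> tng j s) (at s)"
      proof (rule has_field_derivative_transform_within_open[OF _ \<open>open S\<close> \<open>s \<in> S\<close>])
        fix x assume x: "x \<in> S"
        then have "\<sigma> * \<alpha> < \<bar>x\<bar>" "0 < \<epsilon> * x" using side[of x] by (auto simp: S_def)
        then have "\<epsilon> * ang x = \<alpha>"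
          using \<epsilon>_cases sigma_alpha_nonneg by (cases x rule: slack_cases) auto
        then show "W x \<bullet> tng j x = H x" by (simp add: H_def weight_def weight'_def)
      qed
      then show ?thesis using 2 by (simp add: h_def)
    qed
    then show "(H has_vector_derivative h s) (at s)"
      by (simp add: has_real_derivative_iff_has_vector_derivative)
  qed (use ab in auto)
  moreover have "continuous_on {a..b} (\<lambda>s. W1 s \<bullet> tng j s)"
    by (intro continuous_intros continuous_on_subset[OF cont] continuous_on_tng) auto
  then have "((\<lambda>s. W1 s \<bullet> tng j s) has_integral integral {a..b} (\<lambda>s. W1 s \<bullet> tng j s)) {a..b}"
    by (intro integrable_integral integrable_continuous_real)
  moreover have "h s \<le> W1 s \<bullet> tng j s" for s
    using neg[of s] mult_nonneg_nonpos[of "weight \<epsilon> s" "W2 s \<bullet> nrm j s - 2 / \<sigma> * (W1 s \<bullet> tng j s)"] sigma_pos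
    by (auto simp: h_def weight_def)
  ultimately show ?thesis by (rule has_integral_le)
qed

text \<open>At the outer ends weight and derivative vanish, and H reduces to the tangential
  component, which is 0 there. At the tip the two halves agree except for the derivatives of the
  weight, whose values \<open>\<tau>\<close> and \<open>- \<tau>\<close> leave twice \<tau> times
  the normal component.\<close>

lemma length_variation_bound:
  fixes W W1 W2 :: "real \<Rightarrow> space"
  assumes W: "\<And>s. (W has_vector_derivative W1 s) (at s)"
    and W1: "\<And>s. \<bar>s\<bar> < \<sigma> * \<alpha> \<Longrightarrow> (W1 has_vector_derivative W2 s) (at s)"
    and cont: "continuous_on UNIV W1"
    and neg: "\<And>s. \<bar>s\<bar> < \<sigma> * \<alpha> \<Longrightarrow> W2 s \<bullet> nrm j s - 2 / \<sigma> * (W1 s \<bullet> tng j s) \<le> 0"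
    and ends: "W l \<bullet> tng j l = 0" "W (- l) \<bullet> tng j (- l) = 0"
  shows "- 2 * \<tau> * (W 0 \<bullet> nrm j 0) \<le> integral {-l..l} (\<lambda>s. W1 s \<bullet> tng j s)"
proof -
  define H where "H \<epsilon> s = W s \<bullet> tng j s + weight \<epsilon> s * (W1 s \<bullet> nrm j s - (W s \<bullet> tng j s) / \<sigma>)
    - weight' \<epsilon> s * (W s \<bullet> nrm j s)" for \<epsilon> s
  have right: "H 1 l - H 1 0 \<le> integral {0..l} (\<lambda>s. W1 s \<bullet> tng j s)"
    unfolding H_def by (rule multiplier_half[OF W W1 cont neg]) (use l_pos in auto)
  have left: "H (- 1) 0 - H (- 1) (- l) \<le> integral {-l..0} (\<lambda>s. W1 s \<bullet> tng j s)"
    unfolding H_def by (rule multiplier_half[OF W W1 cont neg]) (use l_pos in auto)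
  have "H 1 l = 0" "H (- 1) (- l) = 0"
    using ends by (simp_all add: H_def weight_def weight'_def ang_l ang_uminus)
  moreover have "H (- 1) 0 - H 1 0 = - 2 * \<tau> * (W 0 \<bullet> nrm j 0)"
  proof -
    have "ang 0 = 0" using ang_uminus[of 0] by simp
    then show ?thesis by (simp add: H_def weight_def weight'_def alpha(3))
  qed
  moreover have "integral {-l..0} (\<lambda>s. W1 s \<bullet> tng j s) + integral {0..l} (\<lambda>s. W1 s \<bullet> tng j s)
      = integral {-l..l} (\<lambda>s. W1 s \<bullet> tng j s)"
    using l_pos
    by (intro Henstock_Kurzweil_Integration.integral_combine integrable_continuous_real continuous_intros
        continuous_on_subset[OF cont] continuous_on_tng) auto
  ultimately show ?thesis using left right by linarith
qed

section \<open>The symmetric link generated by half a component\<close>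

lemma crv_uminus: "crv j (- s) = emb j (- px s) (pz s)"
  by (simp add: crv_def px_def pz_def slack_def ang_uminus algebra_simps)

end

lemma star22_emb:
  "(\<lambda>p. vector [- p$1, p$2, p$3]) (emb False x z) = emb False (- x) z"
  "(\<lambda>p. vector [- p$1, p$2, p$3]) (emb True x z) = emb True x z"
  "(\<lambda>p. vector [p$1, - p$2, p$3]) (emb False x z) = emb False x z"
  "(\<lambda>p. vector [p$1, - p$2, p$3]) (emb True x z) = emb True (- x) z"
  "(\<lambda>p. vector [- p$2, p$1, - p$3]) (emb False x z) = emb True x z"
  "(\<lambda>p. vector [- p$2, p$1, - p$3]) (emb True x z) = emb False (- x) z"
  by (simp_all add: emb_def)

context kink
begin

text \<open>The junction has height \<open>(\<sigma> - 1/2) * \<tau>\<close> in the direction of the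
  face normal, and the leg runs in that direction. It therefore has length
  \<open>h - (\<sigma> - 1/2) * \<tau>\<close>, and the arc adds
  \<open>\<sigma> * \<alpha>\<close>.\<close>

lemma kinky_curve_eq:
  assumes h: "l = h - (\<sigma> - 1/2) * \<tau> + \<sigma> * \<alpha>"
  shows "kinky_curve h \<tau> \<sigma> = crv False ` {0..l}"
proof -
  have point: "kink_point \<sigma> \<theta> = emb False (\<sigma> * sin \<theta>) (\<sigma> - 1/2 - \<sigma> * cos \<theta>)" for \<theta>
    by (simp add: kink_point_def emb_def)
  have tangent: "kink_tangent \<theta> = emb False (cos \<theta>) (sin \<theta>)" for \<theta>
    by (simp add: kink_tangent_def emb_def)
  have normal: "face_normal1 \<tau> 1 = emb False (cos \<alpha>) (sin \<alpha>)"
    by (simp add: face_normal1_def emb_def alpha)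
  have "kink_point \<sigma> ` {0..\<alpha>} = crv False ` {0..\<sigma> * \<alpha>}"
  proof -
    have "crv False (\<sigma> * \<theta>) = kink_point \<sigma> \<theta>" if "\<theta> \<in> {0..\<alpha>}" for \<theta>
    proof -
      have "\<bar>\<sigma> * \<theta>\<bar> \<le> \<sigma> * \<alpha>" using that sigma_pos by simp
      then show ?thesis
        using sigma_pos by (simp add: crv_def px_def pz_def point ang_arc slack_arc)
    qed
    moreover have "{0..\<sigma> * \<alpha>} = (\<lambda>\<theta>. \<sigma> * \<theta>) ` {0..\<alpha>}"
      using sigma_pos by (simp add: image_mult_atLeastAtMost)
    ultimately show ?thesis by (simp add: image_image)
  qed
  moreover have "{p. \<exists>s\<ge>0. p = kink_point \<sigma> \<alpha> + s *\<^sub>R kink_tangent \<alpha> \<and> p \<bullet> face_normal1 \<tau> 1 \<le> h}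
      = crv False ` {\<sigma> * \<alpha>..l}"
  proof -
    have leg: "crv False (\<sigma> * \<alpha> + s) = kink_point \<sigma> \<alpha> + s *\<^sub>R kink_tangent \<alpha>" if "0 \<le> s" for s
    proof -
      have "ang (\<sigma> * \<alpha> + s) = \<alpha>"
        using that sigma_alpha_nonneg sigma_pos by (cases "\<sigma> * \<alpha> + s" rule: slack_cases) auto
      then show ?thesis
        by (simp add: crv_def px_def pz_def slack_def point tangent emb_simps algebra_simps)
    qed
    have "(kink_point \<sigma> \<alpha> + s *\<^sub>R kink_tangent \<alpha>) \<bullet> face_normal1 \<tau> 1 = (\<sigma> - 1/2) * \<tau> + s" for s
    proof -
      have "(\<sigma> * S + s * C) * C + (\<sigma> - 1/2 - \<sigma> * C + s * S) * S = (\<sigma> - 1/2) * S + s * (S\<^sup>2 + C\<^sup>2)" for S C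
        by (simp add: power2_eq_square algebra_simps)
      from this[of "sin \<alpha>" "cos \<alpha>"] show ?thesis
        unfolding sin_cos_squared_add point tangent normal emb_simps by (simp add: alpha(3))
    qed
    then have "{p. \<exists>s\<ge>0. p = kink_point \<sigma> \<alpha> + s *\<^sub>R kink_tangent \<alpha> \<and> p \<bullet> face_normal1 \<tau> 1 \<le> h}
        = (\<lambda>s. kink_point \<sigma> \<alpha> + s *\<^sub>R kink_tangent \<alpha>) ` {0..l - \<sigma> * \<alpha>}"
      unfolding h by auto
    also have "\<dots> = (\<lambda>s. crv False (\<sigma> * \<alpha> + s)) ` {0..l - \<sigma> * \<alpha>}"
      using leg by (intro image_cong) auto
    also have "\<dots> = crv False ` {\<sigma> * \<alpha>..l}"
    proof -
      have "{\<sigma> * \<alpha>..l} = (\<lambda>s. \<sigma> * \<alpha> + s) ` {0..l - \<sigma> * \<alpha>}" by simp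
      then show ?thesis by (simp only: image_image)
    qed
    finally show ?thesis .
  qed
  moreover have "{0..l} = {0..\<sigma> * \<alpha>} \<union> {\<sigma> * \<alpha>..l}"
    using sigma_alpha_nonneg alpha(5) by auto
  ultimately show ?thesis
    by (simp add: kinky_curve_def image_Un flip: \<alpha>_def)
qed

lemma star22_base: "g \<in> star22 \<Longrightarrow> x \<in> base \<Longrightarrow> g x \<in> base"
proof (induction rule: star22.induct)
  case one
  then show ?case by simp
next
  case (reflect_x f)
  then have "f x \<in> base" by blast
  then obtain j s where s: "s \<in> {-l..l}" "f x = crv j s" unfolding base_def by blast
  have "(\<lambda>p. vector [- p$1, p$2, p$3]) (f x) \<in> {crv j s, crv j (- s)}"
    unfolding s(2) crv_uminus unfolding crv_def by (cases j) (simp_all only: star22_emb insert_iff simp_thms)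
  then show ?case using s(1) crv_in_base[of s j] crv_in_base[of "- s" j] by auto
next
  case (reflect_y f)
  then have "f x \<in> base" by blast
  then obtain j s where s: "s \<in> {-l..l}" "f x = crv j s" unfolding base_def by blast
  have "(\<lambda>p. vector [p$1, - p$2, p$3]) (f x) \<in> {crv j s, crv j (- s)}"
    unfolding s(2) crv_uminus unfolding crv_def by (cases j) (simp_all only: star22_emb insert_iff simp_thms)
  then show ?case using s(1) crv_in_base[of s j] crv_in_base[of "- s" j] by auto
next
  case (rotate_reflect f)
  then have "f x \<in> base" by blast
  then obtain j s where s: "s \<in> {-l..l}" "f x = crv j s" unfolding base_def by blast
  have "(\<lambda>p. vector [- p$2, p$1, - p$3]) (f x) \<in> {crv (\<not> j) s, crv (\<not> j) (- s)}"
    unfolding s(2) crv_uminus unfolding crv_def by (cases j) (simp_all only: star22_emb insert_iff simp_thms)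
  then show ?case using s(1) crv_in_base[of s "\<not> j"] crv_in_base[of "- s" "\<not> j"] by auto
qed

lemma symmetrize_eq: "symmetrize (crv False ` {0..l}) = base"
proof
  show "symmetrize (crv False ` {0..l}) \<subseteq> base"
  proof
    fix y assume "y \<in> symmetrize (crv False ` {0..l})"
    then obtain g s where g: "g \<in> star22" and s: "s \<in> {0..l}" "y = g (crv False s)"
      unfolding symmetrize_def by blast
    have "crv False s \<in> base" using s(1) by (intro crv_in_base) auto
    then show "y \<in> base" unfolding s(2) by (rule star22_base[OF g])
  qed
  show "base \<subseteq> symmetrize (crv False ` {0..l})"
  proof
    fix y assume "y \<in> base"
    then obtain j s where s: "s \<in> {-l..l}" "y = crv j s" unfolding base_def by blast
    \<comment> \<open>Four of the eight elements of the group already cover the link, since each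
      component is fixed pointwise by the reflection in its own plane.\<close>
    define g1 g2 where "g1 = (\<lambda>p :: space. vector [- p$1, p$2, p$3] :: space)"
      and "g2 = (\<lambda>p :: space. vector [- p$2, p$1, - p$3] :: space)"
    have g: "id \<in> star22" "g1 \<circ> id \<in> star22" "g2 \<circ> id \<in> star22" "g2 \<circ> (g1 \<circ> id) \<in> star22"
      unfolding g1_def g2_def by (intro star22.intros)+
    have sym: "g (crv False u) \<in> symmetrize (crv False ` {0..l})" if "g \<in> star22" "u \<in> {0..l}" for g u
      using that unfolding symmetrize_def by blast
    have maps: "g1 (crv False u) = crv False (- u)" "g2 (crv False u) = crv True u" for u
      unfolding crv_uminus unfolding crv_def g1_def g2_def star22_emb by simp_all
    have maps': "g2 (crv False (- u)) = crv True (- u)" for u by (rule maps)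
    show "y \<in> symmetrize (crv False ` {0..l})"
    proof (cases "0 \<le> s")
      case True
      then have "s \<in> {0..l}" using s(1) by simp
      then show ?thesis
        using sym[OF g(1), of s] sym[OF g(3), of s] by (cases j) (simp_all add: s(2) maps)
    next
      case False
      then have "- s \<in> {0..l}" using s(1) by simp
      then show ?thesis
        using sym[OF g(2), of "- s"] sym[OF g(4), of "- s"] by (cases j) (simp_all add: s(2) maps)
    qed
  qed
qed

end

section \<open>The variation of thickness as a function of the field alone\<close>

lemma blinfun_derivative_unique:
  assumes "(f has_derivative blinfun_apply A) (at x)" "(f has_derivative blinfun_apply B) (at x)"
  shows "A = B"
  using has_derivative_unique[OF assms] by (simp add: blinfun_apply_inject)

text \<open>In a \<open>C1_family\<close> the continuity of \<open>F2 t\<close> is hidden in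
  \<open>C2_diffeo\<close>, whose witnesses are different variables; uniqueness of derivatives
  identifies them.\<close>

lemma C2_map_second_derivative_continuous:
  assumes "C2_map f" "\<And>x. (f has_derivative blinfun_apply (f' x)) (at x)"
    and "\<And>x. (f' has_derivative blinfun_apply (f'' x)) (at x)"
  shows "continuous_on UNIV f''"
proof -
  obtain g' g'' where g: "\<And>x. (f has_derivative blinfun_apply (g' x)) (at x)"
    "\<And>x. (g' has_derivative blinfun_apply (g'' x)) (at x)" "continuous_on UNIV g''"
    using assms(1) unfolding C2_map_def by blast
  have "f' = g'" using blinfun_derivative_unique[OF assms(2) g(1)] by (rule ext)
  then have "f'' = g''" using blinfun_derivative_unique[OF assms(3)] g(2) by (intro ext) blast
  then show ?thesis using g(3) by simp
qed

context kink
begin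

text \<open>With A and A' the first two derivatives of the field, these are its first and, on the
  arcs, second derivatives along the curve, and at the same time the initial rates of change of
  velocity and acceleration under any family.\<close>

definition "flow1 A j s = blinfun_apply (A (crv j s)) (tng j s)"
definition "flow2 A A' j s = blinfun_apply (blinfun_apply (A' (crv j s)) (tng j s)) (tng j s)
  + blinfun_apply (A (crv j s)) ((1 / \<sigma>) *\<^sub>R nrm j s)"

definition "gap_var \<xi> z = 2 * ((crv False (fst z) - crv True (snd z)) \<bullet> (\<xi> (crv False (fst z)) - \<xi> (crv True (snd z))))"
definition "radius_var A A' j s = rho2_deriv \<sigma> (tng j s) (flow1 A j s) ((1 / \<sigma>) *\<^sub>R nrm j s) (flow2 A A' j s)"

definition "thickness_var \<xi> A A' =
  min (INF z\<in>{z\<in>square. base_gap z = (INF z\<in>square. base_gap z)}. gap_var \<xi> z)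
    (min (INF s\<in>bend. radius_var A A' False s) (INF s\<in>bend. radius_var A A' True s)) / 2"

text \<open>The value does not depend on the family, because the initial time derivatives of its
  first two spatial derivatives are those of the field: \<open>G1 0 = A\<close> and
  \<open>G2 0 = A'\<close>.\<close>

lemma has_thickness_variation_base:
  assumes "0 < \<tau>"
    and A: "\<And>x. (\<xi> has_derivative blinfun_apply (A x)) (at x)"
    and A': "\<And>x. (A has_derivative blinfun_apply (A' x)) (at x)"
  shows "has_thickness_variation \<sigma> base \<xi> (thickness_var \<xi> A A')"
  unfolding has_thickness_variation_def
proof (intro allI impI)
  fix \<phi> assume "C1_family \<xi> \<phi>"
  then obtain e F1 F2 G0 G1 G2 where e: "0 < e"
    and *: "\<forall>t\<in>{-e<..<e}. C2_diffeo (\<phi> t) \<and>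
         (\<forall>x. (\<phi> t has_derivative blinfun_apply (F1 t x)) (at x) \<and>
              (F1 t has_derivative blinfun_apply (F2 t x)) (at x) \<and>
              ((\<lambda>u. \<phi> u x) has_vector_derivative G0 t x) (at t) \<and>
              ((\<lambda>u. F1 u x) has_vector_derivative G1 t x) (at t) \<and>
              ((\<lambda>u. F2 u x) has_vector_derivative G2 t x) (at t))"
    and cont: "continuous_on ({-e<..<e} \<times> UNIV) (\<lambda>(t, x). G0 t x)"
      "continuous_on ({-e<..<e} \<times> UNIV) (\<lambda>(t, x). G1 t x)"
      "continuous_on ({-e<..<e} \<times> UNIV) (\<lambda>(t, x). G2 t x)"
    and init: "\<phi> 0 = id" "G0 0 = \<xi>"
    unfolding C1_family_def by blast
  interpret kink_family \<tau> \<sigma> l \<phi> F1 F2 G0 G1 G2 e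
  proof
    show "0 < arcsin \<tau>" using arcsin_less_arcsin[of 0 \<tau>] \<open>0 < \<tau>\<close> tau by simp
    show "inj (\<phi> t)" if "t \<in> {-e<..<e}" for t
      using * that by (simp add: C2_diffeo_def bij_is_inj)
    show "continuous_on UNIV (F2 t)" if "t \<in> {-e<..<e}" for t
      by (rule C2_map_second_derivative_continuous[of "\<phi> t" "F1 t"]) (use * that in \<open>simp_all add: C2_diffeo_def\<close>)
  qed (use e * cont init in blast)+
  have G1_0: "G1 0 = A"
  proof
    fix x
    have "(G0 0 has_derivative blinfun_apply (G1 0 x)) (at x)"
      by (rule has_derivative_time_derivative[OF e F1 G0 G1 cont_G1])
    then show "G1 0 x = A x" using blinfun_derivative_unique A init(2) by blast
  qed
  have G2_0: "G2 0 = A'"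
  proof
    fix x
    have "(G1 0 has_derivative blinfun_apply (G2 0 x)) (at x)"
      by (rule has_derivative_time_derivative[OF e F2 G1 G2 cont_G2])
    then show "G2 0 x = A' x" using blinfun_derivative_unique A' G1_0 by blast
  qed
  have "gap_t 0 = base_gap" "gap_t' 0 = gap_var \<xi>"
    by (simp_all add: fun_eq_iff initial_values gap_var_def init)
  moreover have "vel_t' 0 = flow1 A" "acc_t' 0 = flow2 A A'"
    by (simp_all add: fun_eq_iff vel_t'_def acc_t'_def flow1_def flow2_def G1_0 G2_0)
  ultimately show "((\<lambda>t. real_of_ereal (thickness \<sigma> (\<phi> t ` base))) has_real_derivative thickness_var \<xi> A A') (at_right 0)"
    using has_derivative_thickness by (simp add: thickness_var_def radius_var_def)
qed

text \<open>The parenthesis is the first variation of curvature at a unit-speed curve of curvature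
  \<open>1 / \<sigma>\<close>. The factor \<open>- 2 * \<sigma>\<close> comes from differentiating
  the reciprocal of \<sigma> squared times curvature squared.\<close>

lemma radius_var_eq:
  "radius_var A A' j s = - 2 * \<sigma> * (flow2 A A' j s \<bullet> nrm j s - 2 / \<sigma> * (flow1 A j s \<bullet> tng j s))"
  using sigma_pos
  by (simp add: radius_var_def rho2_deriv_def inner_commute field_simps power2_eq_square)

text \<open>The contrapositive of criticality: if the least variation of all active constraints is
  nonnegative, so is each of them. The arcs then satisfy the sign condition of the balance, and the
  remaining tip terms combine into the variation of the distance of the tips.\<close>

lemma length_variation_nonneg:
  assumes \<xi>: "\<And>x. (\<xi> has_derivative blinfun_apply (A x)) (at x)"
    and A: "\<And>x. (A has_derivative blinfun_apply (A' x)) (at x)"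
    and cont: "continuous_on UNIV A'"
    and ends: "\<And>j. \<xi> (crv j l) \<bullet> tng j l = 0" "\<And>j. \<xi> (crv j (- l)) \<bullet> tng j (- l) = 0"
    and var: "0 < \<tau> \<Longrightarrow> 0 \<le> thickness_var \<xi> A A'"
  shows "0 \<le> integral {-l..l} (\<lambda>s. flow1 A False s \<bullet> tng False s) + integral {-l..l} (\<lambda>s. flow1 A True s \<bullet> tng True s)"
proof -
  have cont_\<xi>: "continuous_on S \<xi>" and cont_A: "continuous_on S A" for S
    using has_derivative_continuous[OF \<xi>] has_derivative_continuous[OF A]
    by (simp_all add: continuous_at_imp_continuous_on)
  have cont_nrm: "continuous_on S (nrm j)" for S j
    unfolding nrm_def[abs_def] by (intro continuous_on_emb continuous_intros continuous_on_ang)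
  have cont1: "continuous_on S (flow1 A j)" for S j
    unfolding flow1_def[abs_def]
    by (intro continuous_intros continuous_on_tng continuous_on_compose2[OF cont_A[of UNIV] continuous_on_crv]) auto
  have cont2: "continuous_on S (flow2 A A' j)" for S j
    unfolding flow2_def[abs_def]
    by (intro continuous_intros continuous_on_tng cont_nrm continuous_on_compose2[OF cont_A[of UNIV] continuous_on_crv]
        continuous_on_compose2[OF cont continuous_on_crv]) auto
  have derivs: "((\<lambda>s. \<xi> (crv j s)) has_vector_derivative flow1 A j s) (at s)" for j s
    unfolding flow1_def by (rule has_vector_derivative_compose_crv[OF \<xi>])
  have derivs2: "(flow1 A j has_vector_derivative flow2 A A' j s) (at s)" if "\<bar>s\<bar> < \<sigma> * \<alpha>" for j s
    using bounded_bilinear.has_vector_derivative[OF bounded_bilinear_blinfun_apply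
        has_vector_derivative_compose_crv[OF A] has_vector_derivative_tng_arc(1)[OF that]]
    unfolding flow1_def[abs_def] flow2_def by (simp add: add.commute)
  have active: "0 \<le> gap_var \<xi> (0, 0) \<and> (\<forall>j. \<forall>s\<in>bend. 0 \<le> radius_var A A' j s)" if "0 < \<tau>"
  proof -
    let ?Z = "{z\<in>square. base_gap z = (INF z\<in>square. base_gap z)}"
    from var[OF that] have nonneg: "0 \<le> (INF z\<in>?Z. gap_var \<xi> z)" "0 \<le> (INF s\<in>bend. radius_var A A' j s)" for j
      unfolding thickness_var_def by (cases j; simp)+
    have mem: "(0, 0) \<in> ?Z" using square_nonempty base_gap_tips by simp
    have "continuous_on square (gap_var \<xi>)"
      unfolding gap_var_def[abs_def]
      by (intro continuous_intros continuous_on_compose2[OF cont_\<xi>[of UNIV]]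
          continuous_on_compose2[OF continuous_on_crv[of UNIV]]) auto
    then have "bdd_below (gap_var \<xi> ` square)"
      using compact_square by (meson bounded_imp_bdd_below compact_continuous_image compact_imp_bounded)
    then have "bdd_below (gap_var \<xi> ` ?Z)" by (rule bdd_below_mono) auto
    from cINF_lower[OF this mem] have "0 \<le> gap_var \<xi> (0, 0)" using nonneg(1) by linarith
    moreover have "0 \<le> radius_var A A' j s" if "s \<in> bend" for j s
    proof -
      have "continuous_on bend (radius_var A A' j)"
        unfolding radius_var_eq[abs_def]
        by (intro continuous_intros cont1 cont2 cont_nrm continuous_on_tng)
      then have "bdd_below (radius_var A A' j ` bend)"
        using compact_bend by (meson bounded_imp_bdd_below compact_continuous_image compact_imp_bounded)
      from cINF_lower[OF this that] show ?thesis using nonneg(2)[of j] by linarith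
    qed
    ultimately show ?thesis by blast
  qed
  have "- 2 * \<tau> * (\<xi> (crv j 0) \<bullet> nrm j 0) \<le> integral {-l..l} (\<lambda>s. flow1 A j s \<bullet> tng j s)" for j
  proof (rule length_variation_bound[OF derivs derivs2 cont1])
    fix s assume s: "\<bar>s\<bar> < \<sigma> * \<alpha>"
    \<comment> \<open>The arc has interior points only for positive \<tau>, and only then is the
      assumption on \<open>thickness_var\<close> available.\<close>
    then have "\<tau> \<noteq> 0" by (auto simp: \<alpha>_def)
    moreover have "s \<in> bend" using s by (auto simp: bend_def)
    ultimately have "0 \<le> radius_var A A' j s" using active tau by simp
    then show "flow2 A A' j s \<bullet> nrm j s - 2 / \<sigma> * (flow1 A j s \<bullet> tng j s) \<le> 0"
      using sigma_pos by (simp add: radius_var_eq zero_le_mult_iff mult_le_0_iff)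
  qed (use ends in auto)
  from this[of False] this[of True]
  have "- 2 * \<tau> * (\<xi> (crv False 0) \<bullet> nrm False 0 + \<xi> (crv True 0) \<bullet> nrm True 0)
    \<le> integral {-l..l} (\<lambda>s. flow1 A False s \<bullet> tng False s) + integral {-l..l} (\<lambda>s. flow1 A True s \<bullet> tng True s)"
    by (simp add: algebra_simps)
  moreover have "0 \<le> - 2 * \<tau> * (\<xi> (crv False 0) \<bullet> nrm False 0 + \<xi> (crv True 0) \<bullet> nrm True 0)"
  proof (cases "\<tau> = 0")
    case False
    then have "0 \<le> gap_var \<xi> (0, 0)" using active tau by simp
    \<comment> \<open>The normals at the tips are opposite to each other, so that
      \<open>gap_var \<xi> (0, 0)\<close> is minus twice this sum.\<close>
    then have "\<xi> (crv False 0) \<bullet> nrm False 0 + \<xi> (crv True 0) \<bullet> nrm True 0 \<le> 0"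
      by (simp add: gap_var_def tips_distance inner_diff_right inner_commute)
    then show ?thesis using tau by (simp add: mult_nonneg_nonpos)
  qed simp
  ultimately show ?thesis by linarith
qed

section \<open>Criticality of the parametrized clasp\<close>

lemma length_variation_eq:
  assumes \<xi>: "\<And>x. (\<xi> has_derivative blinfun_apply (A x)) (at x)"
  shows "length_variation \<xi> (\<lambda>u. crv j (u - l)) (2 * l) = integral {-l..l} (\<lambda>s. flow1 A j s \<bullet> tng j s)"
proof -
  have shift: "((\<lambda>u. f (u - l)) has_vector_derivative f') (at u within S)"
    if "(f has_vector_derivative f') (at (u - l))" for f :: "real \<Rightarrow> space" and f' u S
  proof -
    have "((\<lambda>u. u - l) has_vector_derivative 1) (at u within S)"
      by (auto intro!: derivative_eq_intros)
    from vector_diff_chain_within[OF this has_vector_derivative_at_within[OF that]]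
    show ?thesis by (simp add: o_def)
  qed
  have \<gamma>: "vector_derivative (\<lambda>u. crv j (u - l)) (at u within {0..2 * l}) = tng j (u - l)"
    and \<xi>\<gamma>: "vector_derivative (\<lambda>u. \<xi> (crv j (u - l))) (at u within {0..2 * l}) = flow1 A j (u - l)"
    if u: "u \<in> {0..2 * l}" for u
  proof -
    have "((\<lambda>s. \<xi> (crv j s)) has_vector_derivative flow1 A j s) (at s)" for s
      unfolding flow1_def by (rule has_vector_derivative_compose_crv[OF \<xi>])
    from shift[OF this] show "vector_derivative (\<lambda>u. \<xi> (crv j (u - l))) (at u within {0..2 * l}) = flow1 A j (u - l)"
      using u l_pos by (intro vector_derivative_within_cbox[of 0 "2 * l", unfolded cbox_interval]) auto
    from shift[OF has_vector_derivative_crv]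
    show "vector_derivative (\<lambda>u. crv j (u - l)) (at u within {0..2 * l}) = tng j (u - l)"
      using u l_pos by (intro vector_derivative_within_cbox[of 0 "2 * l", unfolded cbox_interval]) auto
  qed
  have "length_variation \<xi> (\<lambda>u. crv j (u - l)) (2 * l) =
      integral {0..2 * l} (\<lambda>u. flow1 A j (u - l) \<bullet> tng j (u - l))"
    unfolding length_variation_def by (intro integral_cong) (simp add: \<gamma> \<xi>\<gamma>)
  also have "\<dots> = integral {-l..l} (\<lambda>s. flow1 A j s \<bullet> tng j s)"
    using integral_shift_Icc_real[of 0 "2 * l" "\<lambda>s. flow1 A j s \<bullet> tng j s" "- l"] by (simp add: o_def)
  finally show ?thesis .
qed

lemma C11_arc_crv: "C11_arc (\<lambda>u. crv j (u - l)) (2 * l)"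
  unfolding C11_arc_def
proof (intro conjI exI ballI)
  show "0 < 2 * l" using l_pos by simp
  show "inj_on (\<lambda>u. crv j (u - l)) {0..2 * l}"
  proof (rule inj_onI)
    fix x y assume "crv j (x - l) = crv j (y - l)"
    then have "x - l = y - l" by (rule injD[OF inj_crv])
    then show "x = y" by simp
  qed
  show "((\<lambda>u. crv j (u - l)) has_vector_derivative tng j (u - l)) (at u within {0..2 * l})" for u
  proof -
    have "((\<lambda>u. u - l) has_vector_derivative 1) (at u within {0..2 * l})"
      by (auto intro!: derivative_eq_intros)
    from vector_diff_chain_within[OF this has_vector_derivative_crv[of j "u - l"]]
    show ?thesis by (simp add: o_def)
  qed
  show "(2 / \<sigma>)-lipschitz_on {0..2 * l} (\<lambda>u. tng j (u - l))"
  proof (rule lipschitz_onI)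
    show "dist (tng j (x - l)) (tng j (y - l)) \<le> 2 / \<sigma> * dist x y" for x y
      using lipschitz_onD[OF tng_lipschitz[of UNIV j], of "x - l" "y - l"] by (simp add: dist_real_def)
  qed (use sigma_pos in simp)
qed simp

text \<open>The legs end at angle \<alpha> or its negative, with sine and cosine prescribed by
  \<tau>. Tangency of a field to a constraining plane thus means that its component along the curve
  vanishes there.\<close>

lemma normals:
  "face_normal1 \<tau> 1 = tng False l" "face_normal1 \<tau> (- 1) = - tng False (- l)"
  "face_normal2 \<tau> 1 = tng True l" "face_normal2 \<tau> (- 1) = - tng True (- l)"
  by (simp_all add: face_normal1_def face_normal2_def tng_def emb_def ang_l ang_uminus alpha(3,4)
      vec_eq_iff forall_3)

lemma endpoint_heights:
  assumes h: "l = h - (\<sigma> - 1/2) * \<tau> + \<sigma> * \<alpha>"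
  shows "crv j l \<bullet> tng j l = h" "crv j (- l) \<bullet> - tng j (- l) = h"
proof -
  have "(\<sigma> * S + r * C) * C + (\<sigma> - 1/2 - \<sigma> * C + r * S) * S = (\<sigma> - 1/2) * S + r * (S\<^sup>2 + C\<^sup>2)" for r S C
    by (simp add: power2_eq_square algebra_simps)
  from this[of \<tau> "l - \<sigma> * \<alpha>" "cos \<alpha>"] have "px l * cos \<alpha> + pz l * \<tau> = h"
    using sin_cos_squared_add[of \<alpha>] unfolding px_def pz_def slack_def ang_l alpha(3) by (simp add: h)
  then show "crv j l \<bullet> tng j l = h" "crv j (- l) \<bullet> - tng j (- l) = h"
    unfolding crv_uminus by (simp_all add: crv_def tng_def emb_simps ang_l ang_uminus alpha(3))
qed

lemma clasp_critical_base:
  assumes h: "l = h - (\<sigma> - 1/2) * \<tau> + \<sigma> * \<alpha>"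
  shows "clasp_critical h \<tau> \<sigma> base"
  unfolding clasp_critical_def
proof (rule exI[where x = "\<lambda>u. crv False (u - l)"], rule exI[where x = "2 * l"],
    rule exI[where x = "\<lambda>u. crv True (u - l)"], rule exI[where x = "2 * l"], intro conjI allI impI)
  have image: "(\<lambda>u. crv j (u - l)) ` {0..2 * l} = crv j ` {-l..l}" for j
  proof -
    have "{-l..l} = (\<lambda>u. u - l) ` {0..2 * l}"
      using image_add_atLeastAtMost'[of "- l" 0 "2 * l"] by simp
    then show ?thesis by (simp only: image_image)
  qed
  show "C11_arc (\<lambda>u. crv False (u - l)) (2 * l)" "C11_arc (\<lambda>u. crv True (u - l)) (2 * l)"
    by (rule C11_arc_crv)+
  show "(\<lambda>u. crv False (u - l)) ` {0..2 * l} \<inter> (\<lambda>u. crv True (u - l)) ` {0..2 * l} = {}"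
    using crv_neq[of False] by auto
  show "base = (\<lambda>u. crv False (u - l)) ` {0..2 * l} \<union> (\<lambda>u. crv True (u - l)) ` {0..2 * l}"
    by (simp only: image base_def)
  show "crv False (0 - l) \<bullet> face_normal1 \<tau> (- 1) = h" "crv False (2 * l - l) \<bullet> face_normal1 \<tau> 1 = h"
    "crv True (0 - l) \<bullet> face_normal2 \<tau> (- 1) = h" "crv True (2 * l - l) \<bullet> face_normal2 \<tau> 1 = h"
    using endpoint_heights[OF h] by (simp_all add: normals)
  show "thickness \<sigma> base = 1" by (rule thickness_base)
next
  fix \<xi>
  assume \<xi>: "C2_map \<xi> \<and>
      \<xi> (crv False (0 - l)) \<bullet> face_normal1 \<tau> (- 1) = 0 \<and> \<xi> (crv False (2 * l - l)) \<bullet> face_normal1 \<tau> 1 = 0 \<and>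
      \<xi> (crv True (0 - l)) \<bullet> face_normal2 \<tau> (- 1) = 0 \<and> \<xi> (crv True (2 * l - l)) \<bullet> face_normal2 \<tau> 1 = 0 \<and>
      length_variation \<xi> (\<lambda>u. crv False (u - l)) (2 * l) + length_variation \<xi> (\<lambda>u. crv True (u - l)) (2 * l) < 0"
  then obtain A A' where A: "\<And>x. (\<xi> has_derivative blinfun_apply (A x)) (at x)"
    "\<And>x. (A has_derivative blinfun_apply (A' x)) (at x)" "continuous_on UNIV A'"
    unfolding C2_map_def by blast
  have "\<xi> (crv j l) \<bullet> tng j l = 0" "\<xi> (crv j (- l)) \<bullet> tng j (- l) = 0" for j
    using \<xi> by (cases j; simp add: normals)+
  \<comment> \<open>Negative length variation contradicts \<open>length_variation_nonneg\<close>
    both for \<tau> = 0, where its last premise is vacuous, and for nonnegative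
    \<open>thickness_var\<close>.\<close>
  then have "0 < \<tau> \<and> thickness_var \<xi> A A' < 0"
    using length_variation_nonneg[OF A] \<xi> unfolding length_variation_eq[OF A(1)] by (meson not_less)
  then show "\<exists>D<0. has_thickness_variation \<sigma> base \<xi> D"
    using has_thickness_variation_base[OF _ A(1,2)] by blast
qed

end

theorem proposition7p5:
  fixes \<tau> \<sigma> :: real
  assumes "0 \<le> \<tau>" and "\<tau> \<le> 1" and "1 \<le> \<sigma>"
  shows "\<forall>\<^sub>F h in at_top. clasp_critical h \<tau> \<sigma> (symmetrize (kinky_curve h \<tau> \<sigma>))"
  using eventually_gt_at_top[of "(\<sigma> - 1/2) * \<tau>"]
proof eventually_elim
  case (elim h)
  \<comment> \<open>Half the length of a component. The lower bound on h makes the straight legs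
    nondegenerate, which is the last assumption of the locale.\<close>
  define l where "l = h - (\<sigma> - 1/2) * \<tau> + \<sigma> * arcsin \<tau>"
  interpret kink \<tau> \<sigma> l
    by unfold_locales (use assms elim in \<open>auto simp: l_def\<close>)
  have "l = h - (\<sigma> - 1/2) * \<tau> + \<sigma> * \<alpha>" by (simp add: l_def \<alpha>_def)
  then show ?case
    using clasp_critical_base kinky_curve_eq symmetrize_eq by simp
qed

end
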